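(* Let $s\in(0,2)$. The random variable $w$ (the last-passage time of the continuous model with index $s$) is almost surely finite. If $p=1$ and the distribution function $F$ of $v$ satisfies $$\frac{1-F(tx)}{1-F(x)}\to t^{-s}\quad\text{as }x\to\infty,\ \text{for every }t>0,$$ then $\dfrac{w_{0,n}}{b_n}\to w$ in distribution as $n\to\infty$.
   Context: Discrete model ($p=1$). For integers $i<j$ let $v_{i,j}>0$ be i.i.d. with the law of $v$, with distribution function $F$. All directed edges $(i,j)$, $i<j$, are present. $w_{0,n}$ is the maximum, over all sequences $0=i_0<i_1<\dots<i_l=n$ of integers, of $\sum_{k=1}^l v_{i_{k-1},i_k}$. Scaling. $b_n=F^{(-1)}\bigl(1-1/\binom{n+1}{2}\bigr)$, where $F^{(-1)}(u)=\inf\{x:F(x)\ge u\}$. Continuous model with index $s$. Let $W_1,W_2,\dots$ be i.i.d. exponential random variables with mean $1$ and $M_k=(W_1+\dots+W_k)^{-1/s}$. Let $U_1,U_2,\dots$ and $V_1,V_2,\dots$ be i.i.d. uniform on $[0,1]$, all independent of each other and of the $W_k$, and let $Y_i=(\min(U_i,V_i),\max(U_i,V_i))$. Two edges $x=(a,b)$, $y=(a',b')$ (with $a<b$, $a'<b'$) are compatible, written $x\sim y$, if $b\le a'$ or $b'\le a$. Let $\mathcal{C}$ be the (random) collection of all $A\subset\{1,2,\dots\}$ such that $Y_i\sim Y_j$ for all distinct $i,j\in A$, and $$w=\sup_{A\in\mathcal{C}}\sum_{i\in A}M_i .$$ *)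

theory Defs
  imports "HOL-Probability.Probability"
begin

locale discrete_model = prob_space M
  for M :: "'a measure" and v :: "int \<Rightarrow> int \<Rightarrow> 'a \<Rightarrow> real" and F :: "real \<Rightarrow> real" +
  assumes indep: "indep_vars (\<lambda>_. borel) (\<lambda>(i, j). v i j) {(i, j). i < j}"
    and pos: "i < j \<Longrightarrow> AE \<omega> in M. v i j \<omega> > 0"
    and cdf_eq: "i < j \<Longrightarrow> cdf (distr M borel (v i j)) = F"

text \<open>The set under the maximum is finite: only the values \<open>i 0, \<dots>, i l\<close>, all of them in
  \<open>{m..n}\<close>, enter the sum.  It is nonempty iff \<open>m \<le> n\<close>.\<close>

definition last_passage :: "(int \<Rightarrow> int \<Rightarrow> 'a \<Rightarrow> real) \<Rightarrow> int \<Rightarrow> int \<Rightarrow> 'a \<Rightarrow> real" where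
  "last_passage v m n \<omega> =
     Max {(\<Sum>k=1..l. v (i (k - 1)) (i k) \<omega>) | (l :: nat) (i :: nat \<Rightarrow> int).
            i 0 = m \<and> i l = n \<and> strict_mono_on {0..l} i}"

definition quantile :: "(real \<Rightarrow> real) \<Rightarrow> real \<Rightarrow> real" where
  "quantile F u = Inf {x. F x \<ge> u}"

text \<open>For \<open>n \<le> 1\<close> the argument of the quantile function is not in \<open>(0, 1)\<close> and the value is
  meaningless; only large \<open>n\<close> matter.\<close>

definition scaling :: "(real \<Rightarrow> real) \<Rightarrow> nat \<Rightarrow> real" where
  "scaling F n = quantile F (1 - 1 / real ((n + 1) choose 2))"

text \<open>All families are indexed by the positive integers; the values at index \<open>0\<close> are irrelevant.
  Independence is joint independence of all the \<open>W k\<close>, \<open>U k\<close> and \<open>V k\<close>, expressed through a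
  single family over a disjoint sum of index sets.\<close>

locale continuous_model = prob_space N
  for N :: "'b measure" and W U V :: "nat \<Rightarrow> 'b \<Rightarrow> real" +
  assumes indep: "indep_vars (\<lambda>_. borel) (case_sum W (case_sum U V))
                    ({1..} <+> ({1..} <+> {1..}))"
    and W_exponential: "k \<ge> 1 \<Longrightarrow> distributed N lborel (W k) (exponential_density 1)"
    and U_uniform: "k \<ge> 1 \<Longrightarrow> distr N borel (U k) = uniform_measure lborel {0..1}"
    and V_uniform: "k \<ge> 1 \<Longrightarrow> distr N borel (V k) = uniform_measure lborel {0..1}"

definition edge_weight :: "real \<Rightarrow> (nat \<Rightarrow> 'b \<Rightarrow> real) \<Rightarrow> nat \<Rightarrow> 'b \<Rightarrow> real" where
  "edge_weight s W k \<omega> = (\<Sum>i=1..k. W i \<omega>) powr (- 1 / s)"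

definition edge :: "(nat \<Rightarrow> 'b \<Rightarrow> real) \<Rightarrow> (nat \<Rightarrow> 'b \<Rightarrow> real) \<Rightarrow> nat \<Rightarrow> 'b \<Rightarrow> real \<times> real" where
  "edge U V i \<omega> = (min (U i \<omega>) (V i \<omega>), max (U i \<omega>) (V i \<omega>))"

definition compatible :: "real \<times> real \<Rightarrow> real \<times> real \<Rightarrow> bool" where
  "compatible x y \<longleftrightarrow> snd x \<le> fst y \<or> snd y \<le> fst x"

definition compatible_sets :: "(nat \<Rightarrow> 'b \<Rightarrow> real) \<Rightarrow> (nat \<Rightarrow> 'b \<Rightarrow> real) \<Rightarrow> 'b \<Rightarrow> nat set set" where
  "compatible_sets U V \<omega> =
     {A. A \<subseteq> {1..} \<and> pairwise (\<lambda>i j. compatible (edge U V i \<omega>) (edge U V j \<omega>)) A}"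

text \<open>The sets \<open>A\<close> may be infinite, so the sum and the supremum are taken in the extended
  nonnegative reals.\<close>

definition cont_last_passage ::
    "real \<Rightarrow> (nat \<Rightarrow> 'b \<Rightarrow> real) \<Rightarrow> (nat \<Rightarrow> 'b \<Rightarrow> real) \<Rightarrow> (nat \<Rightarrow> 'b \<Rightarrow> real) \<Rightarrow> 'b \<Rightarrow> ennreal" where
  "cont_last_passage s W U V \<omega> =
     (SUP A\<in>compatible_sets U V \<omega>. \<Sum>\<^sub>\<infinity>i\<in>A. ennreal (edge_weight s W i \<omega>))"

end

theory Submission
  imports Defs
begin

text \<open>
  The discrete model is embedded in the continuous one.  Read \<open>(\<Gamma>\<^sub>k, U\<^sub>k, V\<^sub>k)\<close>, with
  \<open>\<Gamma>\<^sub>k = W\<^sub>1 + \<dots> + W\<^sub>k\<close>, as a marked Poisson process and split the unit square into \<open>(n + 1)\<^sup>2\<close> equal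
  cells; up to order, the off-diagonal cells are the edges of the complete graph on \<open>{0..n}\<close>, each of
  mass \<open>r = 2 / (n + 1)\<^sup>2\<close>.  By thinning, the first arrival times \<open>\<xi>\<^sub>e\<close> in the cells are independent and
  exponential with rate \<open>r\<close>, so that the variables \<open>F\<^sup>-\<^sup>1 (exp (- r \<xi>\<^sub>e))\<close> have exactly the law of the
  discrete weights.  For each fixed \<open>k\<close>, regular variation makes the rescaled weight read off \<open>\<Gamma>\<^sub>k\<close>
  converge to \<open>\<Gamma>\<^sub>k powr (- 1 / s)\<close>, and compatibility of finitely many cells agrees with
  compatibility of the limiting edges for large \<open>n\<close>.

  What remains is the contribution of the points with large index.  A generating function bounds the
  number of compatible sets of \<open>l\<close> edges by \<open>(2 e n\<^sup>2 / l\<^sup>2)\<^sup>l\<close>, so with high probability, uniformly in \<open>n\<close>,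
  a compatible set contains at most a constant times \<open>sqrt m\<close> of the first \<open>m\<close> points.  As \<open>s < 2\<close>, the
  terms \<open>m powr (- 1 / s')\<close> with \<open>s < s' < 2\<close> provided by a Potter bound are summable along such sparse
  sets.
\<close>

section \<open>Chains of edges and last-passage times\<close>

text \<open>Both models live on one probability space, so convergence in distribution follows from
  convergence in probability of the embedded passage times. Poissonization makes the embedding exact
  for every \<open>n \<ge> 1\<close>: with a fixed number of points the cells would not be
  independent. Atoms of \<open>F\<close> cause no trouble, because only the generalized inverse is
  used.

  The threshold \<open>s < 2\<close> enters twice. The \<open>j\<close>-th index used by a
  compatible set is at least of order \<open>j^2\<close>, and the sum of
  \<open>j powr (- 2 / s)\<close> converges for \<open>s < 2\<close>. Moreover, the Potter bound
  says nothing about weights of bounded size; these are at most a constant \<open>K\<close>, a chain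
  has at most \<open>n\<close> edges, and \<open>K * n / b_n\<close> vanishes because
  \<open>b_n\<close> outgrows \<open>n\<close>.

  A single combinatorial estimate serves both models: finiteness of \<open>w\<close> is read off
  from the counting of chains in the grid, by letting the mesh tend to 0.\<close>

definition chain_compat :: "'a::linorder \<times> 'a \<Rightarrow> 'a \<times> 'a \<Rightarrow> bool" where
  "chain_compat x y \<longleftrightarrow> snd x \<le> fst y \<or> snd y \<le> fst x"

definition edges :: "nat \<Rightarrow> (int \<times> int) set" where
  "edges n = {(i, j). 0 \<le> i \<and> i < j \<and> j \<le> int n}"

text \<open>Gaps are allowed. Unlike the family of paths, this family is closed under subsets, and
  its members are exactly what a compatible set of points can occupy in the grid.\<close>

definition edge_chains :: "nat \<Rightarrow> (int \<times> int) set set" where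
  "edge_chains n = {S. S \<subseteq> edges n \<and> pairwise chain_compat S}"

lemma finite_edges [simp]: "finite (edges n)"
proof (rule finite_subset)
  show "edges n \<subseteq> {0..int n} \<times> {0..int n}" by (auto simp: edges_def)
qed simp

lemma finite_chains [simp]: "finite (edge_chains n)"
  by (rule finite_subset[of _ "Pow (edges n)"]) (auto simp: edge_chains_def)

lemma finite_chain: "S \<in> edge_chains n \<Longrightarrow> finite S"
  by (auto simp: edge_chains_def intro: finite_subset[OF _ finite_edges])

lemma chains_0 [simp]: "edge_chains 0 = {{}}"
  by (auto simp: edge_chains_def edges_def)

text \<open>Two edges with the same right endpoint overlap, so at most one edge ends at the last
  vertex. If it is \<open>(i, Suc j)\<close>, every other edge has to end at or before
  \<open>i\<close>, which leaves a chain on \<open>{0..i}\<close>. The last clause of the second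
  case makes cardinalities increase by exactly one.\<close>

lemma chains_Suc_cases:
  assumes "S \<in> edge_chains (Suc j)"
  obtains "S \<in> edge_chains j"
  | i S' where "i \<le> j" "S' \<in> edge_chains i" "S = insert (int i, int (Suc j)) S'"
      "(int i, int (Suc j)) \<notin> S'"
proof (cases "\<exists>i. (i, int (Suc j)) \<in> S")
  case False
  have "S \<in> edge_chains j"
    unfolding edge_chains_def edges_def
  proof (safe)
    fix a b assume ab: "(a, b) \<in> S"
    with assms have "0 \<le> a \<and> a < b \<and> b \<le> int (Suc j)" by (auto simp: edge_chains_def edges_def)
    moreover have "b \<noteq> int (Suc j)" using ab False by auto
    ultimately show "0 \<le> a" "a < b" "b \<le> int j" by auto
  next
    show "pairwise chain_compat S" using assms by (auto simp: edge_chains_def)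
  qed
  then show ?thesis by (rule that(1))
next
  case True
  then obtain i where i: "(i, int (Suc j)) \<in> S" by auto
  have rng: "0 \<le> i" "i < int (Suc j)" using assms i by (auto simp: edge_chains_def edges_def)
  define S' where "S' = S - {(i, int (Suc j))}"
  have "S' \<in> edge_chains (nat i)"
    unfolding edge_chains_def edges_def
  proof safe
    fix a b assume ab: "(a, b) \<in> S'"
    with assms have *: "0 \<le> a \<and> a < b \<and> b \<le> int (Suc j)"
      by (auto simp: edge_chains_def edges_def S'_def)
    have "chain_compat (a, b) (i, int (Suc j))"
      using assms i ab by (auto simp: edge_chains_def pairwise_def S'_def)
    then have "b \<le> i" using * by (auto simp: chain_compat_def)
    then show "0 \<le> a" "a < b" "b \<le> int (nat i)" using * rng by auto
  next
    show "pairwise chain_compat S'"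
      using assms by (auto simp: edge_chains_def S'_def pairwise_def)
  qed
  moreover have "S = insert (int (nat i), int (Suc j)) S'" using i rng by (auto simp: S'_def)
  moreover have "(int (nat i), int (Suc j)) \<notin> S'" using rng by (auto simp: S'_def)
  ultimately show ?thesis using that(2)[of "nat i" S'] rng by auto
qed

lemma card_chain_le: "S \<in> edge_chains n \<Longrightarrow> card S \<le> n"
proof (induction n arbitrary: S rule: less_induct)
  case (less n)
  show ?case
  proof (cases n)
    case 0 then show ?thesis using less.prems by simp
  next
    case (Suc j)
    from less.prems[unfolded Suc] show ?thesis
    proof (cases rule: chains_Suc_cases)
      case 1
      then show ?thesis using less.IH[of j S] Suc by auto
    next
      case (2 i S')
      then have "card S = Suc (card S')" using finite_chain by auto
      then show ?thesis using less.IH[of i S'] 2 Suc by auto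
    qed
  qed
qed

lemma sum_UN_le:
  fixes f :: "'a \<Rightarrow> real"
  assumes "finite I" "\<And>i. i \<in> I \<Longrightarrow> finite (G i)" "\<And>x. 0 \<le> f x"
  shows "sum f (\<Union>i\<in>I. G i) \<le> (\<Sum>i\<in>I. sum f (G i))"
  using assms(1,2)
proof (induction I)
  case (insert i I)
  have "sum f (G i \<union> (\<Union>i\<in>I. G i)) \<le> sum f (G i) + sum f (\<Union>i\<in>I. G i)"
    using insert assms(3) by (subst sum_Un) (auto intro!: sum_nonneg)
  then show ?case using insert by auto
qed simp

text \<open>Since \<open>a\<^sup>2 = z (1 + a)\<close>, the recursion obtained by removing the last edge of a chain
  preserves the bound \<open>(1 + a)^n\<close>.\<close>

lemma chains_generating_function:
  fixes a :: real
  assumes a: "a > 0"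
  shows "(\<Sum>S\<in>edge_chains n. (a^2 / (1 + a)) ^ card S) \<le> (1 + a) ^ n"
proof (induction n rule: less_induct)
  case (less n)
  define z where "z = a^2 / (1 + a)"
  have z: "z \<ge> 0" using a by (auto simp: z_def)
  show ?case unfolding z_def[symmetric]
  proof (cases n)
    case 0 then show "(\<Sum>S\<in>edge_chains n. z ^ card S) \<le> (1 + a) ^ n" by simp
  next
    case (Suc j)
    define G where "G i = (\<lambda>S'. insert (int i, int (Suc j)) S') ` {S'\<in>edge_chains i. (int i, int (Suc j)) \<notin> S'}" for i
    have finG: "finite (G i)" for i by (simp add: G_def)
    have "edge_chains n \<subseteq> edge_chains j \<union> (\<Union>i\<in>{..j}. G i)"
    proof
      fix S assume "S \<in> edge_chains n"
      then have "S \<in> edge_chains (Suc j)" using Suc by simp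
      then show "S \<in> edge_chains j \<union> (\<Union>i\<in>{..j}. G i)"
        by (cases rule: chains_Suc_cases) (auto simp: G_def)
    qed
    then have "(\<Sum>S\<in>edge_chains n. z ^ card S) \<le> (\<Sum>S\<in>edge_chains j \<union> (\<Union>i\<in>{..j}. G i). z ^ card S)"
      using z finG by (intro sum_mono2) auto
    also have "\<dots> \<le> (\<Sum>S\<in>edge_chains j. z ^ card S) + (\<Sum>S\<in>(\<Union>i\<in>{..j}. G i). z ^ card S)"
      using z finG by (subst sum_Un) (auto intro!: sum_nonneg)
    also have "(\<Sum>S\<in>(\<Union>i\<in>{..j}. G i). z ^ card S) \<le> (\<Sum>i\<in>{..j}. \<Sum>S\<in>G i. z ^ card S)"
      using z finG by (intro sum_UN_le) auto
    also have "\<dots> \<le> (\<Sum>i\<in>{..j}. z * (1 + a) ^ i)"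
    proof (intro sum_mono)
      fix i assume "i \<in> {..j}"
      have "(\<Sum>S\<in>G i. z ^ card S) \<le> (\<Sum>S'\<in>{S'\<in>edge_chains i. (int i, int (Suc j)) \<notin> S'}. z ^ card (insert (int i, int (Suc j)) S'))"
        unfolding G_def using z by (intro sum_image_le[where g="\<lambda>S. z ^ card S", unfolded o_def]) auto
      also have "\<dots> = (\<Sum>S'\<in>{S'\<in>edge_chains i. (int i, int (Suc j)) \<notin> S'}. z * z ^ card S')"
        by (intro sum.cong) (auto simp: finite_chain)
      also have "\<dots> \<le> (\<Sum>S'\<in>edge_chains i. z * z ^ card S')"
        using z by (intro sum_mono2) auto
      also have "\<dots> = z * (\<Sum>S'\<in>edge_chains i. z ^ card S')" by (simp add: sum_distrib_left)
      also have "\<dots> \<le> z * (1 + a) ^ i"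
        using less.IH[of i] \<open>i \<in> {..j}\<close> Suc z by (intro mult_left_mono) (auto simp: z_def)
      finally show "(\<Sum>S\<in>G i. z ^ card S) \<le> z * (1 + a) ^ i" .
    qed
    also have "\<dots> = z * (((1 + a) ^ Suc j - 1) / a)"
    proof -
      have "(\<Sum>i\<le>j. (1 + a) ^ i) = ((1 + a) ^ Suc j - 1) / a"
        using geometric_sum[of "1 + a" "Suc j"] a by (simp add: lessThan_Suc_atMost)
      then show ?thesis by (simp add: sum_distrib_left[symmetric])
    qed
    also have "\<dots> \<le> z * ((1 + a) ^ Suc j / a)"
      using z a by (intro mult_left_mono divide_right_mono) auto
    also have "\<dots> = a * (1 + a) ^ j"
    proof -
      have "z * ((1 + a) ^ Suc j / a) = (z * (1 + a)) * (1 + a) ^ j / a" by simp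
      also have "z * (1 + a) = a^2" using a by (simp add: z_def)
      finally show ?thesis using a by (simp add: power2_eq_square)
    qed
    also have "(\<Sum>S\<in>edge_chains j. z ^ card S) \<le> (1 + a) ^ j"
      using less.IH[of j] Suc by (simp add: z_def)
    finally show "(\<Sum>S\<in>edge_chains n. z ^ card S) \<le> (1 + a) ^ n" by (simp add: Suc algebra_simps)
  qed
qed

text \<open>Coefficient extraction: with \<open>z = a^2 / (1 + a)\<close>, the number of chains of
  size \<open>l\<close> is at most the generating function divided by \<open>z ^ l\<close>. The
  choice \<open>a = l / n\<close> bounds \<open>(1 + a) ^ n\<close> by \<open>exp 1 ^ l\<close>; the
  factor 2 comes from \<open>a^2 / 2 \<le> z\<close>, valid since \<open>a \<le> 1\<close> (for
  \<open>l > n\<close> there are no chains).\<close>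

lemma card_chains_le:
  assumes l: "l \<ge> 1"
  shows "real (card {S\<in>edge_chains n. card S = l}) \<le> (2 * exp 1 * (real n)\<^sup>2 / (real l)\<^sup>2) ^ l"
proof (cases "l \<le> n")
  case False
  then have "{S\<in>edge_chains n. card S = l} = {}" using card_chain_le by force
  then show ?thesis by (simp only: card.empty of_nat_0) simp
next
  case True
  define a where "a = real l / real n"
  have a: "0 < a" "a \<le> 1" using True l by (auto simp: a_def)
  define z where "z = a^2 / (1 + a)"
  have z: "z > 0" using a by (auto simp: z_def)
  have "real (card {S\<in>edge_chains n. card S = l}) * z ^ l = (\<Sum>S\<in>{S\<in>edge_chains n. card S = l}. z ^ card S)"
    by simp
  also have "\<dots> \<le> (\<Sum>S\<in>edge_chains n. z ^ card S)"
    using z by (intro sum_mono2) auto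
  also have "\<dots> \<le> (1 + a) ^ n" unfolding z_def by (rule chains_generating_function[OF a(1)])
  also have "\<dots> \<le> exp a ^ n" using a by (intro power_mono) auto
  also have "\<dots> = exp 1 ^ l"
    using True l by (simp add: exp_of_nat_mult[symmetric] a_def)
  finally have "real (card {S\<in>edge_chains n. card S = l}) \<le> exp 1 ^ l / z ^ l"
    using z by (simp add: field_simps)
  also have "\<dots> = (exp 1 / z) ^ l" by (simp add: power_divide)
  also have "\<dots> \<le> (2 * exp 1 * (real n)\<^sup>2 / (real l)\<^sup>2) ^ l"
  proof (intro power_mono)
    have "a^2 / 2 \<le> z" unfolding z_def using a by (intro divide_left_mono) auto
    then have "exp 1 / z \<le> exp 1 / (a^2 / 2)"
      using a z by (intro divide_left_mono) auto
    also have "\<dots> = 2 * exp 1 * (real n)\<^sup>2 / (real l)\<^sup>2"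
      by (simp add: a_def power_divide)
    finally show "exp 1 / z \<le> 2 * exp 1 * (real n)\<^sup>2 / (real l)\<^sup>2" .
  qed (use z in auto)
  finally show ?thesis .
qed

section \<open>Paths from 0 to \<open>n\<close> and the last-passage functional\<close>

definition path_edges :: "nat \<Rightarrow> (nat \<Rightarrow> int) \<Rightarrow> (int \<times> int) set" where
  "path_edges l i = (\<lambda>k. (i (k - 1), i k)) ` {1..l}"

definition paths :: "nat \<Rightarrow> (int \<times> int) set set" where
  "paths n = {path_edges l i | l i. i 0 = 0 \<and> i l = int n \<and> strict_mono_on {0..l} i}"

lemma sum_path_edges:
  assumes "strict_mono_on {0..l} (i :: nat \<Rightarrow> int)"
  shows "(\<Sum>e\<in>path_edges l i. x e) = (\<Sum>k=1..l. x (i (k - 1), i k))"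
proof -
  have "inj_on (\<lambda>k. (i (k - 1), i k)) {1..l}"
  proof (rule inj_onI)
    fix k k' assume k: "k \<in> {1..l}" "k' \<in> {1..l}" "(i (k - 1), i k) = (i (k' - 1), i k')"
    then show "k = k'"
      using strict_mono_on_imp_inj_on[OF assms] by (auto simp: inj_on_def)
  qed
  then show ?thesis unfolding path_edges_def by (subst sum.reindex) (auto simp: o_def)
qed

lemma paths_subset_chains: "paths n \<subseteq> edge_chains n"
proof
  fix S assume "S \<in> paths n"
  then obtain l i where S: "S = path_edges l i" and i: "i 0 = 0" "i l = int n"
    and sm: "strict_mono_on {0..l} i" by (auto simp: paths_def)
  have mono: "i a \<le> i b" if "a \<le> b" "b \<le> l" for a b
    using strict_mono_on_leD[OF sm, of a b] that by auto
  have less: "i a < i b" if "a < b" "b \<le> l" for a b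
    using strict_mono_onD[OF sm, of a b] that by auto
  show "S \<in> edge_chains n"
    unfolding edge_chains_def
  proof (intro CollectI conjI)
    show "S \<subseteq> edges n"
    proof
      fix e assume "e \<in> S"
      then obtain k where k: "k \<in> {1..l}" "e = (i (k - 1), i k)" by (auto simp: S path_edges_def)
      then have "i 0 \<le> i (k - 1)" "i (k - 1) < i k" "i k \<le> i l"
        using mono[of 0 "k - 1"] less[of "k - 1" k] mono[of k l] by auto
      then show "e \<in> edges n" using k i by (auto simp: edges_def)
    qed
    show "pairwise chain_compat S"
    proof (rule pairwiseI)
      fix e f assume "e \<in> S" "f \<in> S" "e \<noteq> f"
      then obtain k k' where k: "k \<in> {1..l}" "e = (i (k - 1), i k)"
        "k' \<in> {1..l}" "f = (i (k' - 1), i k')" "k \<noteq> k'" unfolding S path_edges_def by blast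
      show "chain_compat e f"
      proof (cases "k < k'")
        case True
        then have "i k \<le> i (k' - 1)" using mono[of k "k' - 1"] k by auto
        then show ?thesis using k by (auto simp: chain_compat_def)
      next
        case False
        then have "i k' \<le> i (k - 1)" using mono[of k' "k - 1"] k by auto
        then show ?thesis using k by (auto simp: chain_compat_def)
      qed
    qed
  qed
qed

lemma finite_paths [simp]: "finite (paths n)"
  using finite_subset[OF paths_subset_chains] by simp

lemma last_passage_eq_Max:
  "last_passage v 0 (int n) \<omega> = Max ((\<lambda>S. \<Sum>(i, j)\<in>S. v i j \<omega>) ` paths n)"
proof -
  have "{(\<Sum>k=1..l. v (i (k - 1)) (i k) \<omega>) | (l :: nat) (i :: nat \<Rightarrow> int).
            i 0 = 0 \<and> i l = int n \<and> strict_mono_on {0..l} i} = (\<lambda>S. \<Sum>(i, j)\<in>S. v i j \<omega>) ` paths n"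
    (is "?A = ?B")
  proof (intro set_eqI iffI)
    fix x assume "x \<in> ?A"
    then show "x \<in> ?B"
    proof (elim CollectE exE conjE)
      fix l :: nat and i :: "nat \<Rightarrow> int"
      assume i: "i 0 = 0" "i l = int n" and sm: "strict_mono_on {0..l} i"
        and x: "x = (\<Sum>k=1..l. v (i (k - 1)) (i k) \<omega>)"
      have "path_edges l i \<in> paths n" using i sm by (auto simp: paths_def)
      moreover have "x = (\<Sum>(i, j)\<in>path_edges l i. v i j \<omega>)"
        using sum_path_edges[OF sm, of "\<lambda>(i, j). v i j \<omega>"] x by simp
      ultimately show "x \<in> ?B" by auto
    qed
  next
    fix x assume "x \<in> ?B"
    then obtain l i where "i 0 = 0" "i l = int n" and sm: "strict_mono_on {0..l} i"
      and x: "x = (\<Sum>(i, j)\<in>path_edges l i. v i j \<omega>)" by (auto simp: paths_def)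
    moreover have "x = (\<Sum>k=1..l. v (i (k - 1)) (i k) \<omega>)"
      using sum_path_edges[OF sm, of "\<lambda>(i, j). v i j \<omega>"] x by simp
    ultimately show "x \<in> ?A" using sm by (intro CollectI exI conjI)
  qed
  then show ?thesis by (simp add: last_passage_def)
qed

lemma paths_extend:
  assumes "P \<in> paths i" "i < j"
  shows "insert (int i, int j) P \<in> paths j" "(int i, int j) \<notin> P"
proof -
  from assms obtain l f where P: "P = path_edges l f" and f: "f 0 = 0" "f l = int i"
    and sm: "strict_mono_on {0..l} f" by (auto simp: paths_def)
  define g where "g = f(Suc l := int j)"
  have "strict_mono_on {0..Suc l} g"
  proof (rule strict_mono_onI)
    fix r s assume rs: "r \<in> {0..Suc l}" "s \<in> {0..Suc l}" "r < s"
    show "g r < g s"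
    proof (cases "s = Suc l")
      case True
      have "f r \<le> f l" using strict_mono_on_leD[OF sm, of r l] rs by auto
      then show ?thesis using True rs f assms by (auto simp: g_def)
    next
      case False
      then show ?thesis using strict_mono_onD[OF sm, of r s] rs by (auto simp: g_def)
    qed
  qed
  moreover have "g 0 = 0" "g (Suc l) = int j" using f by (auto simp: g_def)
  moreover have "path_edges (Suc l) g = insert (int i, int j) P"
  proof -
    have "{1..Suc l} = insert (Suc l) {1..l}" by auto
    moreover have "(\<lambda>k. (g (k - 1), g k)) ` {1..l} = (\<lambda>k. (f (k - 1), f k)) ` {1..l}"
      by (intro image_cong) (auto simp: g_def)
    ultimately show ?thesis using f by (auto simp: path_edges_def P g_def)
  qed
  ultimately show "insert (int i, int j) P \<in> paths j" unfolding paths_def by (auto intro!: exI)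
  have "P \<subseteq> edges i" using paths_subset_chains assms by (auto simp: edge_chains_def)
  then show "(int i, int j) \<notin> P" using assms by (auto simp: edges_def)
qed

lemma empty_in_paths_0: "{} \<in> paths 0"
proof -
  have "path_edges 0 (\<lambda>_. 0) = {}" by (simp add: path_edges_def)
  moreover have "strict_mono_on {0..0} (\<lambda>_::nat. 0::int)" by (auto simp: strict_mono_on_def)
  ultimately show ?thesis unfolding paths_def by force
qed

text \<open>Recursion on the last edge; the gaps are bridged by extra edges. For nonnegative weights
  the last-passage time is therefore also a maximum over all chains (\<open>passage_ge\<close>,
  \<open>passage_attained\<close>).\<close>

lemma chain_subset_path: "S \<in> edge_chains n \<Longrightarrow> \<exists>P\<in>paths n. S \<subseteq> P"
proof (induction n arbitrary: S rule: less_induct)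
  case (less n)
  show ?case
  proof (cases n)
    case 0 then show ?thesis using less.prems empty_in_paths_0 by auto
  next
    case (Suc j)
    from less.prems[unfolded Suc] show ?thesis
    proof (cases rule: chains_Suc_cases)
      case 1
      then obtain P where "P \<in> paths j" "S \<subseteq> P" using less.IH[of j S] Suc by auto
      then show ?thesis using paths_extend(1)[of P j n] Suc by blast
    next
      case (2 i S')
      then obtain P where "P \<in> paths i" "S' \<subseteq> P" using less.IH[of i S'] Suc by auto
      then have "insert (int i, int n) P \<in> paths n" using paths_extend(1)[of P i n] Suc 2(1) by auto
      moreover have "S \<subseteq> insert (int i, int n) P" using 2 Suc \<open>S' \<subseteq> P\<close> by auto
      ultimately show ?thesis by blast
    qed
  qed
qed

lemma paths_nonempty [simp]: "paths n \<noteq> {}"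
  using chain_subset_path[of "{}" n] by (auto simp: edge_chains_def)

text \<open>Written as a functional of the weight vector, because the discrete model and its
  embedding are compared only through the law of that vector.\<close>

definition passage :: "nat \<Rightarrow> (int \<times> int \<Rightarrow> real) \<Rightarrow> real" where
  "passage n x = Max ((\<lambda>S. \<Sum>e\<in>S. x e) ` paths n)"

lemma passage_ge:
  assumes "S \<in> edge_chains n" "\<And>e. e \<in> edges n \<Longrightarrow> 0 \<le> x e"
  shows "(\<Sum>e\<in>S. x e) \<le> passage n x"
proof -
  obtain P where P: "P \<in> paths n" "S \<subseteq> P" using chain_subset_path[OF assms(1)] by auto
  have "P \<in> edge_chains n" using P paths_subset_chains by auto
  then have "(\<Sum>e\<in>S. x e) \<le> (\<Sum>e\<in>P. x e)"
    using P assms finite_chain[of P n] by (intro sum_mono2) (auto simp: edge_chains_def)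
  also have "\<dots> \<le> passage n x" unfolding passage_def using P by (intro Max_ge) auto
  finally show ?thesis .
qed

lemma passage_attained: "\<exists>S\<in>edge_chains n. passage n x = (\<Sum>e\<in>S. x e)"
proof -
  have "passage n x \<in> (\<lambda>S. \<Sum>e\<in>S. x e) ` paths n"
    unfolding passage_def by (intro Max_in) auto
  then show ?thesis using paths_subset_chains by auto
qed

lemma passage_measurable [measurable]: "passage n \<in> borel_measurable (PiM (edges n) (\<lambda>_. borel))"
  unfolding passage_def
proof (intro borel_measurable_Max)
  fix S assume "S \<in> paths n"
  then have S: "S \<subseteq> edges n" using paths_subset_chains by (auto simp: edge_chains_def)
  have m: "(\<lambda>x. x e) \<in> borel_measurable (PiM (edges n) (\<lambda>_. borel :: real measure))" if "e \<in> S" for e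
    using that S by (intro measurable_component_singleton) auto
  show "(\<lambda>x. \<Sum>e\<in>S. x e) \<in> borel_measurable (PiM (edges n) (\<lambda>_. borel :: real measure))"
    using borel_measurable_sum[of S "\<lambda>e x. x e", OF m] by simp
qed auto

section \<open>Regularly varying tails\<close>

locale regularly_varying_tail = cdf_distribution M for M +
  fixes s :: real
  assumes s_pos: "0 < s"
    and cdf_0: "cdf M 0 = 0"
    and regular: "t > 0 \<Longrightarrow> ((\<lambda>x. (1 - cdf M (t * x)) / (1 - cdf M x)) \<longlongrightarrow> t powr (- s)) at_top"
begin

definition tail :: "real \<Rightarrow> real" where
  "tail x = 1 - cdf M x"

text \<open>The quantile as a function of the exceedance probability: limits at
  \<open>p \<longrightarrow> 0\<close> from the right describe large weights, and
  \<open>scaling\<close> becomes a value of this function.\<close>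

definition upper_quantile :: "real \<Rightarrow> real" where
  "upper_quantile p = quantile (cdf M) (1 - p)"

lemma tail_antimono: "x \<le> y \<Longrightarrow> tail y \<le> tail x"
  by (simp add: tail_def cdf_nondecreasing)

lemma tail_nonneg [simp]: "0 \<le> tail x"
  by (simp add: tail_def cdf_bounded_prob)

lemma tail_ratio: "t > 0 \<Longrightarrow> ((\<lambda>x. tail (t * x) / tail x) \<longlongrightarrow> t powr (- s)) at_top"
  using regular by (simp add: tail_def)

text \<open>If the tail vanished at some point it would vanish beyond it, and the ratio for
  \<open>t = 1\<close> would be \<open>0 / 0 = 0\<close> there, contradicting its limit 1.\<close>

lemma tail_pos [simp]: "0 < tail x"
proof (rule ccontr)
  assume "\<not> 0 < tail x"
  then have *: "tail x = 0" using tail_nonneg[of x] by linarith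
  have "tail y = 0" if "y \<ge> x" for y using tail_antimono[OF that] * tail_nonneg[of y] by linarith
  then have "\<forall>\<^sub>F y in at_top. tail (1 * y) / tail y = 0"
    unfolding eventually_at_top_linorder by auto
  then have "((\<lambda>y. tail (1 * y) / tail y) \<longlongrightarrow> 0) at_top"
    by (rule tendsto_eventually)
  from tendsto_unique[OF _ this tail_ratio[of 1]] show False by simp
qed

lemma tail_neq_0 [simp]: "tail x \<noteq> 0"
  using tail_pos[of x] by linarith

lemma upper_quantile_le_iff:
  assumes "0 < p" "p < 1"
  shows "upper_quantile p \<le> x \<longleftrightarrow> tail x \<le> p"
  using pseudoinverse[of "1 - p" x] assms by (auto simp: upper_quantile_def quantile_def tail_def)

lemma less_upper_quantile_iff:
  assumes "0 < p" "p < 1"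
  shows "x < upper_quantile p \<longleftrightarrow> p < tail x"
  using upper_quantile_le_iff[OF assms, of x] by linarith

lemma tail_upper_quantile_le: "0 < p \<Longrightarrow> p < 1 \<Longrightarrow> tail (upper_quantile p) \<le> p"
  using upper_quantile_le_iff[of p "upper_quantile p"] by simp

lemma upper_quantile_nonneg:
  assumes "0 < p" "p < 1" shows "0 \<le> upper_quantile p"
proof -
  have "x < upper_quantile p" if "x < 0" for x
    using less_upper_quantile_iff[OF assms, of x] tail_antimono[of x 0] cdf_0 that assms
    by (auto simp: tail_def)
  then show ?thesis by (meson not_le order_less_irrefl)
qed

lemma upper_quantile_antimono:
  assumes "0 < p" "p \<le> q" "q < 1" shows "upper_quantile q \<le> upper_quantile p"
  using upper_quantile_le_iff[of q "upper_quantile p"] tail_upper_quantile_le[of p] assms by auto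

text \<open>Regular variation is applied at \<open>t = 2\<close> only: far out, doubling the
  argument costs at most the factor \<open>2 powr (-s')\<close>, which is strictly below the
  limiting factor \<open>2 powr (-s)\<close>. This is iterated about \<open>log 2 \<tau>\<close>
  times. Rounding \<open>\<tau>\<close> up to a power of 2 costs the leading constant.\<close>

lemma potter_lower_bound:
  assumes "s < s'"
  obtains y0 where "y0 > 0"
    "\<And>y \<tau>. y0 \<le> y \<Longrightarrow> 1 \<le> \<tau> \<Longrightarrow> 2 powr (-s') * \<tau> powr (-s') * tail y \<le> tail (\<tau> * y)"
proof -
  have "2 powr (-s') < 2 powr (-s)" using assms by simp
  from order_tendstoD(1)[OF tail_ratio[of 2] this]
  have "\<forall>\<^sub>F y in at_top. 2 powr (-s') < tail (2 * y) / tail y" by simp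
  then obtain y1 where y1: "\<And>y. y1 \<le> y \<Longrightarrow> 2 powr (-s') < tail (2 * y) / tail y"
    by (auto simp: eventually_at_top_linorder)
  define y0 where "y0 = max 1 y1"
  have dbl: "2 powr (-s') * tail y \<le> tail (2 * y)" if "y0 \<le> y" for y
  proof -
    have "2 powr (-s') < tail (2 * y) / tail y" using y1 that by (auto simp: y0_def)
    then have "2 powr (-s') * tail y < tail (2 * y)" using tail_pos[of y] by (simp add: field_simps)
    then show ?thesis by simp
  qed
  have s': "s' > 0" using assms s_pos by simp
  have iter: "(2 powr (-s')) ^ k * tail y \<le> tail (2 ^ k * y)" if "y0 \<le> y" for k y
  proof (induction k)
    case (Suc k)
    have "1 * y \<le> 2 ^ k * y" using that by (intro mult_right_mono) (auto simp: y0_def)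
    then have "2 powr (-s') * tail (2 ^ k * y) \<le> tail (2 * (2 ^ k * y))" using that by (intro dbl) auto
    moreover have "2 powr (-s') * ((2 powr (-s')) ^ k * tail y) \<le> 2 powr (-s') * tail (2 ^ k * y)"
      using Suc by (intro mult_left_mono) auto
    ultimately show ?case unfolding power_Suc mult.assoc by linarith
  qed simp
  show thesis
  proof (rule that)
    show "y0 > 0" by (simp add: y0_def)
    fix y \<tau> :: real assume y: "y0 \<le> y" and \<tau>: "1 \<le> \<tau>"
    define k where "k = nat \<lceil>log 2 \<tau>\<rceil>"
    have lg: "0 \<le> log 2 \<tau>" using \<tau> by simp
    have k: "log 2 \<tau> \<le> real k" "real k \<le> log 2 \<tau> + 1" unfolding k_def using lg by linarith+
    have "\<tau> = 2 powr (log 2 \<tau>)" using \<tau> by simp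
    also have "\<dots> \<le> 2 powr real k" using k by (intro powr_mono) auto
    finally have "\<tau> \<le> 2 ^ k" by (simp add: powr_realpow)
    then have "tail (2 ^ k * y) \<le> tail (\<tau> * y)"
      using y by (intro tail_antimono mult_right_mono) (auto simp: y0_def)
    moreover have "2 powr (-s') * \<tau> powr (-s') \<le> (2 powr (-s')) ^ k"
    proof -
      have "(2 * \<tau>) powr (-s') \<le> (2 powr real k) powr (-s')"
      proof (rule powr_mono2')
        have "2 powr real k \<le> 2 powr (log 2 \<tau> + 1)" using k by (intro powr_mono) auto
        also have "\<dots> = 2 * \<tau>" using \<tau> by (simp add: powr_add)
        finally show "2 powr real k \<le> 2 * \<tau>" .
      qed (use s' in auto)
      also have "\<dots> = (2 powr (-s')) ^ k" by (simp add: powr_powr powr_realpow[symmetric] mult.commute)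
      finally show ?thesis using \<tau> by (simp add: powr_mult)
    qed
    then have "2 powr (-s') * \<tau> powr (-s') * tail y \<le> (2 powr (-s')) ^ k * tail y"
      by (intro mult_right_mono) auto
    ultimately show "2 powr (-s') * \<tau> powr (-s') * tail y \<le> tail (\<tau> * y)"
      using iter[OF y, of k] by linarith
  qed
qed

text \<open>The Potter bound turned into a bound on quantiles. The additive constant
  \<open>K = 2 * y0\<close> takes care of quantiles below the range in which the Potter bound holds.
  In \<open>C = 4\<close>, one factor 2 comes from halving the argument and the other from the
  Potter constant.\<close>

lemma upper_quantile_bound:
  assumes "s < s'"
  obtains K C where "K > 0" "C > 0"
    "\<And>p q. 0 < q \<Longrightarrow> q \<le> p \<Longrightarrow> p < 1 \<Longrightarrow>
       upper_quantile p \<le> K + C * upper_quantile q * (p / q) powr (-1 / s')"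
proof -
  obtain y0 where y0: "y0 > 0"
    and pot: "\<And>y \<tau>. y0 \<le> y \<Longrightarrow> 1 \<le> \<tau> \<Longrightarrow> 2 powr (-s') * \<tau> powr (-s') * tail y \<le> tail (\<tau> * y)"
    by (rule potter_lower_bound[OF assms]) blast
  have s': "s' > 0" using assms s_pos by simp
  show thesis
  proof (rule that)
    show "2 * y0 > 0" "4 > (0::real)" using y0 by auto
    fix p q :: real assume pq: "0 < q" "q \<le> p" "p < 1"
    let ?y = "upper_quantile p" and ?b = "upper_quantile q"
    have b0: "?b \<ge> 0" using upper_quantile_nonneg pq by auto
    show "?y \<le> 2 * y0 + 4 * ?b * (p / q) powr (-1 / s')"
    proof (cases "?y < 2 * y0")
      case True
      then show ?thesis using b0 by (smt (verit) mult_nonneg_nonneg powr_ge_zero)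
    next
      case False
      have yb: "?y \<le> ?b" using upper_quantile_antimono pq by auto
      have yp: "?y > 0" using False y0 by linarith
      define \<tau> where "\<tau> = ?b / (?y / 2)"
      have \<tau>: "\<tau> \<ge> 1" using yb yp by (simp add: \<tau>_def field_simps)
      \<comment> \<open>At \<open>?y\<close> itself the tail may lie below \<open>p\<close> because
        of a jump; at the smaller argument \<open>?y / 2\<close> it exceeds
        \<open>p\<close>.\<close>
      have "p < tail (?y / 2)" using less_upper_quantile_iff[of p "?y / 2"] pq yp by auto
      then have "2 powr (-s') * \<tau> powr (-s') * p \<le> 2 powr (-s') * \<tau> powr (-s') * tail (?y / 2)"
        by (intro mult_left_mono) auto
      also have "\<dots> \<le> tail (\<tau> * (?y / 2))" using False by (intro pot \<tau>) auto
      also have "\<tau> * (?y / 2) = ?b" using yp by (simp add: \<tau>_def)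
      also have "tail ?b \<le> q" using tail_upper_quantile_le pq by auto
      finally have "2 powr (-s') * \<tau> powr (-s') * p \<le> q" .
      then have "(2 * \<tau>) powr (-s') \<le> q / p" using pq \<tau> by (simp add: powr_mult field_simps)
      then have "(q / p) powr (-1 / s') \<le> ((2 * \<tau>) powr (-s')) powr (-1 / s')"
        using s' \<tau> by (intro powr_mono2') auto
      also have "\<dots> = 2 * \<tau>" using s' \<tau> by (simp add: powr_powr)
      finally have le: "(q / p) powr (-1 / s') \<le> 4 * ?b / ?y" by (simp add: \<tau>_def)
      have "(p / q) powr (-1 / s') * (q / p) powr (-1 / s') = 1"
        using pq by (simp add: powr_mult[symmetric])
      then have "1 \<le> (p / q) powr (-1 / s') * (4 * ?b / ?y)"
        using mult_left_mono[OF le, of "(p / q) powr (-1 / s')"] by simp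
      then have "?y \<le> (p / q) powr (-1 / s') * (4 * ?b)" using yp by (simp add: field_simps)
      then show ?thesis using y0 by (simp add: algebra_simps)
    qed
  qed
qed

text \<open>The Potter bound started at the fixed point \<open>y0\<close> and read at the quantile.
  Since \<open>s'\<close> may be taken below 2 when \<open>s < 2\<close>, this is what makes
  \<open>scaling\<close> outgrow \<open>n\<close>.\<close>

lemma upper_quantile_growth:
  assumes "s < s'"
  obtains c where "c > 0" "\<forall>\<^sub>F p in at_right 0. c * p powr (-1 / s') \<le> upper_quantile p"
proof -
  obtain y0 where y0: "y0 > 0"
    and pot: "\<And>y \<tau>. y0 \<le> y \<Longrightarrow> 1 \<le> \<tau> \<Longrightarrow> 2 powr (-s') * \<tau> powr (-s') * tail y \<le> tail (\<tau> * y)"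
    by (rule potter_lower_bound[OF assms]) blast
  have s': "s' > 0" using assms s_pos by simp
  define a where "a = 2 powr (-s') * tail y0"
  have a: "a > 0" by (simp add: a_def)
  show thesis
  proof (rule that)
    show "y0 * a powr (1 / s') > 0" using y0 a by simp
    have "\<forall>\<^sub>F p::real in at_right 0. 0 < p \<and> p < min 1 (tail y0)"
      using tail_pos[of y0] eventually_at_right[of 0 1] 
      by (intro eventually_conj) (auto simp: eventually_at_right_less eventually_at_right_field intro!: exI[of _ "min 1 (tail y0)"])
    then show "\<forall>\<^sub>F p in at_right 0. y0 * a powr (1 / s') * p powr (-1 / s') \<le> upper_quantile p"
    proof (eventually_elim, safe)
      fix p :: real assume p: "0 < p" "p < min 1 (tail y0)"
      let ?b = "upper_quantile p"
      have b: "y0 < ?b" using less_upper_quantile_iff[of p y0] p by auto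
      have "2 powr (-s') * (?b / y0) powr (-s') * tail y0 \<le> tail (?b / y0 * y0)"
        using b y0 by (intro pot) (auto simp: field_simps)
      also have "\<dots> \<le> p" using tail_upper_quantile_le[of p] p y0 by simp
      finally have "(?b / y0) powr (-s') \<le> p / a" using a by (simp add: a_def field_simps)
      then have "(p / a) powr (-1 / s') \<le> ((?b / y0) powr (-s')) powr (-1 / s')"
        using s' b y0 by (intro powr_mono2') auto
      also have "\<dots> = ?b / y0" using s' b y0 by (simp add: powr_powr)
      finally have "(p / a) powr (-1 / s') \<le> ?b / y0" .
      moreover have "(p / a) powr (-1 / s') = a powr (1 / s') * p powr (-1 / s')"
        using a p by (simp add: powr_divide powr_minus_divide)
      ultimately show "y0 * a powr (1 / s') * p powr (-1 / s') \<le> ?b"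
        using y0 by (simp add: field_simps)
    qed
  qed
qed

lemma upper_quantile_at_top: "filterlim upper_quantile at_top (at_right 0)"
proof -
  obtain c where c: "c > 0" "\<forall>\<^sub>F p in at_right 0. c * p powr (-1 / (s + 1)) \<le> upper_quantile p"
    by (rule upper_quantile_growth[of "s + 1"]) auto
  have "filterlim (\<lambda>p::real. c * p powr (-1 / (s + 1))) at_top (at_right 0)"
  proof (rule filterlim_tendsto_pos_mult_at_top[OF tendsto_const c(1)])
    have "((\<lambda>p::real. p powr (1 / (s + 1))) \<longlongrightarrow> 0 powr (1 / (s + 1))) (at_right 0)"
      using s_pos by (intro tendsto_powr2 tendsto_const) (auto simp: tendsto_ident_at eventually_at_filter)
    then have "filterlim (\<lambda>p::real. p powr (1 / (s + 1))) (at_right 0) (at_right 0)"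
      by (auto simp: filterlim_at eventually_at_filter)
    from filterlim_compose[OF filterlim_inverse_at_top_right this]
    show "filterlim (\<lambda>p::real. p powr (-1 / (s + 1))) at_top (at_right 0)"
      by (simp add: powr_minus)
  qed
  then show ?thesis by (rule filterlim_at_top_mono[OF _ c(2)])
qed

text \<open>At an atom the tail may drop from above \<open>p\<close> to below it. But
  \<open>p < tail (\<theta> * upper_quantile p)\<close> for every \<open>\<theta> < 1\<close>, and
  by regular variation the right-hand side is asymptotically \<open>\<theta> powr (-s)\<close> times
  the tail at the quantile. As \<open>\<theta>\<close> tends to 1, atoms turn out to be
  asymptotically negligible.\<close>

lemma tail_upper_quantile_ratio: "((\<lambda>p. tail (upper_quantile p) / p) \<longlongrightarrow> 1) (at_right 0)"
proof (rule order_tendstoI)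
  have ev: "\<forall>\<^sub>F p::real in at_right 0. 0 < p \<and> p < 1"
    by (intro eventually_conj) (auto simp: eventually_at_right_less eventually_at_right_field intro!: exI[of _ 1])
  {
    fix a :: real assume "1 < a"
    show "\<forall>\<^sub>F p in at_right 0. tail (upper_quantile p) / p < a"
      using ev
    proof eventually_elim
      fix p :: real assume p: "0 < p \<and> p < 1"
      then have "tail (upper_quantile p) / p \<le> 1" using tail_upper_quantile_le[of p] by simp
      then show "tail (upper_quantile p) / p < a" using \<open>1 < a\<close> by linarith
    qed
  next
    fix a :: real assume a: "a < 1"
    \<comment> \<open>Chosen so that \<open>\<theta> powr s\<close> is the midpoint of
      \<open>max a (1/2)\<close> and 1, hence \<open>\<theta> powr (-s) < 1 / max a (1/2)\<close>.
      Replacing \<open>a\<close> by \<open>max a (1/2)\<close> allows division also when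
      \<open>a \<le> 0\<close>.\<close>
    define \<theta> where "\<theta> = ((max a (1/2) + 1) / 2) powr (1 / s)"
    have m: "0 < (max a (1/2) + 1) / 2" "(max a (1/2) + 1) / 2 < 1" "a < (max a (1/2) + 1) / 2"
      using a by auto
    have \<theta>: "0 < \<theta>" "\<theta> < 1" using m s_pos powr_less_mono2[of "1 / s" "(max a (1/2) + 1) / 2" 1] by (auto simp: \<theta>_def)
    have "\<theta> powr s = (max a (1/2) + 1) / 2" using m s_pos by (simp add: \<theta>_def powr_powr)
    then have lt: "\<theta> powr (-s) < 1 / max a (1/2) "
    proof -
      note \<open>\<theta> powr s = (max a (1/2) + 1) / 2\<close>
      moreover have "0 < max a (1/2)" "max a (1/2) < (max a (1/2) + 1) / 2" using a by auto
      ultimately show ?thesis unfolding powr_minus_divide by (metis frac_less2 order_refl zero_less_one)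
    qed
    have "\<forall>\<^sub>F p in at_right 0. tail (\<theta> * upper_quantile p) / tail (upper_quantile p) < 1 / max a (1/2)"
      using order_tendstoD(2)[OF filterlim_compose[OF tail_ratio[OF \<theta>(1)] upper_quantile_at_top] lt] .
    moreover have "\<forall>\<^sub>F p in at_right 0. 0 < upper_quantile p"
      using upper_quantile_at_top by (simp add: filterlim_at_top_dense)
    ultimately show "\<forall>\<^sub>F p in at_right 0. a < tail (upper_quantile p) / p"
      using ev
    proof eventually_elim
      fix p assume 1: "tail (\<theta> * upper_quantile p) / tail (upper_quantile p) < 1 / max a (1/2)"
        and 2: "0 < upper_quantile p" and p: "0 < p \<and> p < 1"
      have "\<theta> * upper_quantile p < upper_quantile p" using 2 \<theta> by simp
      then have "p < tail (\<theta> * upper_quantile p)" using less_upper_quantile_iff p by auto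
      then have "p / tail (upper_quantile p) \<le> tail (\<theta> * upper_quantile p) / tail (upper_quantile p)"
        by (simp add: divide_right_mono)
      then have "p / tail (upper_quantile p) < 1 / max a (1/2)" using 1 by linarith
      moreover have "0 < max a (1/2)" by simp
      ultimately have "max a (1/2) < tail (upper_quantile p) / p"
        using p tail_pos[of "upper_quantile p"] by (metis (no_types, lifting) less_divide_eq
            divide_less_eq mult.commute mult_1 order_less_asym times_divide_eq_left)
      then show "a < tail (upper_quantile p) / p" by simp
    qed
  }
qed

text \<open>Regular variation of the inverse. By the Galois connection, comparing the quotient with
  \<open>y\<close> means comparing \<open>tail (y * upper_quantile (q n)) / p n\<close> with 1. This
  ratio tends to \<open>y powr (-s) / l\<close>, which crosses 1 exactly at
  \<open>y = l powr (-1 / s)\<close>.\<close>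

lemma upper_quantile_ratio_tendsto:
  assumes l: "l > 0" and p: "filterlim p (at_right 0) Fl" and q: "filterlim q (at_right 0) Fl"
    and pq: "((\<lambda>n. p n / q n) \<longlongrightarrow> l) Fl"
  shows "((\<lambda>n. upper_quantile (p n) / upper_quantile (q n)) \<longlongrightarrow> l powr (-1 / s)) Fl"
proof -
  have ev: "\<forall>\<^sub>F p::real in at_right 0. 0 < p \<and> p < 1"
    by (intro eventually_conj) (auto simp: eventually_at_right_less eventually_at_right_field intro!: exI[of _ 1])
  have evp: "\<forall>\<^sub>F n in Fl. 0 < p n \<and> p n < 1" using filterlim_iff[THEN iffD1, OF p] ev by blast
  have evq: "\<forall>\<^sub>F n in Fl. 0 < q n \<and> q n < 1" using filterlim_iff[THEN iffD1, OF q] ev by blast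
  have top: "filterlim (\<lambda>n. upper_quantile (q n)) at_top Fl"
    by (rule filterlim_compose[OF upper_quantile_at_top q])
  then have pos: "\<forall>\<^sub>F n in Fl. 0 < upper_quantile (q n)"
    by (simp add: filterlim_at_top_dense)
  have lim: "((\<lambda>n. tail (y * upper_quantile (q n)) / p n) \<longlongrightarrow> y powr (-s) * 1 / l) Fl" if "y > 0" for y
  proof (rule Lim_transform_eventually)
    show "((\<lambda>n. (tail (y * upper_quantile (q n)) / tail (upper_quantile (q n)))
           * (tail (upper_quantile (q n)) / q n) / (p n / q n)) \<longlongrightarrow> y powr (-s) * 1 / l) Fl"
      using l by (intro tendsto_intros filterlim_compose[OF tail_ratio[OF that] top]
          filterlim_compose[OF tail_upper_quantile_ratio q] pq) auto
    show "\<forall>\<^sub>F n in Fl. (tail (y * upper_quantile (q n)) / tail (upper_quantile (q n)))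
           * (tail (upper_quantile (q n)) / q n) / (p n / q n) = tail (y * upper_quantile (q n)) / p n"
      using evp evq
    proof eventually_elim
      fix n assume "0 < p n \<and> p n < 1" "0 < q n \<and> q n < 1"
      then show "(tail (y * upper_quantile (q n)) / tail (upper_quantile (q n)))
           * (tail (upper_quantile (q n)) / q n) / (p n / q n) = tail (y * upper_quantile (q n)) / p n"
        using tail_pos[of "upper_quantile (q n)"] by (simp add: field_simps)
    qed
  qed
  show ?thesis
  proof (rule order_tendstoI)
    fix a assume a: "l powr (-1 / s) < a"
    define y where "y = (l powr (-1 / s) + a) / 2"
    have "0 < l powr (-1 / s)" using l by simp
    from add_pos_pos[OF this less_trans[OF this a]]
    have y: "y > 0" unfolding y_def by simp
    have y': "l powr (-1 / s) < y" "y < a" using a by (auto simp: y_def)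
    have "y powr (-s) < (l powr (-1 / s)) powr (-s)"
      using y' l s_pos by (intro powr_less_mono2_neg) auto
    also have "\<dots> = l" using l s_pos by (simp add: powr_powr)
    finally have "y powr (-s) * 1 / l < 1" using l by simp
    from order_tendstoD(2)[OF lim[OF y(1)] this] evp pos
    show "\<forall>\<^sub>F n in Fl. upper_quantile (p n) / upper_quantile (q n) < a"
    proof eventually_elim
      fix n assume 1: "tail (y * upper_quantile (q n)) / p n < 1" and 2: "0 < p n \<and> p n < 1"
        and 3: "0 < upper_quantile (q n)"
      have "upper_quantile (p n) \<le> y * upper_quantile (q n)"
        using 1 2 by (subst upper_quantile_le_iff) auto
      also have "\<dots> < a * upper_quantile (q n)" using y' 3 by simp
      finally show "upper_quantile (p n) / upper_quantile (q n) < a" using 3 by (simp add: field_simps)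
    qed
  next
    fix a assume a: "a < l powr (-1 / s)"
    define y where "y = (l powr (-1 / s) + max a 0) / 2"
    have y: "y > 0" "y < l powr (-1 / s)" "a < y" using a l by (auto simp: y_def max_def)
    have "l = (l powr (-1 / s)) powr (-s)" using l s_pos by (simp add: powr_powr)
    also have "\<dots> < y powr (-s)"
      using y l s_pos by (intro powr_less_mono2_neg) auto
    finally have "1 < y powr (-s) * 1 / l" using l by simp
    from order_tendstoD(1)[OF lim[OF y(1)] this] evp pos
    show "\<forall>\<^sub>F n in Fl. a < upper_quantile (p n) / upper_quantile (q n)"
    proof eventually_elim
      fix n assume 1: "1 < tail (y * upper_quantile (q n)) / p n" and 2: "0 < p n \<and> p n < 1"
        and 3: "0 < upper_quantile (q n)"
      have "y * upper_quantile (q n) < upper_quantile (p n)"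
        using 1 2 by (subst less_upper_quantile_iff) auto
      then have "y < upper_quantile (p n) / upper_quantile (q n)" using 3 by (simp add: field_simps)
      then show "a < upper_quantile (p n) / upper_quantile (q n)" using y by linarith
    qed
  qed
qed

end

section \<open>Thinning of a marked Poisson process\<close>

lemma has_real_derivative_max_0_diff:
  fixes a w :: real
  assumes "w \<noteq> a"
  shows "((\<lambda>w. max 0 (a - w)) has_real_derivative (if w < a then -1 else 0)) (at w)"
proof (cases "w < a")
  case True
  have "((\<lambda>w. a - w) has_real_derivative -1) (at w)" by (auto intro!: derivative_eq_intros)
  moreover have "\<forall>\<^sub>F x in nhds w. max 0 (a - x) = a - x"
    using eventually_nhds_in_open[of "{..<a}" w] True by (auto elim!: eventually_mono)
  ultimately show ?thesis using True by (subst DERIV_cong_ev[OF refl _ refl]) auto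
next
  case False
  then have "a < w" using assms by auto
  then have "\<forall>\<^sub>F x in nhds w. max 0 (a - x) = 0"
    using eventually_nhds_in_open[of "{a<..}" w] by (auto elim!: eventually_mono)
  then show ?thesis using False by (subst DERIV_cong_ev[OF refl _ refl]) auto
qed

text \<open>The probability that independent Poisson processes of rate \<open>r\<close>, one for
  each \<open>e\<close> in \<open>E\<close>, have no point before the times \<open>t e\<close>. The
  truncation at 0 is there because the recursion shifts thresholds below 0.\<close>

definition void_prob :: "real \<Rightarrow> 'e set \<Rightarrow> ('e \<Rightarrow> real) \<Rightarrow> real" where
  "void_prob r E t = exp (- r * (\<Sum>e\<in>E. max 0 (t e)))"

text \<open>The integrand is the derivative of \<open>w \<mapsto> - exp (- w) * void_prob r E (\<lambda>e. t e - w)\<close> away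
  from the values of \<open>t\<close>.\<close>

lemma exponential_void_integral:
  fixes t :: "'e \<Rightarrow> real" and r :: real
  assumes E: "finite E" and r: "0 \<le> r" "r * card E \<le> 1"
  shows "(\<integral>\<^sup>+w. ennreal (exponential_density 1 w * (1 - r * card {e\<in>E. w < t e}) *
            void_prob r E (\<lambda>e. t e - w)) \<partial>lborel) = ennreal (void_prob r E t)"
proof -
  define g where "g w = 1 - r * card {e\<in>E. w < t e}" for w
  define Q where "Q w = void_prob r E (\<lambda>e. t e - w)" for w
  have card_sum: "real (card {e\<in>E. w < t e}) = (\<Sum>e\<in>E. indicator {..<t e} w)" for w
    using E by (simp add: indicator_def sum.If_cases Int_def)
  have "g = (\<lambda>w. 1 - r * (\<Sum>e\<in>E. indicator {..<t e} w))"
    by (simp add: g_def card_sum fun_eq_iff)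
  then have g_borel [measurable]: "g \<in> borel_measurable borel" by simp
  have Q_borel [measurable]: "Q \<in> borel_measurable borel"
    unfolding Q_def void_prob_def by measurable
  have g_nonneg: "0 \<le> g w" for w
  proof -
    have "card {e\<in>E. w < t e} \<le> card E" using E by (intro card_mono) auto
    then have "r * card {e\<in>E. w < t e} \<le> r * card E" using r by (intro mult_left_mono) auto
    then show ?thesis using r by (simp add: g_def)
  qed
  have Q_nonneg: "0 \<le> Q w" for w by (simp add: Q_def void_prob_def)
  \<comment> \<open>Beyond all thresholds the integrand is just \<open>exp (- w)\<close>; its mass
    \<open>exp (- b)\<close> cancels the boundary term \<open>F b\<close> of the integral over
    \<open>{0..b}\<close>.\<close>
  obtain b where b: "b \<ge> 0" "\<And>e. e \<in> E \<Longrightarrow> t e \<le> b"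
  proof
    show "Max (insert 0 (t ` E)) \<ge> 0" using E by (intro Max_ge) auto
    show "\<And>e. e \<in> E \<Longrightarrow> t e \<le> Max (insert 0 (t ` E))" using E by (intro Max_ge) auto
  qed
  define F where "F w = - exp (- w) * Q w" for w
  have F_deriv: "(F has_vector_derivative exp (- w) * g w * Q w) (at w)" if "w \<notin> t ` E" for w
  proof -
    have d: "((\<lambda>w. \<Sum>e\<in>E. max 0 (t e - w)) has_real_derivative (\<Sum>e\<in>E. if w < t e then -1 else 0)) (at w)"
      using that by (intro DERIV_sum has_real_derivative_max_0_diff) auto
    have s: "(\<Sum>e\<in>E. if w < t e then -1 else 0) = - real (card {e\<in>E. w < t e})"
      using E by (simp add: sum.If_cases Int_def)
    define h where "h w = (\<Sum>e\<in>E. max 0 (t e - w))" for w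
    have d': "(h has_real_derivative (- real (card {e\<in>E. w < t e}))) (at w)"
      using d unfolding s h_def .
    have F_eq: "F = (\<lambda>w. - exp (- w) * exp (- r * h w))"
      by (simp add: F_def Q_def void_prob_def h_def fun_eq_iff)
    have Q_eq: "Q w = exp (- r * h w)" by (simp add: Q_def void_prob_def h_def)
    show ?thesis
      unfolding has_real_derivative_iff_has_vector_derivative[symmetric] F_eq Q_eq g_def
      by (auto intro!: derivative_eq_intros d' simp: algebra_simps)
  qed
  have F_cont: "continuous_on {0..b} F"
    unfolding F_def Q_def void_prob_def by (intro continuous_intros)
  have "((\<lambda>w. exp (- w) * g w * Q w) has_integral (F b - F 0)) {0..b}"
    using b F_cont E F_deriv
    by (intro fundamental_theorem_of_calculus_interior_strong[where S = "t ` E"]) auto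
  then have "(\<integral>\<^sup>+w. ennreal (exp (- w) * g w * Q w) * indicator {0..b} w \<partial>lborel) = ennreal (F b - F 0)"
    using g_nonneg Q_nonneg by (intro nn_integral_has_integral_lebesgue') auto
  moreover have "(\<integral>\<^sup>+w. ennreal (exp (- w) * g w * Q w) * indicator {b<..} w \<partial>lborel) = ennreal (exp (- b))"
  proof -
    have "(\<integral>\<^sup>+w. ennreal (exp (- w) * g w * Q w) * indicator {b<..} w \<partial>lborel) =
      (\<integral>\<^sup>+w. ennreal (exp (- w)) * indicator {b..} w \<partial>lborel)"
    proof (intro nn_integral_cong_AE)
      have *: "exp (- w) * g w * Q w = exp (- w)" if "b < w" for w
      proof -
        have "{e\<in>E. w < t e} = {}" using b that by force
        then have "card {e\<in>E. w < t e} = 0" by (simp only: card.empty)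
        moreover have "(\<Sum>e\<in>E. max 0 (t e - w)) = 0" using b that by (intro sum.neutral) force
        ultimately show ?thesis by (simp add: g_def Q_def void_prob_def)
      qed
      have pt: "ennreal (exp (- w) * g w * Q w) * indicator {b<..} w = ennreal (exp (- w)) * indicator {b..} w"
        if "w \<noteq> b" for w
      proof (cases "b < w")
        case True
        then have w: "w \<in> {b<..}" "w \<in> {b..}" by auto
        show ?thesis unfolding *[OF True] indicator_simps(1)[OF w(1)] indicator_simps(1)[OF w(2)] ..
      next
        case False
        then have w: "w \<notin> {b<..}" "w \<notin> {b..}" using that by auto
        show ?thesis unfolding indicator_simps(2)[OF w(1)] indicator_simps(2)[OF w(2)] by simp
      qed
      show "AE w in lborel. ennreal (exp (- w) * g w * Q w) * indicator {b<..} w =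
         ennreal (exp (- w)) * indicator {b..} w"
        by (rule AE_mp[OF AE_lborel_singleton[of b]], rule AE_I2, rule impI, rule pt)
    qed
    also have "\<dots> = ennreal (0 - (- exp (- b)))"
    proof (rule nn_integral_FTC_atLeast)
      have "((\<lambda>x::real. - exp (- x)) \<longlongrightarrow> - 0) at_top"
        by (intro tendsto_minus filterlim_compose[OF exp_at_bot] filterlim_uminus_at_top_at_bot
            filterlim_uminus_at_bot_at_top)
      then show "((\<lambda>x::real. - exp (- x)) \<longlongrightarrow> 0) at_top" by simp
    qed (auto intro!: derivative_eq_intros)
    finally show ?thesis by simp
  qed
  moreover have "(\<integral>\<^sup>+w. ennreal (exponential_density 1 w * g w * Q w) \<partial>lborel) =
     (\<integral>\<^sup>+w. ennreal (exp (- w) * g w * Q w) * indicator {0..b} w \<partial>lborel) +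
     (\<integral>\<^sup>+w. ennreal (exp (- w) * g w * Q w) * indicator {b<..} w \<partial>lborel)"
    using b by (subst nn_integral_add[symmetric])
      (auto intro!: nn_integral_cong simp: exponential_density_def indicator_def)
  moreover have "F b = - exp (- b)"
  proof -
    have "(\<Sum>e\<in>E. max 0 (t e - b)) = 0" using b by (intro sum.neutral) force
    then show ?thesis by (simp add: F_def Q_def void_prob_def)
  qed
  moreover have "F 0 = - Q 0" by (simp add: F_def)
  moreover have "F 0 \<le> F b"
  proof -
    have "0 \<le> ((F b - F 0))"
      by (rule has_integral_nonneg[OF \<open>((\<lambda>w. exp (- w) * g w * Q w) has_integral (F b - F 0)) {0..b}\<close>])
         (auto intro!: mult_nonneg_nonneg g_nonneg Q_nonneg)
    then show ?thesis by simp
  qed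
  ultimately have "(\<integral>\<^sup>+w. ennreal (exponential_density 1 w * g w * Q w) \<partial>lborel) = ennreal (Q 0)"
    by (simp add: ennreal_plus[symmetric] del: ennreal_plus)
  then show ?thesis by (simp add: g_def Q_def)
qed

text \<open>The Laplace transform of the exponential law at 1. It provides both the halving of the
  error in the recursion over marks and the exponential bound on small arrival times.\<close>

lemma exponential_laplace_integral:
  "(\<integral>\<^sup>+w. ennreal (exponential_density 1 w * exp (- w)) \<partial>lborel) = ennreal (1 / 2)"
proof -
  have "(\<integral>\<^sup>+w. ennreal (exponential_density 1 w * exp (- w)) \<partial>lborel) =
    (\<integral>\<^sup>+w. ennreal (exp (- 2 * w)) * indicator {0..} w \<partial>lborel)"
    by (intro nn_integral_cong) (auto simp: exponential_density_def indicator_def exp_add[symmetric])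
  also have "\<dots> = ennreal (0 - (- exp (- 2 * 0) / 2))"
  proof (rule nn_integral_FTC_atLeast)
    have e: "((\<lambda>x::real. exp (- x)) \<longlongrightarrow> 0) at_top"
      by (intro filterlim_compose[OF exp_at_bot] filterlim_uminus_at_bot_at_top)
    have "((\<lambda>x::real. - (exp (- x) * exp (- x)) / 2) \<longlongrightarrow> - (0 * 0) / 2) at_top"
      by (intro tendsto_intros e) auto
    then show "((\<lambda>x::real. - exp (- 2 * x) / 2) \<longlongrightarrow> 0) at_top"
      by (simp add: exp_add[symmetric])
  qed (auto intro!: derivative_eq_intros)
  finally show ?thesis by simp
qed


text \<open>Here \<open>m\<close> counts the marks already consumed: time is measured from the
  \<open>m\<close>-th arrival, so that an induction on \<open>K\<close> can strip off the first
  remaining mark and restart the clock.\<close>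

definition void_event :: "'e set \<Rightarrow> ('e \<Rightarrow> real) \<Rightarrow> nat \<Rightarrow> nat \<Rightarrow> (nat \<Rightarrow> real \<times> 'e) \<Rightarrow> bool" where
  "void_event E t m K x \<longleftrightarrow>
     (\<forall>k\<in>{m<..m + K}. snd (x k) \<in> E \<longrightarrow> t (snd (x k)) \<le> (\<Sum>i\<in>{m<..k}. fst (x i)))"

text \<open>The renewal step: after a first waiting time \<open>w\<close>, the remaining marks face
  thresholds lowered by \<open>w\<close>.\<close>

lemma void_event_Suc:
  "void_event E t m (Suc K) (x(Suc m := (w, e))) \<longleftrightarrow>
     (e \<in> E \<longrightarrow> t e \<le> w) \<and> void_event E (\<lambda>e. t e - w) (Suc m) K x"
proof -
  have I: "{m<..m + Suc K} = insert (Suc m) {Suc m<..Suc m + K}" by auto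
  have S: "(\<Sum>i\<in>{m<..k}. fst ((x(Suc m := (w, e))) i)) = w + (\<Sum>i\<in>{Suc m<..k}. fst (x i))"
    if "Suc m \<le> k" for k
  proof -
    have "{m<..k} = insert (Suc m) {Suc m<..k}" using that by auto
    then show ?thesis by simp
  qed
  show ?thesis
    unfolding void_event_def I by (auto simp: S algebra_simps simp del: fun_upd_apply) (auto simp: algebra_simps)
qed

lemma void_event_measurable:
  assumes "sets \<nu> = sets (count_space UNIV)" "{m<..m + K} \<subseteq> I"
  shows "{x \<in> space (PiM I (\<lambda>_. density lborel (exponential_density 1) \<Otimes>\<^sub>M \<nu>)). void_event E t m K x}
           \<in> sets (PiM I (\<lambda>_. density lborel (exponential_density 1) \<Otimes>\<^sub>M \<nu>))"
proof -
  let ?P = "PiM I (\<lambda>_. density lborel (exponential_density 1) \<Otimes>\<^sub>M \<nu>)"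
  let ?D = "density lborel (exponential_density 1)"
  have comp: "(\<lambda>x. x i) \<in> measurable ?P (?D \<Otimes>\<^sub>M \<nu>)" if "i \<in> I" for i
    using that by (rule measurable_component_singleton)
  have fst_m: "(\<lambda>x. fst (x i)) \<in> borel_measurable ?P" if "i \<in> I" for i
  proof -
    have "measurable ?P ?D = borel_measurable ?P" by (intro measurable_cong_sets) auto
    then show ?thesis using measurable_compose[OF comp[OF that] measurable_fst] by simp
  qed
  have snd_m: "(\<lambda>x. snd (x i)) \<in> measurable ?P (count_space UNIV)" if "i \<in> I" for i
  proof -
    have "measurable ?P \<nu> = measurable ?P (count_space UNIV)" using assms by (intro measurable_cong_sets) auto
    then show ?thesis using measurable_compose[OF comp[OF that] measurable_snd] by simp
  qed
  have "Measurable.pred ?P (\<lambda>x. snd (x k) \<in> E \<longrightarrow> t (snd (x k)) \<le> (\<Sum>i\<in>{m<..k}. fst (x i)))"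
    if k: "k \<in> {m<..m + K}" for k
  proof -
    have 1: "(\<lambda>x. snd (x k)) \<in> measurable ?P (count_space UNIV)"
      using snd_m k assms(2) by auto
    have 2: "(\<lambda>x. \<Sum>i\<in>{m<..k}. fst (x i)) \<in> borel_measurable ?P"
      by (intro borel_measurable_sum fst_m) (use k assms(2) in auto)
    have 3: "(\<lambda>x. t (snd (x k))) \<in> borel_measurable ?P"
      by (rule measurable_compose[OF 1]) simp
    have "Measurable.pred ?P (\<lambda>x. snd (x k) \<in> E)"
      by (rule measurable_compose[OF 1]) simp
    moreover have "Measurable.pred ?P (\<lambda>x. t (snd (x k)) \<le> (\<Sum>i\<in>{m<..k}. fst (x i)))"
      using borel_measurable_le[OF 3 2] by (simp add: pred_def)
    ultimately show ?thesis by (intro pred_intros_logic)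
  qed
  then have "Measurable.pred ?P (void_event E t m K)"
    unfolding void_event_def by (intro pred_intros_finite) auto
  then show ?thesis by simp
qed

text \<open>The induction integrates over the first mark, with \<open>void_prob r E\<close> as a fixed point of the
  resulting recursion.  The error \<open>exp T / 2 ^ K\<close> is halved in each step because
  \<open>exp (T - w)\<close> has integral \<open>exp T / 2\<close> against the exponential density.\<close>

lemma void_event_bounds:
  fixes \<nu> :: "'e measure" and r :: real
  assumes \<nu>: "prob_space \<nu>" "sets \<nu> = sets (count_space UNIV)"
    and E: "finite E" "\<And>e. e \<in> E \<Longrightarrow> measure \<nu> {e} = r" and r: "0 \<le> r" "r * card E \<le> 1"
    and t: "\<And>e. e \<in> E \<Longrightarrow> t e \<le> T"
  defines "\<mu> \<equiv> density lborel (exponential_density 1) \<Otimes>\<^sub>M \<nu>"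
  defines "P m K \<equiv> PiM {m<..m + K} (\<lambda>_::nat. \<mu>)"
  shows "ennreal (void_prob r E t) \<le> emeasure (P m K) {x \<in> space (P m K). void_event E t m K x}"
    "emeasure (P m K) {x \<in> space (P m K). void_event E t m K x} \<le> ennreal (void_prob r E t + exp T / 2 ^ K)"
proof -
  interpret \<nu>: prob_space \<nu> by fact
  let ?D = "density lborel (exponential_density 1)"
  interpret D: prob_space ?D by (rule prob_space_exponential_density) simp
  interpret D\<nu>: pair_prob_space ?D \<nu> by unfold_locales
  have \<mu>: "prob_space \<mu>" unfolding \<mu>_def by unfold_locales
  interpret PP: product_prob_space "\<lambda>_::nat. \<mu>" using \<mu> by (simp add: product_prob_spaceI)
  have void_le1: "void_prob r E t \<le> 1" for t
    using r by (auto simp: void_prob_def intro!: mult_nonneg_nonneg sum_nonneg)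
  have void_nonneg: "0 \<le> void_prob r E t" for t by (simp add: void_prob_def)
  define V where "V m K t = emeasure (P m K) {x \<in> space (P m K). void_event E t m K x}" for m K t
  \<comment> \<open>The probability that a mark arriving at time \<open>w\<close> violates no
    threshold. It is nonnegative thanks to \<open>r * card E \<le> 1\<close>.\<close>
  define g where "g w t = 1 - r * card {e\<in>E. w < t e}" for w and t :: "'e \<Rightarrow> real"
  have mark: "(\<integral>\<^sup>+e. indicator {e. e \<in> E \<longrightarrow> t e \<le> w} e \<partial>\<nu>) = ennreal (g w t)" for t w
  proof -
    have m: "A \<in> sets \<nu>" for A using \<nu> by simp
    have sp: "space \<nu> = UNIV" using sets_eq_imp_space_eq[OF \<nu>(2)] by simp
    have "measure \<nu> {e\<in>E. w < t e} = (\<Sum>e\<in>{e\<in>E. w < t e}. measure \<nu> {e})"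
      using E m by (intro \<nu>.finite_measure_eq_sum_singleton) auto
    also have "\<dots> = r * card {e\<in>E. w < t e}" using E by simp
    finally have "measure \<nu> (space \<nu> - {e\<in>E. w < t e}) = g w t"
      using m by (subst \<nu>.prob_compl) (auto simp: g_def)
    moreover have "space \<nu> - {e\<in>E. w < t e} = {e. e \<in> E \<longrightarrow> t e \<le> w}" using sp by auto
    ultimately show ?thesis using m by (simp add: \<nu>.emeasure_eq_measure)
  qed
  have g_nonneg: "0 \<le> g w t" for w t
  proof -
    have "r * card {e\<in>E. w < t e} \<le> r * card E"
      using r E by (intro mult_left_mono) (auto intro!: card_mono)
    then show ?thesis using r by (simp add: g_def)
  qed
  have card_sum: "real (card {e\<in>E. w < t e}) = (\<Sum>e\<in>E. indicator {..<t e} w)"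
    for w and t :: "'e \<Rightarrow> real"
    using E by (simp add: indicator_def sum.If_cases Int_def)
  have [measurable]: "(\<lambda>w. g w t) \<in> borel_measurable borel" for t
    unfolding g_def card_sum by measurable
  have [measurable]: "(\<lambda>w. void_prob r E (\<lambda>e. t e - w)) \<in> borel_measurable borel" for t
    unfolding void_prob_def by measurable
  have D_int: "(\<integral>\<^sup>+w. ennreal (g w t) * ennreal (void_prob r E (\<lambda>e. t e - w)) \<partial>?D) = ennreal (void_prob r E t)" for t
  proof -
    have "(\<integral>\<^sup>+w. ennreal (g w t) * ennreal (void_prob r E (\<lambda>e. t e - w)) \<partial>?D) =
      (\<integral>\<^sup>+w. ennreal (exponential_density 1 w * (1 - r * card {e\<in>E. w < t e}) *
            void_prob r E (\<lambda>e. t e - w)) \<partial>lborel)"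
      using g_nonneg void_nonneg unfolding g_def[symmetric]
      by (subst nn_integral_density) (auto intro!: nn_integral_cong simp: ennreal_mult' mult.assoc exponential_density_nonneg)
    also have "\<dots> = ennreal (void_prob r E t)" using E r by (intro exponential_void_integral) auto
    finally show ?thesis .
  qed
  \<comment> \<open>Condition on the first waiting time and its mark; \<open>D_int\<close> says that
    \<open>void_prob\<close> solves the same equation.\<close>
  have step: "V m (Suc K) t =
    (\<integral>\<^sup>+w. ennreal (g w t) * V (Suc m) K (\<lambda>e. t e - w) \<partial>?D)"
    for m K t
  proof -
    let ?A = "{x \<in> space (P m (Suc K)). void_event E t m (Suc K) x}"
    have I: "{m<..m + Suc K} = insert (Suc m) {Suc m<..Suc m + K}" by auto
    have A: "?A \<in> sets (P m (Suc K))"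
      unfolding P_def \<mu>_def by (rule void_event_measurable[OF \<nu>(2) order_refl])
    have "V m (Suc K) t = (\<integral>\<^sup>+x. indicator ?A x \<partial>P m (Suc K))" using A by (simp add: V_def)
    also have "\<dots> = (\<integral>\<^sup>+y. (\<integral>\<^sup>+x. indicator ?A (x(Suc m := y)) \<partial>P (Suc m) K) \<partial>\<mu>)"
      using borel_measurable_indicator[OF A] unfolding P_def I
      by (intro PP.product_nn_integral_insert_rev) auto
    also have "\<dots> = (\<integral>\<^sup>+w. \<integral>\<^sup>+e. (\<integral>\<^sup>+x. indicator ?A (x(Suc m := (w, e))) \<partial>P (Suc m) K) \<partial>\<nu> \<partial>?D)"
    proof -
      interpret PK: prob_space "P (Suc m) K" unfolding P_def by (rule prob_space_PiM) (rule \<mu>)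
      have "(\<lambda>z. (snd z)(Suc m := fst z)) \<in> measurable (\<mu> \<Otimes>\<^sub>M P (Suc m) K) (P m (Suc K))"
        unfolding P_def I
        using measurable_compose[OF measurable_pair_swap' measurable_add_dim[of "Suc m" "{Suc m<..Suc m + K}" "\<lambda>_. \<mu>"]]
        by (simp add: split_beta')
      from measurable_compose[OF this borel_measurable_indicator[OF A]]
      have "(\<lambda>y. \<integral>\<^sup>+x. indicator ?A (x(Suc m := y)) \<partial>P (Suc m) K) \<in> borel_measurable \<mu>"
        by (intro PK.borel_measurable_nn_integral) (simp add: split_beta')
      then show ?thesis unfolding \<mu>_def by (subst \<nu>.nn_integral_fst[symmetric]) auto
    qed
    also have "\<dots> = (\<integral>\<^sup>+w. \<integral>\<^sup>+e. indicator {e. e \<in> E \<longrightarrow> t e \<le> w} e *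
        V (Suc m) K (\<lambda>e. t e - w) \<partial>\<nu> \<partial>?D)"
    proof (intro nn_integral_cong)
      fix w e assume "w \<in> space ?D" "e \<in> space \<nu>"
      then have y: "(w, e) \<in> space \<mu>" by (auto simp: \<mu>_def space_pair_measure)
      let ?B = "{x \<in> space (P (Suc m) K). void_event E (\<lambda>e. t e - w) (Suc m) K x}"
      have B: "?B \<in> sets (P (Suc m) K)"
        unfolding P_def \<mu>_def by (rule void_event_measurable[OF \<nu>(2) order_refl])
      have "(\<integral>\<^sup>+x. indicator ?A (x(Suc m := (w, e))) \<partial>P (Suc m) K) =
         (\<integral>\<^sup>+x. indicator {e. e \<in> E \<longrightarrow> t e \<le> w} e * indicator ?B x \<partial>P (Suc m) K)"
      proof (intro nn_integral_cong)
        fix x assume x: "x \<in> space (P (Suc m) K)"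
        have "x(Suc m := (w, e)) \<in> space (P m (Suc K))"
          using x y unfolding P_def I by (auto simp: space_PiM PiE_def extensional_def Pi_def)
        then show "indicator ?A (x(Suc m := (w, e))) = indicator {e. e \<in> E \<longrightarrow> t e \<le> w} e * (indicator ?B x :: ennreal)"
          using void_event_Suc[of E t m K x w e] x
          by (auto simp: indicator_def simp del: fun_upd_apply)
      qed
      also have "\<dots> = indicator {e. e \<in> E \<longrightarrow> t e \<le> w} e * V (Suc m) K (\<lambda>e. t e - w)"
        using B by (subst nn_integral_cmult) (auto simp: V_def)
      finally show "(\<integral>\<^sup>+x. indicator ?A (x(Suc m := (w, e))) \<partial>P (Suc m) K) = \<dots>" .
    qed
    also have "\<dots> = (\<integral>\<^sup>+w. ennreal (g w t) * V (Suc m) K (\<lambda>e. t e - w) \<partial>?D)"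
      by (subst nn_integral_multc) (auto simp: mark \<nu> intro!: borel_measurable_indicator)
    finally show ?thesis .
  qed
  show "ennreal (void_prob r E t) \<le> emeasure (P m K) {x \<in> space (P m K). void_event E t m K x}"
    unfolding V_def[symmetric]
  proof (induction K arbitrary: m t)
    case 0
    interpret P0: prob_space "P m 0" unfolding P_def by (rule prob_space_PiM) (rule \<mu>)
    show ?case using void_le1 by (simp add: V_def void_event_def P0.emeasure_space_1)
  next
    case (Suc K)
    have "ennreal (void_prob r E t) =
        (\<integral>\<^sup>+w. ennreal (g w t) * ennreal (void_prob r E (\<lambda>e. t e - w)) \<partial>?D)" by (rule D_int[symmetric])
    also have "\<dots> \<le> V m (Suc K) t"
      unfolding step by (intro nn_integral_mono mult_left_mono Suc.IH) auto
    finally show ?case .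
  qed
  show "emeasure (P m K) {x \<in> space (P m K). void_event E t m K x} \<le> ennreal (void_prob r E t + exp T / 2 ^ K)"
    using t unfolding V_def[symmetric]
  proof (induction K arbitrary: m t T)
    case 0
    interpret P0: prob_space "P m 0" unfolding P_def by (rule prob_space_PiM) (rule \<mu>)
    \<comment> \<open>If \<open>T \<le> 0\<close>, all thresholds have already passed and the void
      probability is 1; otherwise \<open>exp T\<close> alone exceeds 1.\<close>
    have "1 \<le> void_prob r E t + exp T"
    proof (cases "T \<le> 0")
      case True
      then have "(\<Sum>e\<in>E. max 0 (t e)) = 0" using 0 by (intro sum.neutral) force
      then show ?thesis by (simp add: void_prob_def)
    next
      case False
      then have "1 \<le> exp T" by simp
      then show ?thesis using void_nonneg[of t] by linarith
    qed
    then have "ennreal 1 \<le> ennreal (void_prob r E t + exp T)" by (rule ennreal_leI)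
    then show ?case by (simp add: V_def void_event_def P0.emeasure_space_1)
  next
    case (Suc K)
    have "V m (Suc K) t \<le>
      (\<integral>\<^sup>+w. ennreal (g w t) * ennreal (void_prob r E (\<lambda>e. t e - w)) + ennreal (exp T / 2 ^ K * exp (- w)) \<partial>?D)"
      unfolding step
    proof (intro nn_integral_mono)
      fix w
      have "V (Suc m) K (\<lambda>e. t e - w)
         \<le> ennreal (void_prob r E (\<lambda>e. t e - w) + exp (T - w) / 2 ^ K)"
        using Suc.prems by (intro Suc.IH) auto
      then have "ennreal (g w t) * V (Suc m) K (\<lambda>e. t e - w)
         \<le> ennreal (g w t) * ennreal (void_prob r E (\<lambda>e. t e - w) + exp (T - w) / 2 ^ K)"
        by (intro mult_left_mono) auto
      also have "\<dots> = ennreal (g w t * void_prob r E (\<lambda>e. t e - w) + g w t * (exp (T - w) / 2 ^ K))"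
        using g_nonneg by (simp add: ennreal_mult'[symmetric] distrib_left del: ennreal_plus)
      also have "\<dots> \<le> ennreal (g w t * void_prob r E (\<lambda>e. t e - w) + exp T / 2 ^ K * exp (- w))"
      proof (intro ennreal_leI add_left_mono)
        have "g w t \<le> 1" using r by (simp add: g_def)
        then have "g w t * (exp (T - w) / 2 ^ K) \<le> 1 * (exp (T - w) / 2 ^ K)" by (intro mult_right_mono) auto
        then show "g w t * (exp (T - w) / 2 ^ K) \<le> exp T / 2 ^ K * exp (- w)"
          by (simp add: exp_diff exp_minus field_simps)
      qed
      finally show "ennreal (g w t) * V (Suc m) K (\<lambda>e. t e - w)
        \<le> ennreal (g w t) * ennreal (void_prob r E (\<lambda>e. t e - w)) + ennreal (exp T / 2 ^ K * exp (- w))"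
        using g_nonneg void_nonneg by (simp add: ennreal_mult)
    qed
    also have "\<dots> = ennreal (void_prob r E t) + (\<integral>\<^sup>+w. ennreal (exp T / 2 ^ K * exp (- w)) \<partial>?D)"
      by (subst nn_integral_add) (auto simp: D_int)
    also have "(\<integral>\<^sup>+w. ennreal (exp T / 2 ^ K * exp (- w)) \<partial>?D) = ennreal (exp T / 2 ^ Suc K)"
    proof -
      have "(\<integral>\<^sup>+w. ennreal (exp T / 2 ^ K * exp (- w)) \<partial>?D) =
        (\<integral>\<^sup>+w. ennreal (exp T / 2 ^ K) * ennreal (exponential_density 1 w * exp (- w)) \<partial>lborel)"
        by (subst nn_integral_density)
           (auto intro!: nn_integral_cong simp: ennreal_mult'[symmetric] exponential_density_nonneg mult.left_commute)
      also have "\<dots> = ennreal (exp T / 2 ^ K) * ennreal (1 / 2)"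
        by (subst nn_integral_cmult) (auto simp: exponential_laplace_integral)
      also have "\<dots> = ennreal (exp T / 2 ^ K * (1 / 2))" by (rule ennreal_mult'[symmetric]) simp
      also have "exp T / 2 ^ K * (1 / 2) = exp T / 2 ^ Suc K" by simp
      finally show ?thesis .
    qed
    finally show ?case using void_nonneg by (simp add: ennreal_plus[symmetric] del: ennreal_plus)
  qed
qed

text \<open>The thinning property, expressed by void probabilities: the right-hand side is a product
  over \<open>E\<close>, so the first arrivals in the different cells behave like independent
  exponential variables of rate \<open>r\<close>. The events for the first \<open>K + 1\<close>
  marks decrease to the event in question, and the two bounds squeeze their probabilities.\<close>

lemma (in prob_space) prob_no_early_mark:
  fixes W :: "nat \<Rightarrow> 'a \<Rightarrow> real" and c :: "nat \<Rightarrow> 'a \<Rightarrow> 'e" and r :: real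
  assumes indep: "indep_vars (\<lambda>_. borel \<Otimes>\<^sub>M count_space UNIV) (\<lambda>k \<omega>. (W k \<omega>, c k \<omega>)) {1..}"
    and law: "\<And>k. k \<ge> 1 \<Longrightarrow> distr M (borel \<Otimes>\<^sub>M count_space UNIV) (\<lambda>\<omega>. (W k \<omega>, c k \<omega>)) =
      density lborel (exponential_density 1) \<Otimes>\<^sub>M \<nu>"
    and \<nu>: "prob_space \<nu>" "sets \<nu> = sets (count_space UNIV)"
    and E: "finite E" "\<And>e. e \<in> E \<Longrightarrow> measure \<nu> {e} = r" and r: "0 \<le> r" "r * card E \<le> 1"
  shows "prob {\<omega>\<in>space M. \<forall>k\<ge>1. c k \<omega> \<in> E \<longrightarrow> t (c k \<omega>) \<le> (\<Sum>i=1..k. W i \<omega>)} = void_prob r E t"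
proof -
  let ?N = "borel \<Otimes>\<^sub>M count_space UNIV :: (real \<times> 'e) measure"
  define \<mu> where "\<mu> = density lborel (exponential_density 1) \<Otimes>\<^sub>M \<nu>"
  define A where "A K = {\<omega>\<in>space M. \<forall>k\<in>{1..Suc K}. c k \<omega> \<in> E \<longrightarrow> t (c k \<omega>) \<le> (\<Sum>i=1..k. W i \<omega>)}" for K
  obtain T where T: "\<And>e. e \<in> E \<Longrightarrow> t e \<le> T"
    using E Max_ge[of "t ` E"] by (meson finite_imageI image_eqI)
  have A_bounds: "void_prob r E t \<le> prob (A K) \<and> prob (A K) \<le> void_prob r E t + exp T / 2 ^ Suc K"
    and A_sets: "A K \<in> events" for K
  proof -
    let ?I = "{0<..0 + Suc K}"
    let ?X = "\<lambda>\<omega>. \<lambda>k\<in>?I. (W k \<omega>, c k \<omega>)"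
    have rv: "random_variable ?N (\<lambda>\<omega>. (W k \<omega>, c k \<omega>))" if "k \<in> ?I" for k
      using indep that by (auto simp: indep_vars_def)
    have "indep_vars (\<lambda>_. ?N) (\<lambda>k \<omega>. (W k \<omega>, c k \<omega>)) ?I"
      by (rule indep_vars_subset[OF indep]) auto
    then have "distr M (PiM ?I (\<lambda>_. ?N)) ?X = PiM ?I (\<lambda>k. distr M ?N (\<lambda>\<omega>. (W k \<omega>, c k \<omega>)))"
      using rv by (subst (asm) indep_vars_iff_distr_eq_PiM') auto
    also have "\<dots> = PiM ?I (\<lambda>_. \<mu>)" by (intro PiM_cong) (auto simp: law \<mu>_def)
    finally have D: "distr M (PiM ?I (\<lambda>_. ?N)) ?X = PiM ?I (\<lambda>_. \<mu>)" .
    have X: "?X \<in> measurable M (PiM ?I (\<lambda>_. ?N))" using rv by (intro measurable_restrict) auto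
    let ?B = "{x \<in> space (PiM ?I (\<lambda>_. \<mu>)). void_event E t 0 (Suc K) x}"
    have B: "?B \<in> sets (PiM ?I (\<lambda>_. \<mu>))"
      unfolding \<mu>_def by (rule void_event_measurable[OF \<nu>(2) order_refl])
    have B': "?B \<in> sets (PiM ?I (\<lambda>_. ?N))" using B unfolding D[symmetric] by simp
    have sp: "space (PiM ?I (\<lambda>_. \<mu>)) = space (PiM ?I (\<lambda>_. ?N))" unfolding D[symmetric] by simp
    have XA: "?X -` ?B \<inter> space M = A K"
    proof -
      have "void_event E t 0 (Suc K) (?X \<omega>) \<longleftrightarrow>
        (\<forall>k\<in>{1..Suc K}. c k \<omega> \<in> E \<longrightarrow> t (c k \<omega>) \<le> (\<Sum>i=1..k. W i \<omega>))" for \<omega>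
      proof -
        have "(\<Sum>i\<in>{0<..k}. fst (?X \<omega> i)) = (\<Sum>i=1..k. W i \<omega>)" if "k \<in> {1..Suc K}" for k
          using that by (intro sum.cong) auto
        moreover have "{0<..0 + Suc K} = {1..Suc K}" by auto
        ultimately show ?thesis unfolding void_event_def by auto
      qed
      then show ?thesis using measurable_space[OF X] sp by (auto simp: A_def)
    qed
    show "A K \<in> events" using measurable_sets[OF X B'] XA by simp
    have "emeasure (PiM ?I (\<lambda>_. \<mu>)) ?B = emeasure (distr M (PiM ?I (\<lambda>_. ?N)) ?X) ?B"
      by (simp only: D)
    also have "\<dots> = emeasure M (?X -` ?B \<inter> space M)" by (rule emeasure_distr[OF X B'])
    also have "\<dots> = emeasure M (A K)" by (simp only: XA)
    finally have "emeasure (PiM ?I (\<lambda>_. \<mu>)) ?B = emeasure M (A K)" .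
    moreover have "ennreal (void_prob r E t) \<le> emeasure (PiM ?I (\<lambda>_. \<mu>)) ?B"
      "emeasure (PiM ?I (\<lambda>_. \<mu>)) ?B \<le> ennreal (void_prob r E t + exp T / 2 ^ Suc K)"
      using void_event_bounds[OF \<nu> E r T, where m = 0 and K = "Suc K"] unfolding \<mu>_def by auto
    moreover have "0 \<le> void_prob r E t + exp T / 2 ^ Suc K" by (simp add: void_prob_def)
    ultimately show "void_prob r E t \<le> prob (A K) \<and> prob (A K) \<le> void_prob r E t + exp T / 2 ^ Suc K"
      by (simp add: emeasure_eq_measure)
  qed
  have "(\<lambda>K. prob (A K)) \<longlonglongrightarrow> prob (\<Inter>K. A K)"
    using A_sets by (intro finite_Lim_measure_decseq) (auto simp: decseq_def A_def)
  moreover have "(\<lambda>K. prob (A K)) \<longlonglongrightarrow> void_prob r E t"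
  proof (rule tendsto_sandwich[OF _ _ tendsto_const])
    have "(\<lambda>K. exp T / 2 * (1 / 2) ^ K) \<longlonglongrightarrow> exp T / 2 * 0"
      by (intro tendsto_mult tendsto_const LIMSEQ_power_zero) simp
    then have "(\<lambda>K. void_prob r E t + exp T / 2 * (1 / 2) ^ K) \<longlonglongrightarrow> void_prob r E t + exp T / 2 * 0"
      by (rule tendsto_add[OF tendsto_const])
    then show "(\<lambda>K. void_prob r E t + exp T / 2 ^ Suc K) \<longlonglongrightarrow> void_prob r E t"
      by (simp add: power_divide)
  qed (use A_bounds in auto)
  moreover have "(\<Inter>K. A K) = {\<omega>\<in>space M. \<forall>k\<ge>1. c k \<omega> \<in> E \<longrightarrow> t (c k \<omega>) \<le> (\<Sum>i=1..k. W i \<omega>)}"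
  proof (intro set_eqI iffI)
    fix \<omega> assume *: "\<omega> \<in> (\<Inter>K. A K)"
    have "c k \<omega> \<in> E \<longrightarrow> t (c k \<omega>) \<le> (\<Sum>i=1..k. W i \<omega>)" if "k \<ge> 1" for k
      using INT_D[OF *, of k] that by (auto simp: A_def)
    then show "\<omega> \<in> {\<omega>\<in>space M. \<forall>k\<ge>1. c k \<omega> \<in> E \<longrightarrow> t (c k \<omega>) \<le> (\<Sum>i=1..k. W i \<omega>)}"
      using INT_D[OF *, of 0] by (auto simp: A_def)
  qed (auto simp: A_def)
  ultimately show ?thesis using LIMSEQ_unique by metis
qed

section \<open>Cells\<close>

text \<open>Cells on the diagonal are not edges.  Marks falling into them are simply discarded, which does
  not affect the independence of the other cells.\<close>

definition grid_cell :: "nat \<Rightarrow> real \<times> real \<Rightarrow> int \<times> int" where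
  "grid_cell n p = (min \<lfloor>real (n + 1) * fst p\<rfloor> \<lfloor>real (n + 1) * snd p\<rfloor>,
                    max \<lfloor>real (n + 1) * fst p\<rfloor> \<lfloor>real (n + 1) * snd p\<rfloor>)"

definition cell_law :: "nat \<Rightarrow> (int \<times> int) measure" where
  "cell_law n = distr (uniform_measure lborel {0..1} \<Otimes>\<^sub>M uniform_measure lborel {0..1})
                  (count_space UNIV) (grid_cell n)"

text \<open>An edge between \<open>i\<close> and \<open>j\<close> is hit from the two squares
  \<open>(i, j)\<close> and \<open>(j, i)\<close>, each of area \<open>1 / (n + 1)^2\<close>; there
  are \<open>n + 1\<close> columns because the vertices are \<open>0, ..., n\<close>.\<close>

definition cell_mass :: "nat \<Rightarrow> real" where
  "cell_mass n = 2 / (real (n + 1))\<^sup>2"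

lemma grid_cell_measurable [measurable]: "grid_cell n \<in> measurable (borel \<Otimes>\<^sub>M borel) (count_space UNIV)"
  unfolding grid_cell_def by measurable

lemma prob_space_uniform_01: "prob_space (uniform_measure lborel {0..1::real})"
  by (rule prob_space_uniform_measure) auto

lemma sets_cell_law [simp]: "sets (cell_law n) = sets (count_space UNIV)"
  by (simp add: cell_law_def)

lemma pair_uniform_measurable_grid_cell:
  "grid_cell n \<in> measurable (uniform_measure lborel {0..1} \<Otimes>\<^sub>M uniform_measure lborel {0..1}) (count_space UNIV)"
proof -
  have "sets (uniform_measure lborel {0..1::real} \<Otimes>\<^sub>M uniform_measure lborel {0..1::real}) =
      sets (borel \<Otimes>\<^sub>M borel)"
    by (intro sets_pair_measure_cong) auto
  then show ?thesis using grid_cell_measurable by (simp cong: measurable_cong_sets)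
qed

lemma prob_space_cell_law: "prob_space (cell_law n)"
proof -
  interpret A: prob_space "uniform_measure lborel {0..1::real}" by (rule prob_space_uniform_01)
  interpret pair_prob_space "uniform_measure lborel {0..1::real}" "uniform_measure lborel {0..1::real}" ..
  show ?thesis unfolding cell_law_def by (rule prob_space_distr[OF pair_uniform_measurable_grid_cell])
qed

lemma measure_floor_cell:
  assumes "0 \<le> i" "i \<le> int n"
  shows "measure (uniform_measure lborel {0..1::real}) {u. \<lfloor>real (n + 1) * u\<rfloor> = i} = 1 / real (n + 1)"
proof -
  define m where "m = real (n + 1)"
  have m: "m > 0" by (simp add: m_def)
  have eq: "{u. \<lfloor>m * u\<rfloor> = i} = {of_int i / m..<(of_int i + 1) / m}"
    using m by (auto simp: floor_eq_iff field_simps)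
  have "of_int i + 1 \<le> m" using assms by (simp add: m_def)
  have sub: "{0..1} \<inter> {of_int i / m..<(of_int i + 1) / m} = {of_int i / m..<(of_int i + 1) / m}"
  proof -
    have "0 \<le> of_int i / m" "(of_int i + 1) / m \<le> 1"
      using \<open>of_int i + 1 \<le> m\<close> assms m by auto
    then show ?thesis by auto
  qed
  have "measure (uniform_measure lborel {0..1::real}) {of_int i / m..<(of_int i + 1) / m} =
     measure lborel ({0..1} \<inter> {of_int i / m..<(of_int i + 1) / m}) / measure lborel {0..1::real}"
    by (rule measure_uniform_measure) auto
  also have "\<dots> = 1 / m" unfolding sub using m by (simp add: divide_right_mono diff_divide_distrib[symmetric])
  finally show ?thesis unfolding m_def[symmetric] eq .
qed

lemma measure_cell_law:
  assumes "e \<in> edges n"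
  shows "measure (cell_law n) {e} = cell_mass n"
proof -
  obtain i j where e: "e = (i, j)" by force
  have ij: "0 \<le> i" "i < j" "j \<le> int n" using assms by (auto simp: edges_def e)
  let ?L = "uniform_measure lborel {0..1::real}"
  interpret A: prob_space ?L by (rule prob_space_uniform_01)
  interpret L: pair_prob_space ?L ?L ..
  let ?S = "\<lambda>i. {u. \<lfloor>real (n + 1) * u\<rfloor> = i}"
  have S: "?S i \<in> sets ?L" for i
  proof -
    have "?S i = {u\<in>space borel. \<lfloor>real (n + 1) * u\<rfloor> = i}" by simp
    also have "\<dots> \<in> sets borel" by measurable
    finally show ?thesis by simp
  qed
  have sp: "space (?L \<Otimes>\<^sub>M ?L) = UNIV" by (simp add: space_pair_measure)
  have pre: "grid_cell n -` {e} \<inter> space (?L \<Otimes>\<^sub>M ?L) = ?S i \<times> ?S j \<union> ?S j \<times> ?S i"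
    using ij unfolding sp by (auto simp: e grid_cell_def min_def max_def split: if_splits)
  have rect: "measure (?L \<Otimes>\<^sub>M ?L) (?S a \<times> ?S b) = 1 / (real (n + 1))\<^sup>2"
    if "0 \<le> a" "a \<le> int n" "0 \<le> b" "b \<le> int n" for a b
  proof -
    have "emeasure (?L \<Otimes>\<^sub>M ?L) (?S a \<times> ?S b) = emeasure ?L (?S a) * emeasure ?L (?S b)"
      by (rule A.emeasure_pair_measure_Times[OF S S])
    then have "measure (?L \<Otimes>\<^sub>M ?L) (?S a \<times> ?S b) = measure ?L (?S a) * measure ?L (?S b)"
      by (simp add: L.P.emeasure_eq_measure A.emeasure_eq_measure ennreal_mult[symmetric])
    then show ?thesis using measure_floor_cell that by (simp add: power2_eq_square)
  qed
  have "measure (cell_law n) {e} = measure (?L \<Otimes>\<^sub>M ?L) (?S i \<times> ?S j \<union> ?S j \<times> ?S i)"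
    unfolding cell_law_def pre[symmetric] by (rule measure_distr[OF pair_uniform_measurable_grid_cell]) simp
  also have "\<dots> = measure (?L \<Otimes>\<^sub>M ?L) (?S i \<times> ?S j) + measure (?L \<Otimes>\<^sub>M ?L) (?S j \<times> ?S i)"
    using ij by (intro L.P.finite_measure_Union pair_measureI S) blast
  also have "\<dots> = cell_mass n" using rect[of i j] rect[of j i] ij by (simp add: cell_mass_def)
  finally show ?thesis .
qed

lemma cell_mass_nonneg [simp]: "0 \<le> cell_mass n" and cell_mass_pos [simp]: "0 < cell_mass n"
  by (simp_all add: cell_mass_def)

text \<open>The left-hand side is the probability of missing the diagonal. This is the hypothesis
  \<open>r * card E \<le> 1\<close> of the thinning lemma.\<close>

lemma cell_mass_card_le: "cell_mass n * card (edges n) \<le> 1"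
proof -
  interpret prob_space "cell_law n" by (rule prob_space_cell_law)
  have "cell_mass n * card (edges n) = (\<Sum>e\<in>edges n. measure (cell_law n) {e})"
    by (simp add: measure_cell_law)
  also have "\<dots> = prob (edges n)"
    by (intro finite_measure_eq_sum_singleton[symmetric]) auto
  also have "\<dots> \<le> 1" by simp
  finally show ?thesis .
qed

lemma (in prob_space) distr_pair_compose_indep:
  assumes "indep_var S X T Y" and p: "p \<in> measurable S S'" and q: "q \<in> measurable T T'"
  shows "distr M (S' \<Otimes>\<^sub>M T') (\<lambda>\<omega>. (p (X \<omega>), q (Y \<omega>))) =
    distr M S' (\<lambda>\<omega>. p (X \<omega>)) \<Otimes>\<^sub>M distr M T' (\<lambda>\<omega>. q (Y \<omega>))"
proof -
  from assms(1) have X [measurable]: "random_variable S X" and Y [measurable]: "random_variable T Y"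
    and D: "distr M S X \<Otimes>\<^sub>M distr M T Y = distr M (S \<Otimes>\<^sub>M T) (\<lambda>\<omega>. (X \<omega>, Y \<omega>))"
    by (auto simp: indep_var_distribution_eq)
  note [measurable] = p q
  interpret Y: prob_space "distr M T Y" by (rule prob_space_distr[OF Y])
  interpret qY: prob_space "distr (distr M T Y) T' q" by (rule Y.prob_space_distr) simp
  have "distr M S' (\<lambda>\<omega>. p (X \<omega>)) \<Otimes>\<^sub>M distr M T' (\<lambda>\<omega>. q (Y \<omega>)) =
     distr (distr M S X) S' p \<Otimes>\<^sub>M distr (distr M T Y) T' q"
    by (simp add: distr_distr comp_def)
  also have "\<dots> = distr (distr M S X \<Otimes>\<^sub>M distr M T Y) (S' \<Otimes>\<^sub>M T') (\<lambda>(x, y). (p x, q y))"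
    by (rule pair_measure_distr) (auto intro: qY.sigma_finite_measure_axioms)
  also have "\<dots> = distr M (S' \<Otimes>\<^sub>M T') (\<lambda>\<omega>. (p (X \<omega>), q (Y \<omega>)))"
    unfolding D by (subst distr_distr) (auto simp: comp_def)
  finally show ?thesis ..
qed

section \<open>Arrival times, cells and the law of the marks\<close>

context continuous_model
begin

definition arrival :: "nat \<Rightarrow> 'b \<Rightarrow> real" where
  "arrival k \<omega> = (\<Sum>i=1..k. W i \<omega>)"

definition cell :: "nat \<Rightarrow> nat \<Rightarrow> 'b \<Rightarrow> int \<times> int" where
  "cell n k \<omega> = grid_cell n (U k \<omega>, V k \<omega>)"

lemma random_variables:
  assumes "k \<ge> 1"
  shows "random_variable borel (W k)" "random_variable borel (U k)" "random_variable borel (V k)"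
proof -
  have *: "random_variable borel (case_sum W (case_sum U V) x)" if "x \<in> {1..} <+> {1..} <+> {1..}" for x
    using indep that by (auto simp: indep_vars_def)
  show "random_variable borel (W k)" "random_variable borel (U k)" "random_variable borel (V k)"
    using *[of "Inl k"] *[of "Inr (Inl k)"] *[of "Inr (Inr k)"] assms by auto
qed

lemma random_variable_arrival [measurable]: "random_variable borel (arrival k)"
  unfolding arrival_def using random_variables by (intro borel_measurable_sum) auto

lemma random_variable_cell:
  assumes "k \<ge> 1" shows "random_variable (count_space UNIV) (cell n k)"
proof -
  note [measurable] = random_variables[OF assms]
  show ?thesis unfolding cell_def by measurable
qed

lemma indep_marks:
  "indep_vars (\<lambda>_. borel \<Otimes>\<^sub>M count_space UNIV) (\<lambda>k \<omega>. (W k \<omega>, cell n k \<omega>)) {1..}"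
proof -
  define K where "K k = {Inl k, Inr (Inl k), Inr (Inr k)}" for k :: nat
  have "indep_vars (\<lambda>k. PiM (K k) (\<lambda>_. borel)) (\<lambda>k \<omega>. \<lambda>i\<in>K k. case_sum W (case_sum U V) i \<omega>) {1..}"
    by (rule indep_vars_restrict[OF indep]) (auto simp: K_def disjoint_family_on_def)
  then have "indep_vars (\<lambda>_. borel \<Otimes>\<^sub>M count_space UNIV)
     (\<lambda>k \<omega>. (\<lambda>f. (f (Inl k), grid_cell n (f (Inr (Inl k)), f (Inr (Inr k)))))
        (\<lambda>i\<in>K k. case_sum W (case_sum U V) i \<omega>)) {1..}"
  proof (rule indep_vars_compose2)
    fix k :: nat
    have [measurable]: "(\<lambda>f. f i) \<in> borel_measurable (PiM (K k) (\<lambda>_. borel :: real measure))" if "i \<in> K k" for i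
      using that by (rule measurable_component_singleton)
    have [measurable]: "(\<lambda>f. f (Inl k)) \<in> borel_measurable (PiM (K k) (\<lambda>_. borel :: real measure))"
      "(\<lambda>f. f (Inr (Inl k))) \<in> borel_measurable (PiM (K k) (\<lambda>_. borel :: real measure))"
      "(\<lambda>f. f (Inr (Inr k))) \<in> borel_measurable (PiM (K k) (\<lambda>_. borel :: real measure))"
      by (auto simp: K_def)
    show "(\<lambda>f. (f (Inl k), grid_cell n (f (Inr (Inl k)), f (Inr (Inr k))))) \<in>
       measurable (PiM (K k) (\<lambda>_. borel)) (borel \<Otimes>\<^sub>M count_space UNIV)" by measurable
  qed
  then show ?thesis by (simp add: K_def cell_def)
qed

lemma distr_marks_product:
  assumes "k \<ge> 1"
  shows "distr N (borel \<Otimes>\<^sub>M count_space UNIV) (\<lambda>\<omega>. (W k \<omega>, cell n k \<omega>)) =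
    distr N borel (W k) \<Otimes>\<^sub>M distr N (count_space UNIV) (cell n k)"
    and "distr N (borel \<Otimes>\<^sub>M borel) (\<lambda>\<omega>. (U k \<omega>, V k \<omega>)) =
    distr N borel (U k) \<Otimes>\<^sub>M distr N borel (V k)"
proof -
  let ?f = "\<lambda>A \<omega>. \<lambda>i\<in>A. case_sum W (case_sum U V) i \<omega>"
  have m: "(\<lambda>f. f i) \<in> borel_measurable (PiM A (\<lambda>_. borel :: real measure))" if "i \<in> A"
    for i :: "nat + nat + nat" and A
    using that by (rule measurable_component_singleton)
  have 1: "indep_var (PiM {Inl k} (\<lambda>_. borel)) (?f {Inl k}) (PiM {Inr (Inl k), Inr (Inr k)} (\<lambda>_. borel)) (?f {Inr (Inl k), Inr (Inr k)})"
    using assms by (intro indep_var_restrict[OF indep]) auto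
  have [measurable]: "(\<lambda>f. f (Inr (Inl k))) \<in> borel_measurable (PiM {Inr (Inl k), Inr (Inr k)} (\<lambda>_. borel :: real measure))"
    "(\<lambda>f. f (Inr (Inr k))) \<in> borel_measurable (PiM {Inr (Inl k), Inr (Inr k)} (\<lambda>_. borel :: real measure))"
    by (auto intro: m)
  have 2: "(\<lambda>f. grid_cell n (f (Inr (Inl k)), f (Inr (Inr k)))) \<in>
     measurable (PiM {Inr (Inl k), Inr (Inr k)} (\<lambda>_. borel)) (count_space UNIV)" by measurable
  show "distr N (borel \<Otimes>\<^sub>M count_space UNIV) (\<lambda>\<omega>. (W k \<omega>, cell n k \<omega>)) =
    distr N borel (W k) \<Otimes>\<^sub>M distr N (count_space UNIV) (cell n k)"
    using distr_pair_compose_indep[OF 1 m[of "Inl k"] 2] by (simp add: cell_def[abs_def])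
  have 3: "indep_var (PiM {Inr (Inl k)} (\<lambda>_. borel)) (?f {Inr (Inl k)}) (PiM {Inr (Inr k)} (\<lambda>_. borel)) (?f {Inr (Inr k)})"
    using assms by (intro indep_var_restrict[OF indep]) auto
  show "distr N (borel \<Otimes>\<^sub>M borel) (\<lambda>\<omega>. (U k \<omega>, V k \<omega>)) =
    distr N borel (U k) \<Otimes>\<^sub>M distr N borel (V k)"
    using distr_pair_compose_indep[OF 3 m[of "Inr (Inl k)"] m[of "Inr (Inr k)"]] by simp
qed

lemma distr_UV:
  assumes "k \<ge> 1"
  shows "distr N (borel \<Otimes>\<^sub>M borel) (\<lambda>\<omega>. (U k \<omega>, V k \<omega>)) =
    uniform_measure lborel {0..1} \<Otimes>\<^sub>M uniform_measure lborel {0..1}"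
  using distr_marks_product(2)[OF assms] U_uniform[OF assms] V_uniform[OF assms] by simp

lemma distr_cell:
  assumes "k \<ge> 1"
  shows "distr N (count_space UNIV) (cell n k) = cell_law n"
proof -
  note [measurable] = random_variables[OF assms]
  have "distr N (count_space UNIV) (cell n k) =
    distr (distr N (borel \<Otimes>\<^sub>M borel) (\<lambda>\<omega>. (U k \<omega>, V k \<omega>))) (count_space UNIV) (grid_cell n)"
    by (subst distr_distr) (auto simp: comp_def cell_def[abs_def])
  then show ?thesis unfolding distr_UV[OF assms] cell_law_def .
qed

lemma distr_mark:
  assumes "k \<ge> 1"
  shows "distr N (borel \<Otimes>\<^sub>M count_space UNIV) (\<lambda>\<omega>. (W k \<omega>, cell n k \<omega>)) =
    density lborel (exponential_density 1) \<Otimes>\<^sub>M cell_law n"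
proof -
  have "distr N borel (W k) = distr N lborel (W k)" by (intro distr_cong) auto
  also have "\<dots> = density lborel (exponential_density 1)"
    by (rule distributed_distr_eq_density[OF W_exponential[OF assms]])
  finally have "distr N borel (W k) = density lborel (exponential_density 1)" .
  then show ?thesis
    using distr_marks_product(1)[OF assms, of n] distr_cell[OF assms] by simp
qed

lemma void_probability:
  "prob {\<omega>\<in>space N. \<forall>k\<ge>1. cell n k \<omega> \<in> edges n \<longrightarrow> t (cell n k \<omega>) \<le> arrival k \<omega>} =
     exp (- cell_mass n * (\<Sum>e\<in>edges n. max 0 (t e)))"
  using prob_no_early_mark[OF indep_marks distr_mark prob_space_cell_law sets_cell_law finite_edges
    measure_cell_law cell_mass_nonneg cell_mass_card_le, of n t]
  unfolding arrival_def void_prob_def .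

lemma prob_cell: "k \<ge> 1 \<Longrightarrow> e \<in> edges n \<Longrightarrow> prob {\<omega>\<in>space N. cell n k \<omega> = e} = cell_mass n"
proof -
  assume k: "k \<ge> 1" and e: "e \<in> edges n"
  have "measure (distr N (count_space UNIV) (cell n k)) {e} = prob (cell n k -` {e} \<inter> space N)"
    by (rule measure_distr[OF random_variable_cell[OF k]]) auto
  moreover have "cell n k -` {e} \<inter> space N = {\<omega>\<in>space N. cell n k \<omega> = e}" by auto
  ultimately show ?thesis using measure_cell_law[OF e] distr_cell[OF k] by simp
qed

end

section \<open>Sparsity of compatible sets\<close>

lemma (in prob_space) prob_UN_geometric:
  assumes A: "\<And>l. l0 \<le> l \<Longrightarrow> A l \<in> events" "\<And>l. l0 \<le> l \<Longrightarrow> prob (A l) \<le> q ^ l" and q: "0 \<le> q" "q < 1"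
  shows "(\<Union>l\<in>{l0..}. A l) \<in> events" "prob (\<Union>l\<in>{l0..}. A l) \<le> q ^ l0 / (1 - q)"
proof -
  show "(\<Union>l\<in>{l0..}. A l) \<in> events" using A by auto
  have eq: "(\<Union>l\<in>{l0..}. A l) = (\<Union>i. A (i + l0))"
  proof (intro equalityI subsetI)
    fix x assume "x \<in> (\<Union>l\<in>{l0..}. A l)"
    then obtain l where "l0 \<le> l" "x \<in> A l" by auto
    then show "x \<in> (\<Union>i. A (i + l0))" by (intro UN_I[of "l - l0"]) auto
  next
    fix x assume "x \<in> (\<Union>i. A (i + l0))"
    then obtain i where "x \<in> A (i + l0)" by auto
    then show "x \<in> (\<Union>l\<in>{l0..}. A l)" by (intro UN_I[of "i + l0"]) auto
  qed
  have sm: "summable (\<lambda>i. q ^ (i + l0))"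
    using q by (simp add: power_add summable_geometric summable_mult2)
  have sm': "summable (\<lambda>i. prob (A (i + l0)))"
    by (rule summable_comparison_test'[OF sm]) (use A in auto)
  have "prob (\<Union>i. A (i + l0)) \<le> (\<Sum>i. prob (A (i + l0)))"
    using A sm' by (intro finite_measure_subadditive_countably) auto
  also have "\<dots> \<le> (\<Sum>i. q ^ (i + l0))"
    using A by (intro suminf_le sm sm') auto
  also have "\<dots> = q ^ l0 / (1 - q)"
    using q by (simp add: power_add suminf_mult2[symmetric] summable_geometric suminf_geometric)
  finally show "prob (\<Union>l\<in>{l0..}. A l) \<le> q ^ l0 / (1 - q)" by (simp add: eq)
qed

lemma exp_half_less_2: "exp (1 / 2) < (2 :: real)"
proof (rule power_less_imp_less_base)
  have "exp 1 < (2::real) ^ 2" using exp_le by simp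
  then show "exp (1 / 2) ^ 2 < (2::real) ^ 2" by (simp add: exp_of_nat_mult[symmetric])
qed simp

section \<open>Almost sure properties of the marks and sparsity in the grid\<close>

context continuous_model
begin

lemma W_pos_AE: "AE \<omega> in N. \<forall>k\<ge>1. 0 < W k \<omega>"
proof -
  have "AE \<omega> in N. 0 < W k \<omega>" if k: "k \<ge> 1" for k
  proof -
    note [measurable] = random_variables[OF k]
    have "prob {\<omega>\<in>space N. W k \<omega> \<le> 0} = 0"
      using exponential_distributedD_le[OF W_exponential[OF k], of 0] by simp
    then have "AE \<omega> in N. \<not> W k \<omega> \<le> 0"
      by (subst (asm) prob_Collect_eq_0) auto
    then show ?thesis by eventually_elim auto
  qed
  then have "AE \<omega> in N. 1 \<le> k \<longrightarrow> 0 < W k \<omega>" for k by (cases "1 \<le> k") auto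
  then show ?thesis by (simp add: AE_all_countable)
qed

lemma UV_AE: "AE \<omega> in N. \<forall>k\<ge>1. 0 \<le> U k \<omega> \<and> U k \<omega> < 1 \<and> 0 \<le> V k \<omega> \<and> V k \<omega> < 1 \<and> U k \<omega> \<noteq> V k \<omega>"
proof -
  let ?L = "uniform_measure lborel {0..1::real}"
  interpret L: prob_space ?L by (rule prob_space_uniform_01)
  interpret LL: pair_prob_space ?L ?L ..
  have unif: "AE x in ?L. 0 \<le> x \<and> x < 1"
    using AE_lborel_singleton[of "1::real"]
    by (subst AE_uniform_measure) (auto elim!: eventually_mono)
  have sing: "AE y in ?L. x \<noteq> y" for x
    using AE_lborel_singleton[of x] by (subst AE_uniform_measure) (auto elim!: eventually_mono)
  have diff: "AE p in ?L \<Otimes>\<^sub>M ?L. fst p \<noteq> snd p"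
  proof (rule LL.AE_pair_measure)
    have s: "sets (?L \<Otimes>\<^sub>M ?L) = sets (borel \<Otimes>\<^sub>M borel)" by (intro sets_pair_measure_cong) auto
    have "{p \<in> space (borel \<Otimes>\<^sub>M borel). fst p \<noteq> snd p} \<in> sets (borel \<Otimes>\<^sub>M (borel :: real measure))"
      by measurable
    then show "{p \<in> space (?L \<Otimes>\<^sub>M ?L). fst p \<noteq> snd p} \<in> sets (?L \<Otimes>\<^sub>M ?L)"
      unfolding s sets_eq_imp_space_eq[OF s] .
  qed (use sing in auto)
  have "AE \<omega> in N. 0 \<le> U k \<omega> \<and> U k \<omega> < 1 \<and> 0 \<le> V k \<omega> \<and> V k \<omega> < 1 \<and> U k \<omega> \<noteq> V k \<omega>" if k: "k \<ge> 1" for k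
  proof -
    note [measurable] = random_variables[OF k]
    have "AE x in distr N borel (U k). 0 \<le> x \<and> x < 1" using unif unfolding U_uniform[OF k] .
    then have 1: "AE \<omega> in N. 0 \<le> U k \<omega> \<and> U k \<omega> < 1" by (subst (asm) AE_distr_iff) auto
    have "AE x in distr N borel (V k). 0 \<le> x \<and> x < 1" using unif unfolding V_uniform[OF k] .
    then have 2: "AE \<omega> in N. 0 \<le> V k \<omega> \<and> V k \<omega> < 1" by (subst (asm) AE_distr_iff) auto
    have "AE p in distr N (borel \<Otimes>\<^sub>M borel) (\<lambda>\<omega>. (U k \<omega>, V k \<omega>)). fst p \<noteq> snd p"
      using diff unfolding distr_UV[OF k] .
    then have "AE \<omega> in N. U k \<omega> \<noteq> V k \<omega>" by (subst (asm) AE_distr_iff) auto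
    with 1 2 show ?thesis by eventually_elim auto
  qed
  then have "AE \<omega> in N. 1 \<le> k \<longrightarrow> 0 \<le> U k \<omega> \<and> U k \<omega> < 1 \<and> 0 \<le> V k \<omega> \<and> V k \<omega> < 1 \<and> U k \<omega> \<noteq> V k \<omega>" for k
    by (cases "1 \<le> k") auto
  then show ?thesis by (simp add: AE_all_countable)
qed

lemma arrival_mono:
  assumes "\<forall>k\<ge>1. 0 < W k \<omega>" "i \<le> j"
  shows "arrival i \<omega> \<le> arrival j \<omega>"
  unfolding arrival_def using assms by (intro sum_mono2) (auto intro: less_imp_le)

lemma arrival_pos:
  assumes "\<forall>k\<ge>1. 0 < W k \<omega>" "1 \<le> i"
  shows "0 < arrival i \<omega>"
  unfolding arrival_def using assms by (intro sum_pos) auto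

text \<open>Chernoff bound with parameter 1: \<open>exp (- arrival k)\<close> has mean
  \<open>(1 / 2) ^ k\<close>, and Markov's inequality multiplies this by \<open>exp (k / 2)\<close>.
  The resulting base is below 1 by \<open>exp_half_less_2\<close>.\<close>

lemma prob_arrival_small: "prob {\<omega>\<in>space N. arrival k \<omega> < real k / 2} \<le> (exp (1 / 2) / 2) ^ k"
proof -
  have W: "indep_vars (\<lambda>_. borel) (\<lambda>i \<omega>. fst (W i \<omega>, cell 0 i \<omega>)) {1..k}"
    by (rule indep_vars_compose2[OF indep_vars_subset[OF indep_marks]]) auto
  then have ind: "indep_vars (\<lambda>_. borel) (\<lambda>i \<omega>. ennreal (exp (- W i \<omega>))) {1..k}"
    using indep_vars_compose2[OF W, of "\<lambda>_ x. ennreal (exp (- x))" "\<lambda>_. borel"] by simp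
  have one: "(\<integral>\<^sup>+\<omega>. ennreal (exp (- W i \<omega>)) \<partial>N) = ennreal (1 / 2)" if "i \<in> {1..k}" for i
  proof -
    have "(\<integral>\<^sup>+\<omega>. ennreal (exp (- W i \<omega>)) \<partial>N) =
      (\<integral>\<^sup>+w. ennreal (exponential_density 1 w) * ennreal (exp (- w)) \<partial>lborel)"
      using that by (subst distributed_nn_integral[OF W_exponential, of i]) auto
    also have "\<dots> = (\<integral>\<^sup>+w. ennreal (exponential_density 1 w * exp (- w)) \<partial>lborel)"
      by (intro nn_integral_cong) (simp add: ennreal_mult' exponential_density_nonneg)
    finally show ?thesis by (simp only: exponential_laplace_integral)
  qed
  have "(\<integral>\<^sup>+\<omega>. ennreal (exp (- arrival k \<omega>)) \<partial>N) = (\<integral>\<^sup>+\<omega>. (\<Prod>i\<in>{1..k}. ennreal (exp (- W i \<omega>))) \<partial>N)"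
    by (intro nn_integral_cong) (simp add: arrival_def prod_ennreal exp_sum[symmetric] sum_negf)
  also have "\<dots> = (\<Prod>i\<in>{1..k}. \<integral>\<^sup>+\<omega>. ennreal (exp (- W i \<omega>)) \<partial>N)"
    by (rule indep_vars_nn_integral[OF _ ind]) auto
  also have "\<dots> = ennreal ((1 / 2) ^ k)" by (simp add: one ennreal_power[symmetric] del: ennreal_half)
  finally have lap: "(\<integral>\<^sup>+\<omega>. ennreal (exp (- arrival k \<omega>)) \<partial>N) = ennreal ((1 / 2) ^ k)" .
  have "emeasure N {\<omega>\<in>space N. 1 \<le> ennreal (exp (real k / 2)) * ennreal (exp (- arrival k \<omega>))} \<le>
    ennreal (exp (real k / 2)) * (\<integral>\<^sup>+\<omega>. ennreal (exp (- arrival k \<omega>)) * indicator (space N) \<omega> \<partial>N)"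
    by (rule nn_integral_Markov_inequality) auto
  also have "(\<integral>\<^sup>+\<omega>. ennreal (exp (- arrival k \<omega>)) * indicator (space N) \<omega> \<partial>N) = ennreal ((1 / 2) ^ k)"
    unfolding lap[symmetric] by (intro nn_integral_cong) auto
  also have "ennreal (exp (real k / 2)) * ennreal ((1 / 2) ^ k) = ennreal ((exp (1 / 2) / 2) ^ k)"
  proof -
    have "exp (real k / 2) = exp (1 / 2) ^ k" by (simp add: exp_of_nat_mult[symmetric])
    then show ?thesis by (simp add: ennreal_mult'[symmetric] power_divide)
  qed
  finally have le: "emeasure N {\<omega>\<in>space N. 1 \<le> ennreal (exp (real k / 2)) * ennreal (exp (- arrival k \<omega>))}
     \<le> ennreal ((exp (1 / 2) / 2) ^ k)" .
  have "emeasure N {\<omega>\<in>space N. arrival k \<omega> < real k / 2} \<le>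
     emeasure N {\<omega>\<in>space N. 1 \<le> ennreal (exp (real k / 2)) * ennreal (exp (- arrival k \<omega>))}"
  proof (intro emeasure_mono subsetI CollectI conjI)
    fix \<omega> assume "\<omega> \<in> {\<omega>\<in>space N. arrival k \<omega> < real k / 2}"
    then have "1 \<le> exp (real k / 2) * exp (- arrival k \<omega>)" by (simp add: exp_add[symmetric])
    then show "1 \<le> ennreal (exp (real k / 2)) * ennreal (exp (- arrival k \<omega>))"
      by (simp add: ennreal_mult'[symmetric] ennreal_1[symmetric] del: ennreal_1)
  qed auto
  with le have "emeasure N {\<omega>\<in>space N. arrival k \<omega> < real k / 2} \<le> ennreal ((exp (1 / 2) / 2) ^ k)"
    by (rule order_trans[rotated])
  then show ?thesis by (simp add: emeasure_eq_measure)
qed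

text \<open>Requiring the cells to be edges excludes the diagonal. An edge of positive length is
  incompatible with itself, so a compatible set never uses the same cell twice
  (\<open>cell_compatible_inj_on\<close>).\<close>

definition cell_compatible :: "nat \<Rightarrow> 'b \<Rightarrow> nat set \<Rightarrow> bool" where
  "cell_compatible n \<omega> B \<longleftrightarrow> (\<forall>i\<in>B. cell n i \<omega> \<in> edges n) \<and>
     pairwise (\<lambda>i j. chain_compat (cell n i \<omega>) (cell n j \<omega>)) B"

lemma cell_compatible_subset: "cell_compatible n \<omega> B \<Longrightarrow> A \<subseteq> B \<Longrightarrow> cell_compatible n \<omega> A"
  unfolding cell_compatible_def by (meson pairwise_subset subsetD)

lemma cell_compatible_inj_on: "cell_compatible n \<omega> B \<Longrightarrow> inj_on (\<lambda>i. cell n i \<omega>) B"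
proof (rule inj_onI, rule ccontr)
  fix i j assume *: "cell_compatible n \<omega> B" "i \<in> B" "j \<in> B" "cell n i \<omega> = cell n j \<omega>" "i \<noteq> j"
  then have "chain_compat (cell n i \<omega>) (cell n i \<omega>)" "cell n i \<omega> \<in> edges n"
    by (auto simp: cell_compatible_def pairwise_def)
  then show False by (auto simp: chain_compat_def edges_def)
qed

lemma cell_compatible_image: "cell_compatible n \<omega> B \<Longrightarrow> (\<lambda>i. cell n i \<omega>) ` B \<in> edge_chains n"
  by (auto simp: cell_compatible_def edge_chains_def pairwise_def)

lemma cell_compatible_measurable:
  assumes "finite B" "B \<subseteq> {1..}"
  shows "{\<omega>\<in>space N. cell_compatible n \<omega> B} \<in> events"
proof -
  have rv: "random_variable (count_space UNIV) (cell n i)" if "i \<in> B" for i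
    using random_variable_cell that assms by auto
  have 1: "Measurable.pred N (\<lambda>\<omega>. cell n i \<omega> \<in> edges n)" if "i \<in> B" for i
    by (rule measurable_compose[OF rv[OF that]]) simp
  have 2: "Measurable.pred N (\<lambda>\<omega>. chain_compat (cell n i \<omega>) (cell n j \<omega>))" if "i \<in> B" "j \<in> B" for i j
    by (rule measurable_compose_countable[OF _ rv[OF that(1)]], rule measurable_compose[OF rv[OF that(2)]]) simp
  have "Measurable.pred N (\<lambda>\<omega>. (\<forall>i\<in>B. cell n i \<omega> \<in> edges n) \<and>
      (\<forall>i\<in>B. \<forall>j\<in>B. i \<noteq> j \<longrightarrow> chain_compat (cell n i \<omega>) (cell n j \<omega>)))"
    using assms(1) 1 2 by (intro pred_intros_logic pred_intros_finite) auto
  then show ?thesis by (simp add: cell_compatible_def pairwise_def pred_def)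
qed

text \<open>Injectivity of \<open>\<phi>\<close> makes the prescribed indices distinct, so the
  events that index \<open>\<phi> e\<close> falls into cell \<open>e\<close> are independent and
  their probabilities multiply.\<close>

lemma prob_cells_eq:
  assumes S: "S \<subseteq> edges n" "S \<noteq> {}" and \<phi>: "inj_on \<phi> S" "\<phi> ` S \<subseteq> {1..}"
  shows "{\<omega>\<in>space N. \<forall>e\<in>S. cell n (\<phi> e) \<omega> = e} \<in> events"
    "prob {\<omega>\<in>space N. \<forall>e\<in>S. cell n (\<phi> e) \<omega> = e} = cell_mass n ^ card S"
proof -
  have fin: "finite S" using S finite_edges finite_subset by blast
  define A where "A i = {inv_into S \<phi> i}" for i
  have eq: "{\<omega>\<in>space N. \<forall>e\<in>S. cell n (\<phi> e) \<omega> = e} = (\<Inter>i\<in>\<phi> ` S. cell n i -` A i \<inter> space N)"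
    using S(2) \<phi>(1) by (auto simp: A_def)
  have rv: "cell n i -` A i \<inter> space N \<in> events" if "i \<in> \<phi> ` S" for i
    using that \<phi>(2) by (intro measurable_sets[OF random_variable_cell]) auto
  show "{\<omega>\<in>space N. \<forall>e\<in>S. cell n (\<phi> e) \<omega> = e} \<in> events"
    unfolding eq using rv S fin by (intro sets.finite_INT) auto
  have ind: "indep_vars (\<lambda>_. count_space UNIV) (\<lambda>k \<omega>. snd (W k \<omega>, cell n k \<omega>)) {1..}"
    by (rule indep_vars_compose2[OF indep_marks]) auto
  have "prob (\<Inter>i\<in>\<phi> ` S. (\<lambda>\<omega>. snd (W i \<omega>, cell n i \<omega>)) -` A i \<inter> space N) =
     (\<Prod>i\<in>\<phi> ` S. prob ((\<lambda>\<omega>. snd (W i \<omega>, cell n i \<omega>)) -` A i \<inter> space N))"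
    using S \<phi> fin by (intro indep_varsD[OF ind]) auto
  also have "\<dots> = (\<Prod>e\<in>S. prob ((\<lambda>\<omega>. snd (W (\<phi> e) \<omega>, cell n (\<phi> e) \<omega>)) -` A (\<phi> e) \<inter> space N))"
    using \<phi>(1) by (simp add: prod.reindex)
  also have "\<dots> = (\<Prod>e\<in>S. cell_mass n)"
  proof (intro prod.cong refl)
    fix e assume e: "e \<in> S"
    have "(\<lambda>\<omega>. snd (W (\<phi> e) \<omega>, cell n (\<phi> e) \<omega>)) -` A (\<phi> e) \<inter> space N = {\<omega>\<in>space N. cell n (\<phi> e) \<omega> = e}"
      using \<phi>(1) e by (auto simp: A_def)
    then show "prob ((\<lambda>\<omega>. snd (W (\<phi> e) \<omega>, cell n (\<phi> e) \<omega>)) -` A (\<phi> e) \<inter> space N) = cell_mass n"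
    proof -
      have "1 \<le> \<phi> e" "e \<in> edges n" using e S(1) \<phi>(2) by auto
      then show ?thesis using prob_cell[of "\<phi> e" e n] \<open>_ = {\<omega>\<in>space N. cell n (\<phi> e) \<omega> = e}\<close> by simp
    qed
  qed
  finally show "prob {\<omega>\<in>space N. \<forall>e\<in>S. cell n (\<phi> e) \<omega> = e} = cell_mass n ^ card S"
    unfolding eq by simp
qed

text \<open>As for longest increasing subsequences, compatible sets among \<open>m\<close> points
  have size of order \<open>sqrt m\<close>; this is the event that the first
  \<open>l^2 div 24\<close> points contain a set exceeding that order.\<close>

definition crowded :: "nat \<Rightarrow> nat \<Rightarrow> 'b set" where
  "crowded n l = {\<omega>\<in>space N. \<exists>B. B \<subseteq> {1..l\<^sup>2 div 24} \<and> card B = l \<and> cell_compatible n \<omega> B}"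

lemma crowded_measurable [measurable]: "crowded n l \<in> events"
proof -
  have "crowded n l = (\<Union>B\<in>{B. B \<subseteq> {1..l\<^sup>2 div 24} \<and> card B = l}. {\<omega>\<in>space N. cell_compatible n \<omega> B})"
    by (auto simp: crowded_def)
  also have "\<dots> \<in> events"
    by (intro sets.finite_UN cell_compatible_measurable) (auto intro: finite_subset)
  finally show ?thesis .
qed

text \<open>Union bound over the chain of cells and over the injection recording which index occupies
  each cell; the constant 24 makes the resulting base at most one half.\<close>

lemma prob_crowded_le:
  assumes l: "l \<ge> 1"
  shows "prob (crowded n l) \<le> (1 / 2) ^ l"
proof -
  define m where "m = l\<^sup>2 div 24"
  define T where "T = (SIGMA S:{S\<in>edge_chains n. card S = l}. {\<phi> \<in> S \<rightarrow>\<^sub>E {1..m}. inj_on \<phi> S})"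
  define G where "G p = {\<omega>\<in>space N. \<forall>e\<in>fst p. cell n (snd p e) \<omega> = e}" for p
  have finP: "finite {\<phi> \<in> S \<rightarrow>\<^sub>E {1..m}. inj_on \<phi> S}" if "S \<in> {S\<in>edge_chains n. card S = l}" for S
    by (rule finite_subset[OF Collect_restrict]) (use that finite_chain in \<open>auto intro: finite_PiE\<close>)
  have fin: "finite T"
    unfolding T_def by (intro finite_SigmaI finP) auto
  have G: "G p \<in> events \<and> prob (G p) = cell_mass n ^ l" if "p \<in> T" for p
  proof -
    obtain S \<phi> where p: "p = (S, \<phi>)" by force
    have "S \<subseteq> edges n" "S \<noteq> {}" "inj_on \<phi> S" "\<phi> ` S \<subseteq> {1..}" "card S = l"
      using that l by (auto simp: p T_def edge_chains_def PiE_def Pi_def)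
    then show ?thesis using prob_cells_eq[of S n \<phi>] by (simp add: G_def p)
  qed
  have "crowded n l \<subseteq> (\<Union>p\<in>T. G p)"
  proof
    fix \<omega> assume "\<omega> \<in> crowded n l"
    then obtain B where \<omega>: "\<omega> \<in> space N" and B: "B \<subseteq> {1..m}" "card B = l" "cell_compatible n \<omega> B"
      by (auto simp: crowded_def m_def)
    define S where "S = (\<lambda>i. cell n i \<omega>) ` B"
    define \<phi> where "\<phi> = restrict (inv_into B (\<lambda>i. cell n i \<omega>)) S"
    have inj: "inj_on (\<lambda>i. cell n i \<omega>) B" using cell_compatible_inj_on[OF B(3)] .
    have "S \<in> edge_chains n" using cell_compatible_image[OF B(3)] by (simp add: S_def)
    moreover have "card S = l" using inj B(2) by (simp add: S_def card_image)
    moreover have "\<phi> \<in> S \<rightarrow>\<^sub>E {1..m}"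
    proof (rule PiE_I)
      fix e assume "e \<in> S"
      then have "inv_into B (\<lambda>i. cell n i \<omega>) e \<in> B" unfolding S_def by (rule inv_into_into)
      then show "\<phi> e \<in> {1..m}" using B(1) \<open>e \<in> S\<close> by (auto simp: \<phi>_def)
    qed (simp add: \<phi>_def)
    moreover have "inj_on \<phi> S"
      using inj_on_inv_into[of S "\<lambda>i. cell n i \<omega>" B] by (simp add: \<phi>_def S_def inj_on_restrict_eq)
    moreover have "cell n (\<phi> e) \<omega> = e" if "e \<in> S" for e
      using f_inv_into_f[of e "\<lambda>i. cell n i \<omega>" B] that by (simp add: \<phi>_def S_def)
    ultimately show "\<omega> \<in> (\<Union>p\<in>T. G p)"
      using \<omega> by (intro UN_I[of "(S, \<phi>)"]) (auto simp: T_def G_def)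
  qed
  then have "prob (crowded n l) \<le> prob (\<Union>p\<in>T. G p)"
    using G fin by (intro finite_measure_mono sets.finite_UN) auto
  also have "\<dots> \<le> (\<Sum>p\<in>T. prob (G p))"
    using G fin by (intro finite_measure_subadditive_finite) auto
  also have "\<dots> = card T * cell_mass n ^ l" using G by simp
  also have "\<dots> \<le> (real (card {S\<in>edge_chains n. card S = l}) * real m ^ l) * cell_mass n ^ l"
  proof (intro mult_right_mono)
    have "card T = (\<Sum>S\<in>{S\<in>edge_chains n. card S = l}. card {\<phi> \<in> S \<rightarrow>\<^sub>E {1..m}. inj_on \<phi> S})"
      unfolding T_def by (intro card_SigmaI ballI finP) auto
    also have "\<dots> \<le> (\<Sum>S\<in>{S\<in>edge_chains n. card S = l}. m ^ l)"
    proof (intro sum_mono)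
      fix S assume S: "S \<in> {S\<in>edge_chains n. card S = l}"
      then have "card {\<phi> \<in> S \<rightarrow>\<^sub>E {1..m}. inj_on \<phi> S} \<le> card (S \<rightarrow>\<^sub>E {1..m})"
        by (intro card_mono finite_PiE Collect_restrict) (auto simp: finite_chain)
      also have "\<dots> = m ^ l" using S finite_chain[of S n] by (simp add: card_PiE)
      finally show "card {\<phi> \<in> S \<rightarrow>\<^sub>E {1..m}. inj_on \<phi> S} \<le> m ^ l" .
    qed
    also have "\<dots> = card {S\<in>edge_chains n. card S = l} * m ^ l" by simp
    finally have "real (card T) \<le> real (card {S\<in>edge_chains n. card S = l} * m ^ l)" by (rule of_nat_mono)
    then show "real (card T) \<le> real (card {S\<in>edge_chains n. card S = l}) * real m ^ l"
      unfolding of_nat_mult of_nat_power .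
  qed simp
  also have "\<dots> \<le> ((2 * exp 1 * (real n)\<^sup>2 / (real l)\<^sup>2) ^ l * real m ^ l) * cell_mass n ^ l"
    using card_chains_le[OF l, of n] by (intro mult_right_mono) auto
  also have "\<dots> = (2 * exp 1 * (real n)\<^sup>2 / (real l)\<^sup>2 * real m * cell_mass n) ^ l"
    by (simp only: power_mult_distrib)
  also have "\<dots> \<le> (1 / 2) ^ l"
  proof (intro power_mono)
    have "24 * m \<le> l\<^sup>2" by (simp add: m_def)
    then have "real (24 * m) \<le> real (l\<^sup>2)" by (rule of_nat_mono)
    then have "24 * real m \<le> (real l)\<^sup>2" by simp
    then have m: "real m / (real l)\<^sup>2 \<le> 1 / 24" using l by (simp add: field_simps)
    have n: "(real n)\<^sup>2 * cell_mass n \<le> 2"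
    proof -
      have "(real n)\<^sup>2 \<le> (real (n + 1))\<^sup>2" by (intro power_mono) auto
      then show ?thesis unfolding cell_mass_def by (simp add: pos_divide_le_eq)
    qed
    have e: "exp 1 \<le> (3::real)" by (rule exp_le)
    have "2 * exp 1 * (real n)\<^sup>2 / (real l)\<^sup>2 * real m * cell_mass n =
       2 * exp 1 * ((real n)\<^sup>2 * cell_mass n) * (real m / (real l)\<^sup>2)" by simp
    also have "\<dots> \<le> 2 * 3 * 2 * (1 / 24)"
      using m n e by (intro mult_mono) auto
    finally show "2 * exp 1 * (real n)\<^sup>2 / (real l)\<^sup>2 * real m * cell_mass n \<le> 1 / 2" by simp
  qed simp
  finally show ?thesis .
qed

end

section \<open>The embedded discrete weights\<close>

text \<open>Half-lines form an intersection-stable generator of the Borel sets, so factorization of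
  the joint distribution functions suffices.\<close>

lemma (in prob_space) indep_vars_if_prob_atMost:
  fixes X :: "'i \<Rightarrow> 'a \<Rightarrow> real"
  assumes rv: "\<And>i. i \<in> I \<Longrightarrow> random_variable borel (X i)"
    and J: "\<And>J x. J \<subseteq> I \<Longrightarrow> finite J \<Longrightarrow> J \<noteq> {} \<Longrightarrow>
      prob {\<omega>\<in>space M. \<forall>i\<in>J. X i \<omega> \<le> x i} = (\<Prod>i\<in>J. prob {\<omega>\<in>space M. X i \<omega> \<le> x i})"
  shows "indep_vars (\<lambda>_. borel) X I"
proof -
  define G where "G i = {X i -` {..x} \<inter> space M | x. True}" for i
  have "indep_sets G I"
  proof (rule indep_setsI)
    fix i assume "i \<in> I" then show "G i \<subseteq> events"
      using measurable_sets[OF rv] by (auto simp: G_def)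
  next
    fix A J assume J': "J \<noteq> {}" "J \<subseteq> I" "finite J" and A: "\<forall>j\<in>J. A j \<in> G j"
    then have "\<forall>j\<in>J. \<exists>x. A j = X j -` {..x} \<inter> space M" by (auto simp: G_def)
    from bchoice[OF this] obtain x where x: "\<forall>j\<in>J. A j = X j -` {..x j} \<inter> space M" by blast
    have "(\<Inter>j\<in>J. A j) = {\<omega>\<in>space M. \<forall>i\<in>J. X i \<omega> \<le> x i}" using x J' by auto
    moreover have "A j = {\<omega>\<in>space M. X j \<omega> \<le> x j}" if "j \<in> J" for j using x that by auto
    ultimately show "prob (\<Inter>j\<in>J. A j) = (\<Prod>j\<in>J. prob (A j))"
      using J[OF J'(2,3,1), of x] by simp
  qed
  then have "indep_sets (\<lambda>i. sigma_sets (space M) (G i)) I"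
  proof (rule indep_sets_sigma)
    fix i
    show "Int_stable (G i)"
    proof (rule Int_stableI)
      fix a b assume "a \<in> G i" "b \<in> G i"
      then obtain x y where "a = X i -` {..x} \<inter> space M" "b = X i -` {..y} \<inter> space M" by (auto simp: G_def)
      then have "a \<inter> b = X i -` {..min x y} \<inter> space M" by auto
      then show "a \<inter> b \<in> G i" by (auto simp: G_def)
    qed
  qed
  moreover have "sigma_sets (space M) (G i) = sigma_sets (space M) {X i -` A \<inter> space M | A. A \<in> sets borel}"
    for i
  proof -
    have b: "sets (borel :: real measure) = sigma_sets UNIV (range atMost)"
      by (subst borel_eq_atMost) (auto simp: image_def)
    have "{X i -` A \<inter> space M | A. A \<in> sets borel} = sigma_sets (space M) {X i -` A \<inter> space M | A. A \<in> range atMost}"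
      unfolding b by (rule sigma_sets_vimage_commute) auto
    also have "{X i -` A \<inter> space M | A. A \<in> range atMost} = G i" by (auto simp: G_def)
    finally show ?thesis using sigma_sets_sigma_sets_eq[of "G i" "space M"] by (auto simp: G_def)
  qed
  ultimately show ?thesis using rv by (simp add: indep_vars_def)
qed

context cdf_distribution
begin

text \<open>Outside \<open>(0, 1)\<close> the value of \<open>quantile\<close> is unspecified; the cut-off makes the function
  Borel measurable.\<close>

definition quantile_01 :: "real \<Rightarrow> real" where
  "quantile_01 y = (if y \<in> {0<..<1} then quantile (cdf M) y else 0)"

lemma quantile_01_measurable [measurable]: "quantile_01 \<in> borel_measurable borel"
proof -
  have "(\<lambda>y. if y \<in> {0<..<1} then I y else 0) \<in> borel_measurable borel"
    using measurable_CI
    by (subst measurable_If_restrict_space_iff) (simp_all del: greaterThanLessThan_iff)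
  then show ?thesis unfolding quantile_01_def[abs_def] quantile_def .
qed

lemma quantile_01_le_iff: "y \<in> {0<..<1} \<Longrightarrow> quantile_01 y \<le> x \<longleftrightarrow> y \<le> cdf M x"
  using pseudoinverse[of y x] by (auto simp: quantile_01_def quantile_def)

end

section \<open>First hits of the cells and the exact law of the embedded weights\<close>

context continuous_model
begin

text \<open>\<open>LEAST\<close> is unspecified for a cell that is never hit. Almost surely there is
  no such cell, and \<open>hit_properties\<close> carries the existence of a hit as a
  hypothesis.\<close>

definition hit :: "nat \<Rightarrow> int \<times> int \<Rightarrow> 'b \<Rightarrow> nat" where
  "hit n e \<omega> = (LEAST k. 1 \<le> k \<and> cell n k \<omega> = e)"

text \<open>The first arrival in the cell is exponential with rate \<open>cell_mass n\<close>, so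
  this level is uniform on \<open>(0, 1)\<close>. Early hits have levels near 1 and hence large
  weights.\<close>

definition hit_level :: "nat \<Rightarrow> int \<times> int \<Rightarrow> 'b \<Rightarrow> real" where
  "hit_level n e \<omega> = exp (- cell_mass n * arrival (hit n e \<omega>) \<omega>)"

lemma cell_eq_pred: "Measurable.pred N (\<lambda>\<omega>. 1 \<le> k \<and> cell n k \<omega> = e)"
proof (cases "1 \<le> k")
  case True
  have "Measurable.pred N (\<lambda>\<omega>. cell n k \<omega> = e)"
    by (rule measurable_compose[OF random_variable_cell[OF True]]) simp
  with True show ?thesis by simp
qed simp

lemma hit_measurable [measurable]: "hit n e \<in> measurable N (count_space UNIV)"
  unfolding hit_def by (rule measurable_Least) (rule cell_eq_pred)

lemma hit_level_measurable [measurable]: "random_variable borel (hit_level n e)"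
proof -
  have "random_variable borel (\<lambda>\<omega>. arrival (hit n e \<omega>) \<omega>)"
    by (rule measurable_compose_countable[OF _ hit_measurable]) simp
  then show ?thesis unfolding hit_level_def by measurable
qed

lemma void_event_sets:
  "{\<omega>\<in>space N. \<forall>k\<ge>1. cell n k \<omega> \<in> edges n \<longrightarrow> t (cell n k \<omega>) \<le> arrival k \<omega>} \<in> events"
proof -
  have "Measurable.pred N (\<lambda>\<omega>. 1 \<le> k \<longrightarrow> cell n k \<omega> \<in> edges n \<longrightarrow> t (cell n k \<omega>) \<le> arrival k \<omega>)" for k
  proof (cases "1 \<le> k")
    case True
    note rv = random_variable_cell[OF True]
    have "Measurable.pred N (\<lambda>\<omega>. cell n k \<omega> \<in> edges n)" by (rule measurable_compose[OF rv]) simp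
    moreover have "Measurable.pred N (\<lambda>\<omega>. t (cell n k \<omega>) \<le> arrival k \<omega>)"
      by (rule measurable_compose_countable[OF _ rv]) measurable
    ultimately show ?thesis by (intro pred_intros_logic) auto
  qed simp
  then have "Measurable.pred N (\<lambda>\<omega>. \<forall>k. 1 \<le> k \<longrightarrow> cell n k \<omega> \<in> edges n \<longrightarrow> t (cell n k \<omega>) \<le> arrival k \<omega>)"
    by (intro pred_intros_countable)
  then show ?thesis unfolding pred_def .
qed

text \<open>A cell that is never hit is in particular not hit before time \<open>T\<close>, which
  has probability \<open>exp (- cell_mass n * T)\<close>; now let \<open>T\<close> grow.\<close>

lemma all_cells_hit_AE: "AE \<omega> in N. \<forall>n. \<forall>e\<in>edges n. \<exists>k\<ge>1. cell n k \<omega> = e"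
proof -
  have one: "AE \<omega> in N. \<exists>k\<ge>1. cell n k \<omega> = e" if e: "e \<in> edges n" for n e
  proof -
    define A where "A = {\<omega>\<in>space N. \<not> (\<exists>k. 1 \<le> k \<and> cell n k \<omega> = e)}"
    have "Measurable.pred N (\<lambda>\<omega>. \<not> (\<exists>k. 1 \<le> k \<and> cell n k \<omega> = e))"
      by (intro pred_intros_logic pred_intros_countable cell_eq_pred)
    then have A: "A \<in> events" unfolding A_def pred_def .
    have le: "prob A \<le> exp (- cell_mass n * real T)" for T :: nat
    proof -
      define t where "t e' = (if e' = e then real T else 0)" for e'
      let ?B = "{\<omega>\<in>space N. \<forall>k\<ge>1. cell n k \<omega> \<in> edges n \<longrightarrow> t (cell n k \<omega>) \<le> arrival k \<omega>}"
      have "AE \<omega> in N. \<omega> \<in> A \<longrightarrow> \<omega> \<in> ?B"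
        using W_pos_AE
      proof eventually_elim
        fix \<omega> assume W: "\<forall>k\<ge>1. 0 < W k \<omega>"
        show "\<omega> \<in> A \<longrightarrow> \<omega> \<in> ?B"
          using arrival_pos[OF W] by (auto simp: A_def t_def less_imp_le)
      qed
      then have "prob A \<le> prob ?B" by (intro finite_measure_mono_AE void_event_sets)
      also have "\<dots> = exp (- cell_mass n * (\<Sum>e'\<in>edges n. max 0 (t e')))" by (rule void_probability)
      also have "(\<Sum>e'\<in>edges n. max 0 (t e')) = (\<Sum>e'\<in>edges n. if e' = e then real T else 0)"
        by (intro sum.cong) (auto simp: t_def)
      also have "\<dots> = real T" using e by simp
      finally show ?thesis .
    qed
    have "(\<lambda>T. exp (- cell_mass n * real T)) = (\<lambda>T. exp (- cell_mass n) ^ T)"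
      by (simp add: exp_of_nat_mult[symmetric] mult.commute)
    moreover have "(\<lambda>T. exp (- cell_mass n) ^ T) \<longlonglongrightarrow> 0" by (rule LIMSEQ_power_zero) simp
    ultimately have "(\<lambda>T. exp (- cell_mass n * real T)) \<longlonglongrightarrow> 0" by simp
    then have "prob A \<le> 0" by (rule LIMSEQ_le_const) (use le in auto)
    then have "prob A = 0" by (simp add: measure_le_0_iff)
    then have "AE \<omega> in N. \<omega> \<notin> A" using A by (intro AE_not_in) (simp add: null_sets_def emeasure_eq_measure)
    then show ?thesis by (auto simp: A_def elim!: AE_mp)
  qed
  have "AE \<omega> in N. e \<in> edges n \<longrightarrow> (\<exists>k\<ge>1. cell n k \<omega> = e)" for n e
    using one by (cases "e \<in> edges n") auto
  then show ?thesis unfolding Ball_def by (simp add: AE_all_countable)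
qed

lemma hit_properties:
  assumes "\<exists>k\<ge>1. cell n k \<omega> = e"
  shows "1 \<le> hit n e \<omega>" "cell n (hit n e \<omega>) \<omega> = e" "\<And>k. 1 \<le> k \<Longrightarrow> cell n k \<omega> = e \<Longrightarrow> hit n e \<omega> \<le> k"
  using LeastI_ex[of "\<lambda>k. 1 \<le> k \<and> cell n k \<omega> = e"] Least_le[of "\<lambda>k. 1 \<le> k \<and> cell n k \<omega> = e"] assms
  unfolding hit_def by auto

text \<open>The levels are independent and uniform. A level is at most \<open>f e\<close> iff the
  first hit of \<open>e\<close> occurs no earlier than \<open>- ln (f e) / cell_mass n\<close>, so
  the event is a void event; cells outside \<open>J\<close> receive the vacuous threshold 0. The
  case \<open>f e = 0\<close> is separate because of the logarithm.\<close>

lemma prob_hit_level_le: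
  assumes J: "J \<subseteq> edges n" and f: "\<And>e. e \<in> J \<Longrightarrow> 0 \<le> f e \<and> f e \<le> 1"
  shows "prob {\<omega>\<in>space N. \<forall>e\<in>J. hit_level n e \<omega> \<le> f e} = (\<Prod>e\<in>J. f e)"
proof (cases "\<exists>e\<in>J. f e = 0")
  case True
  then have empty: "{\<omega>\<in>space N. \<forall>e\<in>J. hit_level n e \<omega> \<le> f e} = {}" by (force simp: hit_level_def)
  have "(\<Prod>e\<in>J. f e) = 0" using True finite_subset[OF J finite_edges] by auto
  then show ?thesis unfolding empty by simp
next
  case False
  then have f': "0 < f e" "f e \<le> 1" if "e \<in> J" for e
    using f[OF that] False that by (auto simp: less_le)
  define t where "t e = (if e \<in> J then - ln (f e) / cell_mass n else 0)" for e
  have t: "0 \<le> t e" for e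
    using f' ln_le_zero_iff by (auto simp: t_def divide_nonpos_nonneg)
  have "AE \<omega> in N. (\<forall>e\<in>J. hit_level n e \<omega> \<le> f e) \<longleftrightarrow>
      (\<forall>k\<ge>1. cell n k \<omega> \<in> edges n \<longrightarrow> t (cell n k \<omega>) \<le> arrival k \<omega>)"
    using W_pos_AE all_cells_hit_AE
  proof eventually_elim
    fix \<omega> assume W: "\<forall>k\<ge>1. 0 < W k \<omega>" and hits: "\<forall>n. \<forall>e\<in>edges n. \<exists>k\<ge>1. cell n k \<omega> = e"
    have "hit_level n e \<omega> \<le> f e \<longleftrightarrow> (\<forall>k\<ge>1. cell n k \<omega> = e \<longrightarrow> t e \<le> arrival k \<omega>)" if "e \<in> J" for e
    proof -
      have h: "\<exists>k\<ge>1. cell n k \<omega> = e" using hits that J by auto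
      have "hit_level n e \<omega> \<le> f e \<longleftrightarrow> - cell_mass n * arrival (hit n e \<omega>) \<omega> \<le> ln (f e)"
        using f' that unfolding hit_level_def by (subst ln_ge_iff[symmetric]) auto
      also have "\<dots> \<longleftrightarrow> t e \<le> arrival (hit n e \<omega>) \<omega>"
        using that cell_mass_pos[of n] by (simp add: t_def field_simps) linarith
      also have "\<dots> \<longleftrightarrow> (\<forall>k\<ge>1. cell n k \<omega> = e \<longrightarrow> t e \<le> arrival k \<omega>)"
      proof (intro iffI allI impI)
        fix k assume "t e \<le> arrival (hit n e \<omega>) \<omega>" "1 \<le> k" "cell n k \<omega> = e"
        then show "t e \<le> arrival k \<omega>"
          using order_trans[OF _ arrival_mono[OF W hit_properties(3)[OF h]]] by blast
      qed (use hit_properties(1,2)[OF h] in auto)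
      finally show ?thesis .
    qed
    then have "(\<forall>e\<in>J. hit_level n e \<omega> \<le> f e) \<longleftrightarrow> (\<forall>k\<ge>1. cell n k \<omega> \<in> J \<longrightarrow> t (cell n k \<omega>) \<le> arrival k \<omega>)"
      by auto
    also have "\<dots> \<longleftrightarrow> (\<forall>k\<ge>1. cell n k \<omega> \<in> edges n \<longrightarrow> t (cell n k \<omega>) \<le> arrival k \<omega>)"
      using J arrival_pos[OF W] by (auto simp: t_def less_imp_le)
    finally show "(\<forall>e\<in>J. hit_level n e \<omega> \<le> f e) \<longleftrightarrow>
      (\<forall>k\<ge>1. cell n k \<omega> \<in> edges n \<longrightarrow> t (cell n k \<omega>) \<le> arrival k \<omega>)" .
  qed
  then have "AE \<omega> in N. \<omega> \<in> {\<omega>\<in>space N. \<forall>e\<in>J. hit_level n e \<omega> \<le> f e} \<longleftrightarrow>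
    \<omega> \<in> {\<omega>\<in>space N. \<forall>k\<ge>1. cell n k \<omega> \<in> edges n \<longrightarrow> t (cell n k \<omega>) \<le> arrival k \<omega>}"
    by eventually_elim (simp only: mem_Collect_eq)
  then have "prob {\<omega>\<in>space N. \<forall>e\<in>J. hit_level n e \<omega> \<le> f e} =
    prob {\<omega>\<in>space N. \<forall>k\<ge>1. cell n k \<omega> \<in> edges n \<longrightarrow> t (cell n k \<omega>) \<le> arrival k \<omega>}"
  proof (rule finite_measure_eq_AE)
    show "{\<omega>\<in>space N. \<forall>e\<in>J. hit_level n e \<omega> \<le> f e} \<in> events"
      using finite_subset[OF J finite_edges] by measurable
  qed (rule void_event_sets)
  also have "\<dots> = exp (- cell_mass n * (\<Sum>e\<in>edges n. max 0 (t e)))" by (rule void_probability)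
  also have "(\<Sum>e\<in>edges n. max 0 (t e)) = (\<Sum>e\<in>edges n. t e)"
    using t by (simp add: max_absorb2)
  also have "\<dots> = (\<Sum>e\<in>J. - ln (f e) / cell_mass n)"
    using J by (intro sum.mono_neutral_cong_right) (auto simp: t_def)
  also have "- cell_mass n * \<dots> = (\<Sum>e\<in>J. ln (f e))"
    using less_imp_neq[OF cell_mass_pos[of n]] by (simp add: sum_distrib_left)
  also have "exp \<dots> = (\<Prod>e\<in>J. f e)"
    using f' finite_subset[OF J finite_edges] by (simp add: exp_sum)
  finally show ?thesis .
qed

text \<open>Inverse transform sampling from independent uniform levels. The identity is exact for
  each \<open>n\<close>, also when \<open>D\<close> has atoms.\<close>

lemma embedded_weights_law:
  assumes D: "cdf_distribution D" and n: "n \<ge> 1"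
  shows "distr N (PiM (edges n) (\<lambda>_. borel)) (\<lambda>\<omega>. \<lambda>e\<in>edges n. cdf_distribution.quantile_01 D (hit_level n e \<omega>)) =
    PiM (edges n) (\<lambda>_. D)"
proof -
  interpret D: cdf_distribution D by fact
  let ?X = "\<lambda>e \<omega>. D.quantile_01 (hit_level n e \<omega>)"
  have rv: "random_variable borel (?X e)" for e by measurable
  have pr: "prob {\<omega>\<in>space N. \<forall>e\<in>J. ?X e \<omega> \<le> x e} = (\<Prod>e\<in>J. cdf D (x e))" if J: "J \<subseteq> edges n" for J x
  proof -
    have fin: "finite J" using finite_subset[OF J finite_edges] .
    have "AE \<omega> in N. (\<forall>e\<in>J. ?X e \<omega> \<le> x e) \<longleftrightarrow> (\<forall>e\<in>J. hit_level n e \<omega> \<le> cdf D (x e))"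
      using W_pos_AE all_cells_hit_AE
    proof eventually_elim
      fix \<omega> assume W: "\<forall>k\<ge>1. 0 < W k \<omega>" and hits: "\<forall>n. \<forall>e\<in>edges n. \<exists>k\<ge>1. cell n k \<omega> = e"
      have "hit_level n e \<omega> \<in> {0<..<1}" if "e \<in> J" for e
      proof -
        have "\<exists>k\<ge>1. cell n k \<omega> = e" using hits that J by auto
        then have "0 < arrival (hit n e \<omega>) \<omega>" using hit_properties(1) arrival_pos[OF W] by blast
        then show ?thesis using cell_mass_pos[of n] by (simp add: hit_level_def)
      qed
      then show "(\<forall>e\<in>J. ?X e \<omega> \<le> x e) \<longleftrightarrow> (\<forall>e\<in>J. hit_level n e \<omega> \<le> cdf D (x e))"
        using D.quantile_01_le_iff by auto
    qed
    then have "AE \<omega> in N. \<omega> \<in> {\<omega>\<in>space N. \<forall>e\<in>J. ?X e \<omega> \<le> x e} \<longleftrightarrow>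
      \<omega> \<in> {\<omega>\<in>space N. \<forall>e\<in>J. hit_level n e \<omega> \<le> cdf D (x e)}"
      by eventually_elim (simp only: mem_Collect_eq)
    then have "prob {\<omega>\<in>space N. \<forall>e\<in>J. ?X e \<omega> \<le> x e} = prob {\<omega>\<in>space N. \<forall>e\<in>J. hit_level n e \<omega> \<le> cdf D (x e)}"
    proof (rule finite_measure_eq_AE)
      show "{\<omega>\<in>space N. \<forall>e\<in>J. ?X e \<omega> \<le> x e} \<in> events"
        "{\<omega>\<in>space N. \<forall>e\<in>J. hit_level n e \<omega> \<le> cdf D (x e)} \<in> events"
        using fin by measurable
    qed
    also have "\<dots> = (\<Prod>e\<in>J. cdf D (x e))"
      using J D.cdf_nonneg D.cdf_bounded_prob by (intro prob_hit_level_le) auto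
    finally show ?thesis .
  qed
  have single: "prob {\<omega>\<in>space N. ?X e \<omega> \<le> x} = cdf D x" if "e \<in> edges n" for e x
    using pr[of "{e}" "\<lambda>_. x"] that by simp
  have "indep_vars (\<lambda>_. borel) ?X (edges n)"
  proof (rule indep_vars_if_prob_atMost)
    fix J x assume J: "J \<subseteq> edges n" "finite J" "J \<noteq> {}"
    show "prob {\<omega>\<in>space N. \<forall>e\<in>J. ?X e \<omega> \<le> x e} = (\<Prod>e\<in>J. prob {\<omega>\<in>space N. ?X e \<omega> \<le> x e})"
      unfolding pr[OF J(1)] using J by (intro prod.cong) (auto simp: single)
  qed (rule rv)
  \<comment> \<open>The product characterization of independence is applied to a nonempty family;
    this is where \<open>n \<ge> 1\<close> enters.\<close>
  moreover have "(0, 1) \<in> edges n" using n by (simp add: edges_def)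
  ultimately have "distr N (PiM (edges n) (\<lambda>_. borel)) (\<lambda>\<omega>. \<lambda>e\<in>edges n. ?X e \<omega>) =
    PiM (edges n) (\<lambda>e. distr N borel (?X e))"
    using rv by (subst (asm) indep_vars_iff_distr_eq_PiM') auto
  also have "\<dots> = PiM (edges n) (\<lambda>_. D)"
  proof (intro PiM_cong refl)
    fix e assume e: "e \<in> edges n"
    show "distr N borel (?X e) = D"
    proof (rule cdf_unique)
      show "real_distribution (distr N borel (?X e))" using rv by (rule real_distribution_distr)
      show "real_distribution D" ..
      show "cdf (distr N borel (?X e)) = cdf D"
      proof
        fix x
        have "cdf (distr N borel (?X e)) x = prob (?X e -` {..x} \<inter> space N)"
          unfolding cdf_def by (rule measure_distr[OF rv]) auto
        also have "?X e -` {..x} \<inter> space N = {\<omega>\<in>space N. ?X e \<omega> \<le> x}" by auto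
        finally show "cdf (distr N borel (?X e)) x = cdf D x" using single[OF e] by simp
      qed
    qed
  qed
  finally show ?thesis .
qed

end

section \<open>The continuous last-passage time\<close>

text \<open>The element of rank \<open>j\<close> in \<open>B\<close> is at least
  \<open>j^2 / 24\<close>, and distinct elements have distinct ranks. Hence the sum is dominated by
  a series in \<open>j\<close> with exponent \<open>- 2 * (\<alpha> - \<delta>) < - 1\<close>. The
  part \<open>\<delta>\<close> split off from the exponent is evaluated at the lower bound
  \<open>k\<close>: with \<open>\<delta> = 0\<close> the sum is bounded, with
  \<open>\<delta> > 0\<close> it is small for large \<open>k\<close>.\<close>

lemma sparse_powr_sum_bound:
  fixes B :: "nat set" and \<alpha> \<delta> :: real
  assumes \<delta>: "0 \<le> \<delta>" "1 / 2 < \<alpha> - \<delta>" and k: "1 \<le> k"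
    and B: "finite B" "\<And>i. i \<in> B \<Longrightarrow> k < i" "\<And>i. i \<in> B \<Longrightarrow> (card (B \<inter> {..i}))\<^sup>2 \<le> 24 * i"
  shows "(\<Sum>i\<in>B. real i powr (- \<alpha>)) \<le>
    24 powr (\<alpha> - \<delta>) * (\<Sum>j. real j powr (- 2 * (\<alpha> - \<delta>))) * real k powr (- \<delta>)"
proof -
  define \<beta> where "\<beta> = \<alpha> - \<delta>"
  define rk where "rk i = card (B \<inter> {..i})" for i
  have rk_less: "rk i < rk j" if "i \<in> B" "j \<in> B" "i < j" for i j
  proof -
    have "B \<inter> {..i} \<subseteq> B \<inter> {..j}" "j \<in> B \<inter> {..j}" "j \<notin> B \<inter> {..i}" using that by auto
    then have "B \<inter> {..i} \<subset> B \<inter> {..j}" by blast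
    then show ?thesis unfolding rk_def using B(1) by (intro psubset_card_mono) auto
  qed
  have inj: "inj_on rk B"
    by (rule inj_onI) (metis rk_less less_irrefl linorder_neqE_nat)
  have sm: "summable (\<lambda>j. real j powr (- 2 * \<beta>))"
    using \<delta> by (subst summable_real_powr_iff) (simp add: \<beta>_def)
  have "(\<Sum>i\<in>B. real i powr (- \<alpha>)) \<le> (\<Sum>i\<in>B. real k powr (- \<delta>) * (24 powr \<beta> * real (rk i) powr (- 2 * \<beta>)))"
  proof (intro sum_mono)
    fix i assume i: "i \<in> B"
    have pos: "0 < rk i" unfolding rk_def using i B(1) by (intro card_gt_0_iff[THEN iffD2]) auto
    have "(rk i)\<^sup>2 \<le> 24 * i" using B(3)[OF i] by (simp add: rk_def)
    then have "real ((rk i)\<^sup>2) \<le> real (24 * i)" by (rule of_nat_mono)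
    then have le: "(real (rk i))\<^sup>2 / 24 \<le> real i" by simp
    have "real i powr (- \<alpha>) = real i powr (- \<delta>) * real i powr (- \<beta>)"
      by (simp add: \<beta>_def powr_add[symmetric])
    also have "\<dots> \<le> real k powr (- \<delta>) * ((real (rk i))\<^sup>2 / 24) powr (- \<beta>)"
    proof (intro mult_mono)
      show "real i powr (- \<delta>) \<le> real k powr (- \<delta>)"
        using B(2)[OF i] k \<delta> by (intro powr_mono2') auto
      show "real i powr (- \<beta>) \<le> ((real (rk i))\<^sup>2 / 24) powr (- \<beta>)"
        using le pos \<delta> by (intro powr_mono2') (auto simp: \<beta>_def)
    qed auto
    also have "((real (rk i))\<^sup>2 / 24) powr (- \<beta>) = 24 powr \<beta> * real (rk i) powr (- 2 * \<beta>)"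
    proof -
      have "(real (rk i))\<^sup>2 = real (rk i) powr 2" using pos by simp
      then have "((real (rk i))\<^sup>2 / 24) powr (- \<beta>) = (real (rk i) powr 2 / 24) powr (- \<beta>)" by (simp only:)
      also have "\<dots> = real (rk i) powr (2 * (- \<beta>)) / 24 powr (- \<beta>)"
        by (simp only: powr_divide powr_powr powr_ge_zero)
      finally show ?thesis by (simp add: powr_minus_divide)
    qed
    finally show "real i powr (- \<alpha>) \<le> real k powr (- \<delta>) * (24 powr \<beta> * real (rk i) powr (- 2 * \<beta>))" .
  qed
  also have "\<dots> = real k powr (- \<delta>) * (24 powr \<beta> * (\<Sum>j\<in>rk ` B. real j powr (- 2 * \<beta>)))"
    by (simp add: sum_distrib_left sum.reindex[OF inj])
  also have "\<dots> \<le> real k powr (- \<delta>) * (24 powr \<beta> * (\<Sum>j. real j powr (- 2 * \<beta>)))"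
    using B(1) by (intro mult_left_mono sum_le_suminf sm) auto
  finally show ?thesis by (simp add: \<beta>_def mult_ac)
qed

lemma eventually_floor_less:
  fixes a b :: real
  assumes "a < b"
  shows "\<forall>\<^sub>F n in sequentially. \<lfloor>real (n + 1) * a\<rfloor> < \<lfloor>real (n + 1) * b\<rfloor>"
proof -
  obtain n0 :: nat where n0: "1 / (b - a) < real n0" using reals_Archimedean2 by blast
  show ?thesis
    unfolding eventually_sequentially
  proof (intro exI allI impI)
    fix n assume "n0 \<le> n"
    then have "1 / (b - a) < real (n + 1)" using n0 by linarith
    then have "1 < real (n + 1) * (b - a)" using assms by (simp add: field_simps)
    then have "real (n + 1) * a + 1 < real (n + 1) * b" by (simp add: algebra_simps)
    then show "\<lfloor>real (n + 1) * a\<rfloor> < \<lfloor>real (n + 1) * b\<rfloor>" by linarith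
  qed
qed

context continuous_model
begin

text \<open>If \<open>l\<close> of the first \<open>l\<^sup>2 div 24\<close> limiting edges are compatible, then \<open>\<omega> \<in> crowded n l\<close> for
  all large \<open>n\<close>; the last clause therefore says that compatible sets of limiting edges are sparse.\<close>

definition generic :: "'b \<Rightarrow> bool" where
  "generic \<omega> \<longleftrightarrow> (\<forall>k\<ge>1. 0 < W k \<omega>) \<and>
    (\<forall>k\<ge>1. 0 \<le> U k \<omega> \<and> U k \<omega> < 1 \<and> 0 \<le> V k \<omega> \<and> V k \<omega> < 1 \<and> U k \<omega> \<noteq> V k \<omega>) \<and>
    (\<forall>n. \<forall>e\<in>edges n. \<exists>k\<ge>1. cell n k \<omega> = e) \<and>
    (\<forall>\<^sub>F k in sequentially. real k / 2 \<le> arrival k \<omega>) \<and>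
    (\<forall>\<^sub>F l in sequentially. \<not> (\<forall>\<^sub>F n in sequentially. \<omega> \<in> crowded n l))"

lemma arrival_large_AE: "AE \<omega> in N. \<forall>\<^sub>F k in sequentially. real k / 2 \<le> arrival k \<omega>"
proof -
  define A where "A k = {\<omega>\<in>space N. arrival k \<omega> < real k / 2}" for k
  have [measurable]: "A k \<in> events" for k unfolding A_def by measurable
  have "summable (\<lambda>k. (exp (1 / 2) / 2 :: real) ^ k)" using exp_half_less_2 by (intro summable_geometric) simp
  then have "summable (\<lambda>k. prob (A k))"
    by (rule summable_comparison_test'[of _ 0]) (use prob_arrival_small in \<open>simp add: A_def\<close>)
  then have "AE \<omega> in N. \<forall>\<^sub>F k in sequentially. \<omega> \<in> space N - A k"
    by (intro borel_cantelli_AE1) (auto simp: emeasure_eq_measure)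
  then show ?thesis
    by eventually_elim (auto simp: A_def elim!: eventually_mono)
qed

text \<open>The bound \<open>(1 / 2) ^ l\<close> is uniform in \<open>n\<close> but does not decay
  in \<open>n\<close>, so Borel-Cantelli is used in \<open>l\<close>, for the lower limit in
  \<open>n\<close> of the events \<open>crowded n l\<close>. That lower limit inherits the bound by
  monotone continuity.\<close>

lemma not_crowded_AE:
  "AE \<omega> in N. \<forall>\<^sub>F l in sequentially. \<not> (\<forall>\<^sub>F n in sequentially. \<omega> \<in> crowded n l)"
proof -
  define A where "A l = (\<Union>m. \<Inter>n\<in>{m..}. crowded n l)" for l
  have A_sets [measurable]: "A l \<in> events" for l unfolding A_def by measurable
  have A_prob: "prob (A l) \<le> (1 / 2) ^ l" if "1 \<le> l" for l
  proof -
    have "(\<lambda>m. prob (\<Inter>n\<in>{m..}. crowded n l)) \<longlonglongrightarrow> prob (A l)"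
      unfolding A_def by (intro finite_Lim_measure_incseq) (auto simp: incseq_def)
    moreover have "prob (\<Inter>n\<in>{m..}. crowded n l) \<le> (1 / 2) ^ l" for m
      by (rule order_trans[OF finite_measure_mono prob_crowded_le[OF that, of m]]) auto
    ultimately show ?thesis by (intro LIMSEQ_le_const2) auto
  qed
  have "summable (\<lambda>l. (1 / 2 :: real) ^ l)" by (intro summable_geometric) simp
  then have "summable (\<lambda>l. prob (A l))"
    by (rule summable_comparison_test'[of _ 1]) (use A_prob in simp)
  then have "AE \<omega> in N. \<forall>\<^sub>F l in sequentially. \<omega> \<in> space N - A l"
    by (intro borel_cantelli_AE1) (auto simp: emeasure_eq_measure)
  then show ?thesis
  proof eventually_elim
    fix \<omega> assume "\<forall>\<^sub>F l in sequentially. \<omega> \<in> space N - A l"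
    moreover have "\<omega> \<in> A l \<longleftrightarrow> (\<forall>\<^sub>F n in sequentially. \<omega> \<in> crowded n l)" for l
      by (auto simp: A_def eventually_sequentially)
    ultimately show "\<forall>\<^sub>F l in sequentially. \<not> (\<forall>\<^sub>F n in sequentially. \<omega> \<in> crowded n l)"
      by (auto elim!: eventually_mono)
  qed
qed

lemma generic_AE: "AE \<omega> in N. generic \<omega>"
  using W_pos_AE UV_AE all_cells_hit_AE arrival_large_AE not_crowded_AE
  by eventually_elim (simp add: generic_def)

text \<open>Scaling followed by \<open>floor\<close> is monotone and therefore commutes with
  \<open>min\<close> and \<open>max\<close>.\<close>

lemma cell_eq_floor_edge:
  "cell n i \<omega> = (\<lfloor>real (n + 1) * fst (edge U V i \<omega>)\<rfloor>, \<lfloor>real (n + 1) * snd (edge U V i \<omega>)\<rfloor>)"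
proof (cases "U i \<omega> \<le> V i \<omega>")
  case True
  then have "\<lfloor>real (n + 1) * U i \<omega>\<rfloor> \<le> \<lfloor>real (n + 1) * V i \<omega>\<rfloor>" by (intro floor_mono mult_left_mono) auto
  then show ?thesis using True by (simp add: cell_def grid_cell_def edge_def)
next
  case False
  then have "\<lfloor>real (n + 1) * V i \<omega>\<rfloor> \<le> \<lfloor>real (n + 1) * U i \<omega>\<rfloor>" by (intro floor_mono mult_left_mono) auto
  then show ?thesis using False by (simp add: cell_def grid_cell_def edge_def min_def max_def)
qed

lemma eventually_cell_in_edges:
  assumes "generic \<omega>" "1 \<le> i"
  shows "\<forall>\<^sub>F n in sequentially. cell n i \<omega> \<in> edges n"
proof -
  define u v where "u = fst (edge U V i \<omega>)" and "v = snd (edge U V i \<omega>)"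
  have uv: "0 \<le> u" "u < v" "v < 1" using assms by (auto simp: generic_def u_def v_def edge_def)
  from eventually_floor_less[OF uv(2)] show ?thesis
  proof eventually_elim
    fix n assume fl: "\<lfloor>real (n + 1) * u\<rfloor> < \<lfloor>real (n + 1) * v\<rfloor>"
    have c: "cell n i \<omega> = (\<lfloor>real (n + 1) * u\<rfloor>, \<lfloor>real (n + 1) * v\<rfloor>)"
      unfolding cell_eq_floor_edge u_def v_def ..
    have "real (n + 1) * v < real (n + 1)" using uv by simp
    then have "\<lfloor>real (n + 1) * v\<rfloor> \<le> int n" by linarith
    moreover have "0 \<le> \<lfloor>real (n + 1) * u\<rfloor>" using uv by simp
    ultimately show "cell n i \<omega> \<in> edges n" using fl by (simp add: c edges_def)
  qed
qed

text \<open>The weak inequalities in compatibility survive rounding for every \<open>n\<close>; a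
  large \<open>n\<close> is required only to move the cells off the diagonal.\<close>

lemma eventually_cell_compatible:
  assumes gen: "generic \<omega>" and F: "finite F" "F \<in> compatible_sets U V \<omega>"
  shows "\<forall>\<^sub>F n in sequentially. cell_compatible n \<omega> F"
proof -
  have "\<forall>\<^sub>F n in sequentially. \<forall>i\<in>F. cell n i \<omega> \<in> edges n"
    using F eventually_cell_in_edges[OF gen] by (intro eventually_ball_finite) (auto simp: compatible_sets_def)
  then show ?thesis
  proof eventually_elim
    fix n assume *: "\<forall>i\<in>F. cell n i \<omega> \<in> edges n"
    have "chain_compat (cell n i \<omega>) (cell n j \<omega>)" if "i \<in> F" "j \<in> F" "i \<noteq> j" for i j
    proof -
      have "compatible (edge U V i \<omega>) (edge U V j \<omega>)"
        using F that by (auto simp: compatible_sets_def pairwise_def)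
      then show ?thesis
        unfolding compatible_def chain_compat_def cell_eq_floor_edge
        by (auto intro!: floor_mono mult_left_mono)
    qed
    with * show "cell_compatible n \<omega> F" by (auto simp: cell_compatible_def pairwise_def)
  qed
qed

text \<open>Incompatibility consists of two strict inequalities, and these survive rounding once the
  mesh is fine enough.\<close>

lemma eventually_cell_incompatible:
  assumes F: "finite F" "F \<subseteq> {1..}" "F \<notin> compatible_sets U V \<omega>"
  shows "\<forall>\<^sub>F n in sequentially. \<not> cell_compatible n \<omega> F"
proof -
  from F obtain i j where ij: "i \<in> F" "j \<in> F" "i \<noteq> j" "\<not> compatible (edge U V i \<omega>) (edge U V j \<omega>)"
    by (auto simp: compatible_sets_def pairwise_def)
  then have "fst (edge U V j \<omega>) < snd (edge U V i \<omega>)" "fst (edge U V i \<omega>) < snd (edge U V j \<omega>)"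
    by (auto simp: compatible_def)
  from this[THEN eventually_floor_less] show ?thesis
  proof eventually_elim
    fix n assume "\<lfloor>real (n + 1) * fst (edge U V j \<omega>)\<rfloor> < \<lfloor>real (n + 1) * snd (edge U V i \<omega>)\<rfloor>"
      "\<lfloor>real (n + 1) * fst (edge U V i \<omega>)\<rfloor> < \<lfloor>real (n + 1) * snd (edge U V j \<omega>)\<rfloor>"
    then have "\<not> chain_compat (cell n i \<omega>) (cell n j \<omega>)"
      by (simp add: cell_eq_floor_edge chain_compat_def not_le)
    then show "\<not> cell_compatible n \<omega> F" using ij by (auto simp: cell_compatible_def pairwise_def)
  qed
qed

text \<open>Let \<open>l\<close> be the rank of \<open>i\<close> in \<open>B\<close>. If
  \<open>l \<ge> m\<close>, the first \<open>l\<close> elements of \<open>B\<close> cannot all lie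
  in \<open>{1..l^2 div 24}\<close>, so \<open>i\<close> exceeds that bound. If
  \<open>l < m\<close>, then \<open>l^2 \<le> m^2 \<le> k < i\<close>. The predicate
  \<open>P\<close> is abstract because the argument serves the limiting edges as well as the
  cells.\<close>

lemma sparse_if_not_crowded:
  assumes P: "\<And>l B. m \<le> l \<Longrightarrow> B \<subseteq> {1..l\<^sup>2 div 24} \<Longrightarrow> card B = l \<Longrightarrow> \<not> P B"
    and sub: "\<And>A. A \<subseteq> B \<Longrightarrow> P A"
    and B: "finite B" "\<And>i. i \<in> B \<Longrightarrow> k < i" and k: "m\<^sup>2 \<le> k" and i: "i \<in> B"
  shows "(card (B \<inter> {..i}))\<^sup>2 \<le> 24 * i"
proof (cases "card (B \<inter> {..i}) < m")
  case True
  then have "(card (B \<inter> {..i}))\<^sup>2 \<le> m\<^sup>2" by (intro power_mono) auto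
  then show ?thesis using k B(2)[OF i] by linarith
next
  case False
  have "\<not> B \<inter> {..i} \<subseteq> {1..(card (B \<inter> {..i}))\<^sup>2 div 24}"
    using P[of "card (B \<inter> {..i})" "B \<inter> {..i}"] sub[of "B \<inter> {..i}"] False by auto
  then obtain i' where "i' \<in> B" "i' \<le> i" "i' \<notin> {1..(card (B \<inter> {..i}))\<^sup>2 div 24}"
    by blast
  then have "(card (B \<inter> {..i}))\<^sup>2 div 24 < i" using B(2)[of i'] by (cases i') auto
  then show ?thesis by linarith
qed

text \<open>Nonnegative infinite sums are suprema of finite ones, and compatibility passes to
  subsets. Finite sets are countably many, which gives measurability, and they are what a grid can
  approximate.\<close>

lemma cont_last_passage_eq_SUP_finite:
  "cont_last_passage s W U V \<omega> =
     (SUP F\<in>{F\<in>compatible_sets U V \<omega>. finite F}. ennreal (\<Sum>i\<in>F. arrival i \<omega> powr (- 1 / s)))"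
proof -
  have w: "edge_weight s W i \<omega> = arrival i \<omega> powr (- 1 / s)" for i by (simp add: edge_weight_def arrival_def)
  have inf: "(\<Sum>\<^sub>\<infinity>i\<in>A. ennreal (edge_weight s W i \<omega>)) =
     (SUP F\<in>{F. finite F \<and> F \<subseteq> A}. ennreal (\<Sum>i\<in>F. arrival i \<omega> powr (- 1 / s)))" for A
    by (subst nonneg_infsum_complete) (auto simp: w sum_ennreal)
  have sub: "F \<in> compatible_sets U V \<omega>" if "A \<in> compatible_sets U V \<omega>" "F \<subseteq> A" for A F
    using that by (auto simp: compatible_sets_def intro: pairwise_subset)
  show ?thesis
    unfolding cont_last_passage_def inf
  proof (intro antisym SUP_least)
    fix A F assume "A \<in> compatible_sets U V \<omega>" "F \<in> {F. finite F \<and> F \<subseteq> A}"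
    then show "ennreal (\<Sum>i\<in>F. arrival i \<omega> powr (- 1 / s)) \<le>
      (SUP F\<in>{F\<in>compatible_sets U V \<omega>. finite F}. ennreal (\<Sum>i\<in>F. arrival i \<omega> powr (- 1 / s)))"
      using sub by (intro SUP_upper) auto
  next
    fix F assume F: "F \<in> {F\<in>compatible_sets U V \<omega>. finite F}"
    have "ennreal (\<Sum>i\<in>F. arrival i \<omega> powr (- 1 / s)) \<le>
      (SUP G\<in>{G. finite G \<and> G \<subseteq> F}. ennreal (\<Sum>i\<in>G. arrival i \<omega> powr (- 1 / s)))"
      using F by (intro SUP_upper) auto
    also have "\<dots> \<le> (SUP A\<in>compatible_sets U V \<omega>. SUP G\<in>{G. finite G \<and> G \<subseteq> A}.
        ennreal (\<Sum>i\<in>G. arrival i \<omega> powr (- 1 / s)))"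
      using F by (intro SUP_upper) simp
    finally show "ennreal (\<Sum>i\<in>F. arrival i \<omega> powr (- 1 / s)) \<le> \<dots>" .
  qed
qed

lemma cont_last_passage_measurable: "cont_last_passage s W U V \<in> borel_measurable N"
proof -
  \<comment> \<open>The value 0 for incompatible sets leaves the supremum in \<open>ennreal\<close>
    unchanged and makes the index family independent of \<open>\<omega>\<close>.\<close>
  define G where "G F \<omega> = (if F \<in> compatible_sets U V \<omega> then ennreal (\<Sum>i\<in>F. arrival i \<omega> powr (- 1 / s)) else 0)"
    for F \<omega>
  define \<F> where "\<F> = {F :: nat set. finite F \<and> F \<subseteq> {1..}}"
  have "cont_last_passage s W U V = (\<lambda>\<omega>. SUP F\<in>\<F>. G F \<omega>)"
  proof
    fix \<omega>
    show "cont_last_passage s W U V \<omega> = (SUP F\<in>\<F>. G F \<omega>)"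
      unfolding cont_last_passage_eq_SUP_finite
    proof (intro antisym SUP_least)
      fix F assume "F \<in> {F\<in>compatible_sets U V \<omega>. finite F}"
      then show "ennreal (\<Sum>i\<in>F. arrival i \<omega> powr (- 1 / s)) \<le> (SUP F\<in>\<F>. G F \<omega>)"
        by (intro SUP_upper2[of F]) (auto simp: \<F>_def G_def compatible_sets_def)
    next
      fix F assume "F \<in> \<F>"
      then show "G F \<omega> \<le> (SUP F\<in>{F\<in>compatible_sets U V \<omega>. finite F}. ennreal (\<Sum>i\<in>F. arrival i \<omega> powr (- 1 / s)))"
        by (auto simp: G_def \<F>_def intro!: SUP_upper2[of F])
    qed
  qed
  moreover have "G F \<in> borel_measurable N" if "F \<in> \<F>" for F
  proof -
    have F: "finite F" "F \<subseteq> {1..}" using that by (auto simp: \<F>_def)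
    have "Measurable.pred N (\<lambda>\<omega>. compatible (edge U V i \<omega>) (edge U V j \<omega>))" if "i \<in> F" "j \<in> F" for i j
    proof -
      have "1 \<le> i" "1 \<le> j" using that F by auto
      note [measurable] = random_variables[OF \<open>1 \<le> i\<close>] random_variables[OF \<open>1 \<le> j\<close>]
      show ?thesis unfolding compatible_def edge_def by simp
    qed
    then have "Measurable.pred N (\<lambda>\<omega>. \<forall>i\<in>F. \<forall>j\<in>F. i \<noteq> j \<longrightarrow> compatible (edge U V i \<omega>) (edge U V j \<omega>))"
      using F(1) by (intro pred_intros_logic pred_intros_finite) auto
    moreover have "(\<lambda>\<omega>. F \<in> compatible_sets U V \<omega>) = (\<lambda>\<omega>. \<forall>i\<in>F. \<forall>j\<in>F. i \<noteq> j \<longrightarrow>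
        compatible (edge U V i \<omega>) (edge U V j \<omega>))"
      using F(2) by (auto simp: compatible_sets_def pairwise_def fun_eq_iff)
    ultimately have [measurable]: "Measurable.pred N (\<lambda>\<omega>. F \<in> compatible_sets U V \<omega>)" by (simp only:)
    show ?thesis unfolding G_def[abs_def] by measurable
  qed
  moreover have "countable \<F>"
    unfolding \<F>_def by (rule countable_subset[OF _ countable_Collect_finite]) auto
  ultimately show ?thesis by (simp add: borel_measurable_SUP)
qed

text \<open>If the limiting edges violated sparsity for arbitrarily large \<open>l\<close>, the
  grids would be crowded for all large \<open>n\<close>, which \<open>generic\<close> excludes.
  Boundedness is all that is asked for, hence \<open>\<delta> = 0\<close>; the series converges
  because \<open>2 / s > 1\<close>.\<close>

lemma cont_last_passage_finite:
  assumes s: "0 < s" "s < 2" and gen: "generic \<omega>" and "\<omega> \<in> space N"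
  shows "cont_last_passage s W U V \<omega> < \<infinity>"
proof -
  define \<alpha> \<delta> where "\<alpha> = 1 / s" and "\<delta> = (0 :: real)"
  have \<alpha>: "0 \<le> \<delta>" "1 / 2 < \<alpha> - \<delta>" using s by (auto simp: \<alpha>_def \<delta>_def field_simps)
  obtain i0 where i0: "\<And>k. i0 \<le> k \<Longrightarrow> real k / 2 \<le> arrival k \<omega>"
    using gen by (auto simp: generic_def eventually_sequentially)
  have "\<forall>\<^sub>F l in sequentially. \<not> (\<forall>\<^sub>F n in sequentially. \<omega> \<in> crowded n l)"
    using gen by (simp add: generic_def)
  from eventually_sequentially[THEN iffD1, OF this]
  obtain l0 where l0: "\<And>l. l0 \<le> l \<Longrightarrow> \<not> (\<forall>\<^sub>F n in sequentially. \<omega> \<in> crowded n l)" by blast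
  \<comment> \<open>Beyond \<open>k\<close> the arrivals grow linearly (\<open>i0\<close>) and
    compatible sets are sparse (\<open>l0^2\<close>); all indices up to \<open>k\<close> are simply
    summed.\<close>
  define k where "k = max (max 1 i0) (l0\<^sup>2)"
  define C where "C = (\<Sum>i\<in>{..k}. arrival i \<omega> powr (- 1 / s)) + 
     2 powr \<alpha> * (24 powr (\<alpha> - \<delta>) * (\<Sum>j. real j powr (- 2 * (\<alpha> - \<delta>))) * real k powr (- \<delta>))"
  have "(\<Sum>i\<in>F. arrival i \<omega> powr (- 1 / s)) \<le> C" if F: "F \<in> compatible_sets U V \<omega>" "finite F" for F
  proof -
    define B where "B = F \<inter> {k<..}"
    have B: "finite B" "\<And>i. i \<in> B \<Longrightarrow> k < i" using F by (auto simp: B_def)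
    have "(card (B \<inter> {..i}))\<^sup>2 \<le> 24 * i" if "i \<in> B" for i
    proof (rule sparse_if_not_crowded[where P = "\<lambda>B. finite B \<and> B \<in> compatible_sets U V \<omega>" and m = l0 and k = k])
      fix l B assume *: "l0 \<le> l" "B \<subseteq> {1..l\<^sup>2 div 24}" "card B = l"
      show "\<not> (finite B \<and> B \<in> compatible_sets U V \<omega>)"
      proof
        assume "finite B \<and> B \<in> compatible_sets U V \<omega>"
        then have "\<forall>\<^sub>F n in sequentially. cell_compatible n \<omega> B"
          using eventually_cell_compatible[OF gen] by blast
        then have "\<forall>\<^sub>F n in sequentially. \<omega> \<in> crowded n l"
          by (rule eventually_mono) (use * \<open>\<omega> \<in> space N\<close> in \<open>auto simp: crowded_def\<close>)
        then show False using l0 * by blast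
      qed
    next
      fix A assume "A \<subseteq> B"
      then have "A \<subseteq> F" by (auto simp: B_def)
      then show "finite A \<and> A \<in> compatible_sets U V \<omega>"
        using F by (auto simp: compatible_sets_def intro: pairwise_subset finite_subset)
    qed (use B that in \<open>auto simp: k_def\<close>)
    then have tail: "(\<Sum>i\<in>B. real i powr (- \<alpha>)) \<le>
      24 powr (\<alpha> - \<delta>) * (\<Sum>j. real j powr (- 2 * (\<alpha> - \<delta>))) * real k powr (- \<delta>)"
      using B \<alpha> by (intro sparse_powr_sum_bound) (auto simp: k_def)
    have "(\<Sum>i\<in>B. arrival i \<omega> powr (- 1 / s)) \<le> (\<Sum>i\<in>B. 2 powr \<alpha> * real i powr (- \<alpha>))"
    proof (intro sum_mono)
      fix i assume "i \<in> B"
      then have "real i / 2 \<le> arrival i \<omega>" "0 < i" using i0 B(2)[of i] by (auto simp: k_def)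
      then have "arrival i \<omega> powr (- \<alpha>) \<le> (real i / 2) powr (- \<alpha>)"
        using s by (intro powr_mono2') (auto simp: \<alpha>_def)
      also have "\<dots> = 2 powr \<alpha> * real i powr (- \<alpha>)" by (simp add: powr_divide powr_minus_divide)
      finally show "arrival i \<omega> powr (- 1 / s) \<le> 2 powr \<alpha> * real i powr (- \<alpha>)" by (simp add: \<alpha>_def)
    qed
    also have "\<dots> \<le> 2 powr \<alpha> * (24 powr (\<alpha> - \<delta>) * (\<Sum>j. real j powr (- 2 * (\<alpha> - \<delta>))) * real k powr (- \<delta>))"
      using tail by (simp add: sum_distrib_left[symmetric])
    finally have 1: "(\<Sum>i\<in>B. arrival i \<omega> powr (- 1 / s)) \<le> \<dots>" .
    have 2: "(\<Sum>i\<in>F \<inter> {..k}. arrival i \<omega> powr (- 1 / s)) \<le> (\<Sum>i\<in>{..k}. arrival i \<omega> powr (- 1 / s))"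
      by (intro sum_mono2) auto
    have "F = F \<inter> {..k} \<union> B" by (auto simp: B_def)
    then have "(\<Sum>i\<in>F. arrival i \<omega> powr (- 1 / s)) =
       (\<Sum>i\<in>F \<inter> {..k}. arrival i \<omega> powr (- 1 / s)) + (\<Sum>i\<in>B. arrival i \<omega> powr (- 1 / s))"
      using F by (metis (no_types, lifting) B_def disjoint_iff finite_Int greaterThan_iff Int_iff
          atMost_iff not_le sum.union_disjoint)
    then show ?thesis using 1 2 by (simp add: C_def)
  qed
  then have "cont_last_passage s W U V \<omega> \<le> ennreal C"
    unfolding cont_last_passage_eq_SUP_finite by (intro SUP_least ennreal_leI) auto
  also have "\<dots> < \<infinity>" by simp
  finally show ?thesis .
qed

end

section \<open>Convergence\<close>

text \<open>The tail unions of the sets decrease to a null set, so continuity from above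
  applies.\<close>

lemma (in prob_space) prob_tendsto_0_if_eventually_notin:
  assumes A [measurable]: "\<And>n. A n \<in> events" and ev: "AE \<omega> in M. \<forall>\<^sub>F n in sequentially. \<omega> \<notin> A n"
  shows "(\<lambda>n. prob (A n)) \<longlonglongrightarrow> 0"
proof -
  define B where "B n = (\<Union>m\<in>{n..}. A m)" for n
  have B [measurable]: "B n \<in> events" for n unfolding B_def by measurable
  have "(\<lambda>n. prob (B n)) \<longlonglongrightarrow> prob (\<Inter>n. B n)"
    by (intro finite_Lim_measure_decseq) (auto simp: decseq_def B_def intro: order_trans)
  moreover have "prob (\<Inter>n. B n) = 0"
  proof -
    have "AE \<omega> in M. \<omega> \<notin> (\<Inter>n. B n)"
      using ev
    proof eventually_elim
      fix \<omega> assume "\<forall>\<^sub>F n in sequentially. \<omega> \<notin> A n"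
      then obtain n where "\<And>m. n \<le> m \<Longrightarrow> \<omega> \<notin> A m" by (auto simp: eventually_sequentially)
      then have "\<omega> \<notin> B n" by (auto simp: B_def)
      then show "\<omega> \<notin> (\<Inter>n. B n)" by auto
    qed
    then show ?thesis by (subst prob_eq_0) auto
  qed
  ultimately have lim: "(\<lambda>n. prob (B n)) \<longlonglongrightarrow> 0" by simp
  show ?thesis
    by (rule tendsto_sandwich[OF _ _ tendsto_const lim]) (auto intro!: always_eventually finite_measure_mono simp: B_def)
qed

text \<open>Convergence in probability, split into its two sides: the lower side comes from an
  almost sure statement, whereas the upper one rests on estimates that hold only with high
  probability.\<close>

lemma (in prob_space) weak_conv_m_if_tendsto_in_probability:
  fixes X :: "'a \<Rightarrow> real" and Z :: "nat \<Rightarrow> 'a \<Rightarrow> real"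
  assumes [measurable]: "random_variable borel X" "\<And>n. random_variable borel (Z n)"
    and up: "\<And>\<epsilon>. 0 < \<epsilon> \<Longrightarrow> (\<lambda>n. prob {\<omega>\<in>space M. X \<omega> + \<epsilon> < Z n \<omega>}) \<longlonglongrightarrow> 0"
    and low: "\<And>\<epsilon>. 0 < \<epsilon> \<Longrightarrow> (\<lambda>n. prob {\<omega>\<in>space M. Z n \<omega> < X \<omega> - \<epsilon>}) \<longlonglongrightarrow> 0"
  shows "weak_conv_m (\<lambda>n. distr M borel (Z n)) (distr M borel X)"
  unfolding weak_conv_m_def weak_conv_def
proof (intro allI impI)
  fix x assume cont: "isCont (cdf (distr M borel X)) x"
  have cdf_eq: "cdf (distr M borel Y) y = prob {\<omega>\<in>space M. Y \<omega> \<le> y}"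
    if [measurable]: "random_variable borel Y" for Y y
  proof -
    have "cdf (distr M borel Y) y = prob (Y -` {..y} \<inter> space M)"
      unfolding cdf_def by (rule measure_distr) auto
    also have "Y -` {..y} \<inter> space M = {\<omega>\<in>space M. Y \<omega> \<le> y}" by auto
    finally show ?thesis .
  qed
  show "(\<lambda>n. cdf (distr M borel (Z n)) x) \<longlonglongrightarrow> cdf (distr M borel X) x"
  proof (rule LIMSEQ_I)
    fix e :: real assume e: "0 < e"
    have "\<exists>d>0. \<forall>y. \<bar>y - x\<bar> < d \<longrightarrow> \<bar>cdf (distr M borel X) y - cdf (distr M borel X) x\<bar> < e / 2"
      using cont half_gt_zero[OF e] unfolding continuous_at_eps_delta dist_real_def by blast
    then obtain d where d: "0 < d"
      "\<And>y. \<bar>y - x\<bar> < d \<Longrightarrow> \<bar>cdf (distr M borel X) y - cdf (distr M borel X) x\<bar> < e / 2" by blast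
    define \<epsilon> where "\<epsilon> = d / 2"
    have \<epsilon>: "0 < \<epsilon>" using d by (simp add: \<epsilon>_def)
    have "\<forall>\<^sub>F n in sequentially. prob {\<omega>\<in>space M. X \<omega> + \<epsilon> < Z n \<omega>} < e / 2 \<and>
        prob {\<omega>\<in>space M. Z n \<omega> < X \<omega> - \<epsilon>} < e / 2"
      using order_tendstoD(2)[OF up[OF \<epsilon>], of "e / 2"] order_tendstoD(2)[OF low[OF \<epsilon>], of "e / 2"] e
      by (intro eventually_conj) auto
    then obtain n0 where n0: "\<And>n. n0 \<le> n \<Longrightarrow> prob {\<omega>\<in>space M. X \<omega> + \<epsilon> < Z n \<omega>} < e / 2 \<and>
        prob {\<omega>\<in>space M. Z n \<omega> < X \<omega> - \<epsilon>} < e / 2"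
      unfolding eventually_sequentially by blast
    show "\<exists>no. \<forall>n\<ge>no. norm (cdf (distr M borel (Z n)) x - cdf (distr M borel X) x) < e"
    proof (intro exI allI impI)
      fix n assume n: "n0 \<le> n"
      have "prob {\<omega>\<in>space M. Z n \<omega> \<le> x} \<le>
          prob ({\<omega>\<in>space M. X \<omega> \<le> x + \<epsilon>} \<union> {\<omega>\<in>space M. Z n \<omega> < X \<omega> - \<epsilon>})"
        by (intro finite_measure_mono) auto
      also have "\<dots> \<le> prob {\<omega>\<in>space M. X \<omega> \<le> x + \<epsilon>} + prob {\<omega>\<in>space M. Z n \<omega> < X \<omega> - \<epsilon>}"
        by (intro measure_Un_le) auto
      finally have 1: "prob {\<omega>\<in>space M. Z n \<omega> \<le> x} < cdf (distr M borel X) (x + \<epsilon>) + e / 2"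
        using n0[OF n] by (simp add: cdf_eq)
      have "prob {\<omega>\<in>space M. X \<omega> \<le> x - \<epsilon>} \<le>
          prob ({\<omega>\<in>space M. Z n \<omega> \<le> x} \<union> {\<omega>\<in>space M. X \<omega> + \<epsilon> < Z n \<omega>})"
        by (intro finite_measure_mono) auto
      also have "\<dots> \<le> prob {\<omega>\<in>space M. Z n \<omega> \<le> x} + prob {\<omega>\<in>space M. X \<omega> + \<epsilon> < Z n \<omega>}"
        by (intro measure_Un_le) auto
      finally have 2: "cdf (distr M borel X) (x - \<epsilon>) < prob {\<omega>\<in>space M. Z n \<omega> \<le> x} + e / 2"
        using n0[OF n] by (simp add: cdf_eq)
      have "\<bar>cdf (distr M borel X) (x + \<epsilon>) - cdf (distr M borel X) x\<bar> < e / 2"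
        "\<bar>cdf (distr M borel X) (x - \<epsilon>) - cdf (distr M borel X) x\<bar> < e / 2"
        using \<epsilon> by (intro d(2); simp add: \<epsilon>_def)+
      then show "norm (cdf (distr M borel (Z n)) x - cdf (distr M borel X) x) < e"
        using 1 2 unfolding cdf_eq[OF assms(2)] real_norm_def by linarith
    qed
  qed
qed

lemma passage_cong: "(\<And>e. e \<in> edges n \<Longrightarrow> x e = y e) \<Longrightarrow> passage n x = passage n y"
proof -
  assume *: "\<And>e. e \<in> edges n \<Longrightarrow> x e = y e"
  have "(\<Sum>e\<in>S. x e) = (\<Sum>e\<in>S. y e)" if "S \<in> paths n" for S
    using that paths_subset_chains[of n] * by (intro sum.cong) (auto simp: edge_chains_def)
  then show ?thesis unfolding passage_def by (intro arg_cong[of _ _ Max] image_cong) auto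
qed

lemma real_choose_two: "real ((n + 1) choose 2) = real n * real (n + 1) / 2"
proof -
  have "2 dvd (n + 1) * n" by simp
  then show ?thesis by (simp add: choose_two real_of_nat_div algebra_simps)
qed

section \<open>Asymptotics of \<open>scaling\<close> and of the rescaled weights\<close>

context regularly_varying_tail
begin

lemma quantile_01_eq_upper_quantile: "0 < x \<Longrightarrow> quantile_01 (exp (- x)) = upper_quantile (1 - exp (- x))"
  by (simp add: quantile_01_def upper_quantile_def)

lemma scaling_eq: "scaling (cdf M) n = upper_quantile (1 / real ((n + 1) choose 2))"
  by (simp add: scaling_def upper_quantile_def)

lemma inverse_choose_two_at_right_0:
  "filterlim (\<lambda>n. 1 / real ((n + 1) choose 2)) (at_right 0) sequentially"
proof -
  have lim: "(\<lambda>n. 1 / real ((n + 1) choose 2)) \<longlonglongrightarrow> 0"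
  proof (rule tendsto_sandwich[OF _ _ tendsto_const LIMSEQ_inverse_real_of_nat])
    show "\<forall>\<^sub>F n in sequentially. 1 / real ((n + 1) choose 2) \<le> inverse (real (Suc n))"
      unfolding eventually_sequentially
    proof (intro exI allI impI)
      fix n :: nat assume "2 \<le> n"
      then have "2 * real (n + 1) \<le> real n * real (n + 1)" by (intro mult_right_mono) auto
      then have "real (Suc n) \<le> real ((n + 1) choose 2)" unfolding real_choose_two by simp
      then show "1 / real ((n + 1) choose 2) \<le> inverse (real (Suc n))"
        by (simp add: inverse_eq_divide frac_le)
    qed
  qed auto
  have "\<forall>\<^sub>F n in sequentially. 0 < 1 / real ((n + 1) choose 2)"
    unfolding eventually_sequentially
  proof (intro exI allI impI)
    fix n :: nat assume "1 \<le> n"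
    then show "0 < 1 / real ((n + 1) choose 2)" unfolding real_choose_two by simp
  qed
  with lim show ?thesis by (rule tendsto_imp_filterlim_at_right)
qed

lemma scaling_at_top: "filterlim (scaling (cdf M)) at_top sequentially"
  unfolding scaling_eq[abs_def]
  by (rule filterlim_compose[OF upper_quantile_at_top inverse_choose_two_at_right_0])

lemma cell_mass_tendsto_0: "cell_mass \<longlonglongrightarrow> 0"
proof -
  have "(\<lambda>n. 2 * (inverse (real (Suc n)))\<^sup>2) \<longlonglongrightarrow> 2 * 0\<^sup>2"
    by (intro tendsto_intros LIMSEQ_inverse_real_of_nat)
  then show ?thesis by (simp add: cell_mass_def[abs_def] power_inverse[symmetric] divide_inverse)
qed

text \<open>Again the probability of missing the diagonal. As it tends to 1, the rate per cell is
  asymptotically the exceedance probability that defines \<open>scaling\<close>.\<close>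

lemma cell_mass_choose_two: "cell_mass n * real ((n + 1) choose 2) = real n / real (n + 1)"
proof -
  have "2 / m\<^sup>2 * (real n * m / 2) = real n / m" if "m \<noteq> 0" for m :: real
    using that by (simp add: power2_eq_square)
  from this[of "real (n + 1)"] show ?thesis unfolding real_choose_two cell_mass_def by simp
qed

text \<open>The exceedance probability of the weight at arrival time \<open>x\<close> is
  \<open>1 - exp (- cell_mass n * x)\<close>, asymptotically \<open>x\<close> times the one defining
  \<open>scaling\<close>. Regular variation of the quantile turns the factor \<open>x\<close> into
  \<open>x powr (-1 / s)\<close>.\<close>

lemma level_quantile_tendsto:
  assumes x: "0 < x"
  shows "(\<lambda>n. quantile_01 (exp (- cell_mass n * x)) / scaling (cdf M) n) \<longlonglongrightarrow> x powr (-1 / s)"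
proof -
  have rx: "(\<lambda>n. - (cell_mass n * x)) \<longlonglongrightarrow> - (0 * x)"
    by (intro tendsto_intros cell_mass_tendsto_0)
  have at0: "filterlim (\<lambda>n. - (cell_mass n * x)) (at 0) sequentially"
    using rx x less_imp_neq[OF cell_mass_pos] by (auto simp: filterlim_at)
  have "((\<lambda>h::real. (exp h - 1) / h) \<longlongrightarrow> 1) (at 0)"
    using DERIV_exp[of "0::real"] by (simp add: DERIV_def)
  from filterlim_compose[OF this at0]
  have e: "(\<lambda>n. (exp (- (cell_mass n * x)) - 1) / (- (cell_mass n * x))) \<longlonglongrightarrow> 1" .
  have rN: "(\<lambda>n. real n / real (n + 1)) \<longlonglongrightarrow> 1"
    using LIMSEQ_n_over_Suc_n by simp
  have "(\<lambda>n. (1 - exp (- (cell_mass n * x))) / (1 / real ((n + 1) choose 2))) \<longlonglongrightarrow> 1 * 1 * x"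
  proof (rule Lim_transform_eventually)
    show "(\<lambda>n. (exp (- (cell_mass n * x)) - 1) / (- (cell_mass n * x)) * (real n / real (n + 1)) * x) \<longlonglongrightarrow> 1 * 1 * x"
      by (intro tendsto_intros e rN)
    show "\<forall>\<^sub>F n in sequentially. (exp (- (cell_mass n * x)) - 1) / (- (cell_mass n * x)) * (real n / real (n + 1)) * x =
        (1 - exp (- (cell_mass n * x))) / (1 / real ((n + 1) choose 2))"
    proof (intro always_eventually allI)
      fix n
      show "(exp (- (cell_mass n * x)) - 1) / (- (cell_mass n * x)) * (real n / real (n + 1)) * x =
        (1 - exp (- (cell_mass n * x))) / (1 / real ((n + 1) choose 2))"
        unfolding cell_mass_choose_two[symmetric]
        using x less_imp_neq[OF cell_mass_pos[of n]] by (simp add: field_simps)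
    qed
  qed
  then have pq: "(\<lambda>n. (1 - exp (- (cell_mass n * x))) / (1 / real ((n + 1) choose 2))) \<longlonglongrightarrow> x" by simp
  have p: "filterlim (\<lambda>n. 1 - exp (- (cell_mass n * x))) (at_right 0) sequentially"
  proof -
    have "(\<lambda>n. 1 - exp (- (cell_mass n * x))) \<longlonglongrightarrow> 1 - exp (- (0 * x))"
      by (intro tendsto_intros cell_mass_tendsto_0)
    moreover have "0 < 1 - exp (- (cell_mass n * x))" for n using x by simp
    ultimately show ?thesis by (intro tendsto_imp_filterlim_at_right always_eventually) auto
  qed
  have eq: "quantile_01 (exp (- cell_mass n * x)) = upper_quantile (1 - exp (- (cell_mass n * x)))" for n
    using quantile_01_eq_upper_quantile[of "cell_mass n * x"] x by simp
  show ?thesis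
    unfolding eq scaling_eq
    by (rule upper_quantile_ratio_tendsto[OF x p inverse_choose_two_at_right_0 pq])
qed

text \<open>Uniform counterpart of the preceding limit. Write \<open>p\<close> for the exceedance
  probability at \<open>x\<close> and \<open>q\<close> for the one defining \<open>scaling\<close>.
  If \<open>cell_mass n * x \<le> 1\<close>, then \<open>p / q \<ge> x / 4\<close>, and
  \<open>x \<ge> 4\<close> ensures \<open>q \<le> p\<close>, so that
  \<open>upper_quantile_bound\<close> applies. Otherwise \<open>p \<ge> 1 / 2\<close>, and the
  weight is at most a fixed quantile, which goes into the additive constant.\<close>

lemma level_quantile_bound:
  assumes "s < s'"
  obtains K C where "0 < K" "0 < C" "\<And>n x. 2 \<le> n \<Longrightarrow> 4 \<le> x \<Longrightarrow>
    quantile_01 (exp (- cell_mass n * x)) \<le> K + C * scaling (cdf M) n * x powr (-1 / s')"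
proof -
  obtain K C where K: "K > 0" and C: "C > 0"
    and b: "\<And>p q. 0 < q \<Longrightarrow> q \<le> p \<Longrightarrow> p < 1 \<Longrightarrow>
       upper_quantile p \<le> K + C * upper_quantile q * (p / q) powr (-1 / s')"
    by (rule upper_quantile_bound[OF assms]) blast
  have s': "s' > 0" using assms s_pos by simp
  have uq: "0 \<le> upper_quantile (1 / 2)" by (rule upper_quantile_nonneg) auto
  show thesis
  proof (rule that)
    show "0 < K + upper_quantile (1 / 2)" "0 < C * 4 powr (1 / s')" using K C uq by auto
    fix n :: nat and x :: real assume n: "2 \<le> n" and x: "4 \<le> x"
    define r where "r = cell_mass n"
    define p where "p = 1 - exp (- (r * x))"
    define q where "q = 1 / real ((n + 1) choose 2)"
    have r: "0 < r" by (simp add: r_def)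
    have p: "0 < p" "p < 1" using r x by (auto simp: p_def)
    have "2 * 3 \<le> real n * real (n + 1)" using n by (intro mult_mono) auto
    then have "3 \<le> real ((n + 1) choose 2)" unfolding real_choose_two by simp
    then have q: "0 < q" "q \<le> 1 / 3"
      unfolding q_def by (intro divide_pos_pos divide_left_mono; linarith)+
    have q1: "upper_quantile q \<ge> 0" using q by (intro upper_quantile_nonneg) auto
    have eq: "quantile_01 (exp (- cell_mass n * x)) = upper_quantile p"
      using quantile_01_eq_upper_quantile[of "r * x"] r x by (simp add: p_def r_def)
    have sc: "scaling (cdf M) n = upper_quantile q" by (simp add: scaling_eq q_def)
    show "quantile_01 (exp (- cell_mass n * x)) \<le>
      (K + upper_quantile (1 / 2)) + C * 4 powr (1 / s') * scaling (cdf M) n * x powr (-1 / s')"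
      unfolding eq sc
    proof (cases "r * x \<le> 1")
      case True
      have "exp (- (r * x)) \<le> 1 - r * x / 2"
      proof -
        have "1 + r * x \<le> exp (r * x)" by (rule exp_ge_add_one_self)
        then have "exp (- (r * x)) \<le> 1 / (1 + r * x)"
          using r x by (simp add: exp_minus inverse_eq_divide frac_le add_pos_pos)
        also have "\<dots> \<le> 1 - r * x / 2"
        proof -
          have "0 \<le> (r * x) * (1 - r * x) / 2" using True r x by simp
          then have "1 \<le> (1 - r * x / 2) * (1 + r * x)" by (simp add: algebra_simps)
          then show ?thesis using r x by (simp add: pos_divide_le_eq add_pos_pos)
        qed
        finally show ?thesis .
      qed
      then have pr: "r * x / 2 \<le> p" by (simp add: p_def)
      have "1 / 2 \<le> real n / real (n + 1)" using n by (simp add: field_simps)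
      then have "1 / 2 \<le> r / q"
        using cell_mass_choose_two[of n] by (simp add: r_def q_def)
      then have "x / 2 * (1 / 2) \<le> x / 2 * (r / q)" using x by (intro mult_left_mono) auto
      also have "\<dots> \<le> p / q" using pr q by (simp add: field_simps)
      finally have pq: "x / 4 \<le> p / q" by simp
      then have "1 \<le> p / q" using x by linarith
      then have "q \<le> p" using q by (simp add: field_simps)
      then have "upper_quantile p \<le> K + C * upper_quantile q * (p / q) powr (-1 / s')"
        using p q by (intro b) auto
      also have "\<dots> \<le> K + C * upper_quantile q * (x / 4) powr (-1 / s')"
        using pq x s' C q1 by (intro add_left_mono mult_left_mono powr_mono2') auto
      also have "(x / 4) powr (-1 / s') = 4 powr (1 / s') * x powr (-1 / s')"
        using x by (simp add: powr_divide powr_minus_divide)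
      finally show "upper_quantile p \<le> (K + upper_quantile (1 / 2)) + C * 4 powr (1 / s') * upper_quantile q * x powr (-1 / s')"
        using uq by (simp add: mult_ac)
    next
      case False
      have "exp (- (r * x)) \<le> exp (- 1)" using False by simp
      also have "\<dots> \<le> 1 / 2"
        using exp_ge_add_one_self[of "1::real"] by (simp add: exp_minus inverse_eq_divide frac_le)
      finally have "1 / 2 \<le> p" by (simp add: p_def)
      then have "upper_quantile p \<le> upper_quantile (1 / 2)" using p by (intro upper_quantile_antimono) auto
      moreover have "0 \<le> C * 4 powr (1 / s') * upper_quantile q * x powr (-1 / s')" using C q1 by simp
      ultimately show "upper_quantile p \<le> (K + upper_quantile (1 / 2)) + C * 4 powr (1 / s') * upper_quantile q * x powr (-1 / s')"
        using K by linarith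
    qed
  qed
qed

text \<open>For \<open>s < s' < 2\<close>, \<open>scaling\<close> is at least of order
  \<open>n powr (2 / s')\<close>, which is superlinear. This makes the additive constants in the
  weight bound negligible along a chain of at most \<open>n\<close> edges.\<close>

lemma linear_over_scaling_tendsto_0:
  assumes "s < 2"
  shows "(\<lambda>n. real n / scaling (cdf M) n) \<longlonglongrightarrow> 0"
proof -
  define s' where "s' = (s + 2) / 2"
  have s': "s < s'" "0 < s'" "s' < 2" using assms s_pos by (auto simp: s'_def)
  obtain c where c: "c > 0" "\<forall>\<^sub>F p in at_right 0. c * p powr (-1 / s') \<le> upper_quantile p"
    by (rule upper_quantile_growth[OF s'(1)]) blast
  have "\<forall>\<^sub>F n in sequentially. c * (1 / real ((n + 1) choose 2)) powr (-1 / s') \<le> scaling (cdf M) n"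
    unfolding scaling_eq
    using filterlim_iff[THEN iffD1, OF inverse_choose_two_at_right_0] c(2) by blast
  then have ev: "\<forall>\<^sub>F n in sequentially. real n / scaling (cdf M) n \<le> 2 powr (1 / s') / c * real n powr (1 - 2 / s')"
    using eventually_ge_at_top[of 1]
  proof eventually_elim
    fix n :: nat assume sc: "c * (1 / real ((n + 1) choose 2)) powr (-1 / s') \<le> scaling (cdf M) n" and n: "1 \<le> n"
    have "real n powr (2 / s') / 2 powr (1 / s') = ((real n)\<^sup>2 / 2) powr (1 / s')"
    proof -
      have "((real n)\<^sup>2 / 2) powr (1 / s') = (real n powr 2 / 2) powr (1 / s')" using n by simp
      also have "\<dots> = real n powr (2 * (1 / s')) / 2 powr (1 / s')"
        by (simp only: powr_divide powr_powr powr_ge_zero)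
      finally show ?thesis by simp
    qed
    also have "\<dots> \<le> (real ((n + 1) choose 2)) powr (1 / s')"
      using n s' unfolding real_choose_two by (intro powr_mono2) (auto simp: power2_eq_square field_simps)
    also have "\<dots> = (1 / real ((n + 1) choose 2)) powr (-1 / s')"
      by (simp add: powr_divide powr_minus_divide)
    finally have "c * (real n powr (2 / s') / 2 powr (1 / s')) \<le> scaling (cdf M) n"
      using sc c(1) by (smt (verit) mult_left_mono)
    moreover have "0 < c * (real n powr (2 / s') / 2 powr (1 / s'))" using c n by simp
    ultimately have "real n / scaling (cdf M) n \<le> real n / (c * (real n powr (2 / s') / 2 powr (1 / s')))"
      by (intro frac_le) auto
    also have "\<dots> = 2 powr (1 / s') / c * real n powr (1 - 2 / s')"
      using n by (simp add: powr_diff)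
    finally show "real n / scaling (cdf M) n \<le> 2 powr (1 / s') / c * real n powr (1 - 2 / s')" .
  qed
  have "((\<lambda>n. 2 powr (1 / s') / c * real n powr (1 - 2 / s')) \<longlongrightarrow> 2 powr (1 / s') / c * 0) sequentially"
    using s' by (intro tendsto_mult tendsto_const tendsto_neg_powr filterlim_real_sequentially) (simp add: field_simps)
  then have lim: "(\<lambda>n. 2 powr (1 / s') / c * real n powr (1 - 2 / s')) \<longlonglongrightarrow> 0" by simp
  have "\<forall>\<^sub>F n in sequentially. 0 \<le> scaling (cdf M) n"
    using scaling_at_top unfolding filterlim_at_top by blast
  then have "\<forall>\<^sub>F n in sequentially. 0 \<le> real n / scaling (cdf M) n" by eventually_elim simp
  then show ?thesis using ev by (intro tendsto_sandwich[OF _ ev tendsto_const lim])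
qed

end

section \<open>The coupling: embedded passage times and their limit in probability\<close>

locale embedded_model = continuous_model N W U V + R: regularly_varying_tail D s
  for N :: "'b measure" and W U V :: "nat \<Rightarrow> 'b \<Rightarrow> real" and D :: "real measure" and s :: real +
  assumes s_less_2: "s < 2"
begin

text \<open>\<open>enn2real\<close> maps infinity to 0; this does not matter, since the value is
  finite at every generic point.\<close>

definition limit_passage :: "'b \<Rightarrow> real" where
  "limit_passage \<omega> = enn2real (cont_last_passage s W U V \<omega>)"

definition embedded_weight :: "nat \<Rightarrow> nat \<Rightarrow> 'b \<Rightarrow> real" where
  "embedded_weight n i \<omega> = R.quantile_01 (exp (- cell_mass n * arrival i \<omega>))"

definition embedded_passage :: "nat \<Rightarrow> 'b \<Rightarrow> real" where
  "embedded_passage n \<omega> = passage n (\<lambda>e. R.quantile_01 (hit_level n e \<omega>))"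

lemma limit_passage_measurable [measurable]: "random_variable borel limit_passage"
  unfolding limit_passage_def using cont_last_passage_measurable by measurable

lemma embedded_weight_measurable [measurable]: "random_variable borel (embedded_weight n i)"
  unfolding embedded_weight_def by measurable

lemma embedded_vector_measurable:
  "(\<lambda>\<omega>. \<lambda>e\<in>edges n. R.quantile_01 (hit_level n e \<omega>)) \<in> measurable N (PiM (edges n) (\<lambda>_. borel))"
  by (intro measurable_restrict) measurable

lemma embedded_passage_eq:
  "embedded_passage n \<omega> = passage n (\<lambda>e\<in>edges n. R.quantile_01 (hit_level n e \<omega>))"
  unfolding embedded_passage_def by (rule passage_cong) simp

lemma embedded_passage_measurable [measurable]: "random_variable borel (embedded_passage n)"
  unfolding embedded_passage_eq[abs_def]
  by (rule measurable_compose[OF embedded_vector_measurable passage_measurable])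

lemma ennreal_limit_passage:
  assumes "generic \<omega>" "\<omega> \<in> space N"
  shows "ennreal (limit_passage \<omega>) = cont_last_passage s W U V \<omega>"
  using cont_last_passage_finite[OF R.s_pos s_less_2 assms] by (simp add: limit_passage_def)

lemma sum_le_limit_passage:
  assumes "generic \<omega>" "\<omega> \<in> space N" "F \<in> compatible_sets U V \<omega>" "finite F"
  shows "(\<Sum>i\<in>F. arrival i \<omega> powr (- 1 / s)) \<le> limit_passage \<omega>"
proof -
  have "ennreal (\<Sum>i\<in>F. arrival i \<omega> powr (- 1 / s)) \<le> ennreal (limit_passage \<omega>)"
    unfolding ennreal_limit_passage[OF assms(1,2)] cont_last_passage_eq_SUP_finite
    using assms by (intro SUP_upper) auto
  then show ?thesis by (subst (asm) ennreal_le_iff) (auto simp: limit_passage_def)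
qed

lemma embedded_weight_tendsto:
  assumes "generic \<omega>" "1 \<le> i"
  shows "(\<lambda>n. embedded_weight n i \<omega> / scaling (cdf D) n) \<longlonglongrightarrow> arrival i \<omega> powr (- 1 / s)"
  unfolding embedded_weight_def
  using assms arrival_pos[of \<omega> i] by (intro R.level_quantile_tendsto) (auto simp: generic_def)

lemma sum_embedded_weight_tendsto:
  assumes "generic \<omega>" "F \<subseteq> {1..}"
  shows "(\<lambda>n. (\<Sum>i\<in>F. embedded_weight n i \<omega>) / scaling (cdf D) n) \<longlonglongrightarrow> (\<Sum>i\<in>F. arrival i \<omega> powr (- 1 / s))"
  unfolding sum_divide_distrib
  using assms by (intro tendsto_sum embedded_weight_tendsto) auto

lemma exp_arrival_in_01:
  assumes "generic \<omega>" "1 \<le> i"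
  shows "exp (- cell_mass n * arrival i \<omega>) \<in> {0<..<1}"
  using assms arrival_pos[of \<omega> i] by (simp add: generic_def)

lemma embedded_weight_nonneg:
  assumes "generic \<omega>" "1 \<le> i"
  shows "0 \<le> embedded_weight n i \<omega>"
proof -
  have "0 < cell_mass n * arrival i \<omega>"
    using assms arrival_pos[of \<omega> i] by (intro mult_pos_pos) (auto simp: generic_def)
  then show ?thesis
    using R.quantile_01_eq_upper_quantile R.upper_quantile_nonneg[of "1 - exp (- (cell_mass n * arrival i \<omega>))"]
    by (simp add: embedded_weight_def)
qed

lemma embedded_weight_antimono:
  assumes gen: "generic \<omega>" and ij: "1 \<le> i" "i \<le> j"
  shows "embedded_weight n j \<omega> \<le> embedded_weight n i \<omega>"
proof -
  have "arrival i \<omega> \<le> arrival j \<omega>" using gen ij by (intro arrival_mono) (auto simp: generic_def)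
  then have "exp (- cell_mass n * arrival j \<omega>) \<le> exp (- cell_mass n * arrival i \<omega>)"
    by (simp add: mult_left_mono)
  also have "\<dots> \<le> cdf D (embedded_weight n i \<omega>)"
    using R.quantile_01_le_iff[OF exp_arrival_in_01[OF gen ij(1)], of n "embedded_weight n i \<omega>"]
    by (simp add: embedded_weight_def)
  finally show ?thesis
    using R.quantile_01_le_iff[OF exp_arrival_in_01[OF gen, of j n], of "embedded_weight n i \<omega>"] ij
    by (simp add: embedded_weight_def)
qed

lemma hit_level_weight: "R.quantile_01 (hit_level n e \<omega>) = embedded_weight n (hit n e \<omega>) \<omega>"
  by (simp add: hit_level_def embedded_weight_def)

text \<open>Only the first point of a cell carries the discrete weight. A later point of the same
  cell has a smaller weight by \<open>embedded_weight_antimono\<close>, and a compatible set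
  occupies distinct cells that form a chain.\<close>

lemma sum_le_embedded_passage:
  assumes gen: "generic \<omega>" and F: "cell_compatible n \<omega> F" "F \<subseteq> {1..}"
  shows "(\<Sum>i\<in>F. embedded_weight n i \<omega>) \<le> embedded_passage n \<omega>"
proof -
  have hits: "\<exists>k\<ge>1. cell n k \<omega> = e" if "e \<in> edges n" for e
    using gen that by (simp add: generic_def)
  have "(\<Sum>i\<in>F. embedded_weight n i \<omega>) \<le> (\<Sum>i\<in>F. R.quantile_01 (hit_level n (cell n i \<omega>) \<omega>))"
  proof (intro sum_mono)
    fix i assume i: "i \<in> F"
    have "\<exists>k\<ge>1. cell n k \<omega> = cell n i \<omega>" using i F(2) by auto
    note h = hit_properties[OF this]
    have "hit n (cell n i \<omega>) \<omega> \<le> i" using h(3)[of i] i F(2) by auto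
    then show "embedded_weight n i \<omega> \<le> R.quantile_01 (hit_level n (cell n i \<omega>) \<omega>)"
      unfolding hit_level_weight by (rule embedded_weight_antimono[OF gen h(1)])
  qed
  also have "\<dots> = (\<Sum>e\<in>(\<lambda>i. cell n i \<omega>) ` F. R.quantile_01 (hit_level n e \<omega>))"
    by (simp add: sum.reindex[OF cell_compatible_inj_on[OF F(1)]])
  also have "\<dots> \<le> embedded_passage n \<omega>"
    unfolding embedded_passage_def
  proof (rule passage_ge[OF cell_compatible_image[OF F(1)]])
    fix e assume "e \<in> edges n"
    then show "0 \<le> R.quantile_01 (hit_level n e \<omega>)"
      unfolding hit_level_weight using hits hit_properties(1) by (intro embedded_weight_nonneg[OF gen]) blast
  qed
  finally show ?thesis .
qed

lemma eventually_scaling_pos: "\<forall>\<^sub>F n in sequentially. 0 < scaling (cdf D) n"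
  using R.scaling_at_top by (simp add: filterlim_at_top_dense)

text \<open>Lower semicontinuity: a nearly optimal finite set is compatible in the grid for all
  large \<open>n\<close>, and its finitely many rescaled weights converge.\<close>

lemma eventually_less_embedded_passage:
  assumes gen: "generic \<omega>" "\<omega> \<in> space N" and \<epsilon>: "0 < \<epsilon>"
  shows "\<forall>\<^sub>F n in sequentially. limit_passage \<omega> - \<epsilon> < embedded_passage n \<omega> / scaling (cdf D) n"
proof -
  have "\<exists>F\<in>{F\<in>compatible_sets U V \<omega>. finite F}. limit_passage \<omega> - \<epsilon> < (\<Sum>i\<in>F. arrival i \<omega> powr (- 1 / s))"
  proof (rule ccontr)
    assume "\<not> ?thesis"
    then have *: "(\<Sum>i\<in>F. arrival i \<omega> powr (- 1 / s)) \<le> limit_passage \<omega> - \<epsilon>"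
      if "F \<in> compatible_sets U V \<omega>" "finite F" for F using that by (auto simp: not_less)
    \<comment> \<open>The empty set shows
      \<open>limit_passage \<omega> - \<epsilon> \<ge> 0\<close>, so that \<open>ennreal\<close>
      does not truncate the difference below.\<close>
    have "{} \<in> compatible_sets U V \<omega>" by (simp add: compatible_sets_def)
    with *[of "{}"] have nn: "0 \<le> limit_passage \<omega> - \<epsilon>" by simp
    have "ennreal (limit_passage \<omega>) \<le> ennreal (limit_passage \<omega> - \<epsilon>)"
      unfolding ennreal_limit_passage[OF gen] cont_last_passage_eq_SUP_finite
      using * by (intro SUP_least ennreal_leI) auto
    then show False using nn \<epsilon> by (simp add: ennreal_le_iff)
  qed
  then obtain F where F: "F \<in> compatible_sets U V \<omega>" "finite F"
    and less: "limit_passage \<omega> - \<epsilon> < (\<Sum>i\<in>F. arrival i \<omega> powr (- 1 / s))" by blast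
  have F1: "F \<subseteq> {1..}" using F by (simp add: compatible_sets_def)
  from order_tendstoD(1)[OF sum_embedded_weight_tendsto[OF gen(1) F1] less]
    eventually_cell_compatible[OF gen(1) F(2,1)] eventually_scaling_pos
  show ?thesis
  proof eventually_elim
    fix n assume 1: "limit_passage \<omega> - \<epsilon> < (\<Sum>i\<in>F. embedded_weight n i \<omega>) / scaling (cdf D) n"
      and 2: "cell_compatible n \<omega> F" and 3: "0 < scaling (cdf D) n"
    have "(\<Sum>i\<in>F. embedded_weight n i \<omega>) / scaling (cdf D) n \<le> embedded_passage n \<omega> / scaling (cdf D) n"
      using sum_le_embedded_passage[OF gen(1) 2 F1] 3 by (intro divide_right_mono) auto
    then show "limit_passage \<omega> - \<epsilon> < embedded_passage n \<omega> / scaling (cdf D) n" using 1 by linarith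
  qed
qed

text \<open>Concerns only the head of an optimal chain. For fixed \<open>k\<close> there are
  finitely many index sets, so the limit in \<open>n\<close> can be taken set by set.\<close>

definition overshoot :: "nat \<Rightarrow> real \<Rightarrow> nat \<Rightarrow> 'b set" where
  "overshoot k \<epsilon> n = {\<omega>\<in>space N. \<exists>F\<in>Pow {1..k}. cell_compatible n \<omega> F \<and>
     limit_passage \<omega> + \<epsilon> < (\<Sum>i\<in>F. embedded_weight n i \<omega>) / scaling (cdf D) n}"

lemma overshoot_measurable: "overshoot k \<epsilon> n \<in> events"
proof -
  have "overshoot k \<epsilon> n = (\<Union>F\<in>Pow {1..k}. {\<omega>\<in>space N. cell_compatible n \<omega> F} \<inter>
     {\<omega>\<in>space N. limit_passage \<omega> + \<epsilon> < (\<Sum>i\<in>F. embedded_weight n i \<omega>) / scaling (cdf D) n})"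
    by (auto simp: overshoot_def)
  also have "\<dots> \<in> events"
  proof (intro sets.finite_UN sets.Int)
    fix F assume "F \<in> Pow {1..k}"
    then show "{\<omega>\<in>space N. cell_compatible n \<omega> F} \<in> events"
      by (intro cell_compatible_measurable) (auto intro: finite_subset)
    show "{\<omega>\<in>space N. limit_passage \<omega> + \<epsilon> < (\<Sum>i\<in>F. embedded_weight n i \<omega>) / scaling (cdf D) n} \<in> events"
      by measurable
  qed auto
  finally show ?thesis .
qed

text \<open>Each index set is either compatible in the limit, where its weight converges to at most
  \<open>limit_passage \<omega>\<close>, or incompatible in the grid from some \<open>n\<close>
  on.\<close>

lemma eventually_not_overshoot:
  assumes gen: "generic \<omega>" "\<omega> \<in> space N" and \<epsilon>: "0 < \<epsilon>"
  shows "\<forall>\<^sub>F n in sequentially. \<omega> \<notin> overshoot k \<epsilon> n"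
proof -
  have "\<forall>\<^sub>F n in sequentially. \<not> (cell_compatible n \<omega> F \<and>
     limit_passage \<omega> + \<epsilon> < (\<Sum>i\<in>F. embedded_weight n i \<omega>) / scaling (cdf D) n)" if F: "F \<in> Pow {1..k}" for F
  proof (cases "F \<in> compatible_sets U V \<omega>")
    case True
    have fin: "finite F" and F1: "F \<subseteq> {1..}" using F by (auto intro: finite_subset)
    have "(\<Sum>i\<in>F. arrival i \<omega> powr (- 1 / s)) < limit_passage \<omega> + \<epsilon>"
      using sum_le_limit_passage[OF gen True fin] \<epsilon> by linarith
    from order_tendstoD(2)[OF sum_embedded_weight_tendsto[OF gen(1) F1] this]
    show ?thesis by eventually_elim auto
  next
    case False
    have "finite F" "F \<subseteq> {1..}" using F by (auto intro: finite_subset)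
    from eventually_cell_incompatible[OF this False] show ?thesis by eventually_elim auto
  qed
  then have "\<forall>\<^sub>F n in sequentially. \<forall>F\<in>Pow {1..k}. \<not> (cell_compatible n \<omega> F \<and>
     limit_passage \<omega> + \<epsilon> < (\<Sum>i\<in>F. embedded_weight n i \<omega>) / scaling (cdf D) n)"
    by (intro eventually_ball_finite) auto
  then show ?thesis by eventually_elim (auto simp: overshoot_def)
qed

text \<open>An optimal chain, pulled back to the indices of its first hits, is split at
  \<open>k\<close>. The absence of \<open>overshoot\<close> controls the head. In the rest, sparsity
  bounds the sum of the power terms by a multiple of \<open>k powr (- \<delta>)\<close>, and the
  additive constant \<open>K\<close> is paid at most \<open>n\<close> times because a chain has at
  most \<open>n\<close> edges.\<close>

lemma embedded_passage_le:
  fixes \<alpha> \<delta> K C :: real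
  assumes gen: "generic \<omega>" "\<omega> \<in> space N"
    and notin: "\<omega> \<notin> overshoot k \<epsilon> n"
    and crowd: "\<And>l. l0 \<le> l \<Longrightarrow> \<omega> \<notin> crowded n l"
    and arr: "\<And>i. k \<le> i \<Longrightarrow> real i / 2 \<le> arrival i \<omega>"
    and k: "l0\<^sup>2 \<le> k" "8 \<le> k" and b: "0 < scaling (cdf D) n"
    and \<alpha>: "0 \<le> \<delta>" "1 / 2 < \<alpha> - \<delta>" and K: "0 \<le> K" "0 \<le> C"
    and bound: "\<And>x. 4 \<le> x \<Longrightarrow> R.quantile_01 (exp (- cell_mass n * x)) \<le> K + C * scaling (cdf D) n * x powr (- \<alpha>)"
  shows "embedded_passage n \<omega> / scaling (cdf D) n \<le> limit_passage \<omega> + \<epsilon> + K * (real n / scaling (cdf D) n) +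
    C * 2 powr \<alpha> * (24 powr (\<alpha> - \<delta>) * (\<Sum>j. real j powr (- 2 * (\<alpha> - \<delta>)))) * real k powr (- \<delta>)"
proof -
  let ?b = "scaling (cdf D) n"
  obtain S where S: "S \<in> edge_chains n"
    and pass: "embedded_passage n \<omega> = (\<Sum>e\<in>S. R.quantile_01 (hit_level n e \<omega>))"
    unfolding embedded_passage_def using passage_attained by blast
  have Se: "S \<subseteq> edges n" and Sc: "pairwise chain_compat S" and finS: "finite S"
    using S finite_chain[OF S] by (auto simp: edge_chains_def)
  have h: "1 \<le> hit n e \<omega>" "cell n (hit n e \<omega>) \<omega> = e" if "e \<in> S" for e
  proof -
    have "\<exists>k\<ge>1. cell n k \<omega> = e" using gen(1) Se that by (auto simp: generic_def)
    from hit_properties[OF this] show "1 \<le> hit n e \<omega>" "cell n (hit n e \<omega>) \<omega> = e" by auto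
  qed
  define B where "B = (\<lambda>e. hit n e \<omega>) ` S"
  have inj: "inj_on (\<lambda>e. hit n e \<omega>) S" by (rule inj_onI) (metis h(2))
  have B: "finite B" "B \<subseteq> {1..}" using finS h(1) by (auto simp: B_def)
  have cardB: "card B \<le> n" using card_chain_le[OF S] inj by (simp add: B_def card_image)
  have comp: "cell_compatible n \<omega> B"
    unfolding cell_compatible_def
  proof
    show "\<forall>i\<in>B. cell n i \<omega> \<in> edges n" using h(2) Se by (auto simp: B_def)
    show "pairwise (\<lambda>i j. chain_compat (cell n i \<omega>) (cell n j \<omega>)) B"
      using h(2) Sc by (auto simp: B_def pairwise_def)
  qed
  have passB: "embedded_passage n \<omega> = (\<Sum>i\<in>B. embedded_weight n i \<omega>)"
    unfolding pass hit_level_weight B_def by (simp add: sum.reindex[OF inj])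
  define B1 B2 where "B1 = B \<inter> {..k}" and "B2 = B \<inter> {k<..}"
  have B12: "B = B1 \<union> B2" "B1 \<inter> B2 = {}" "finite B1" "finite B2"
    using B by (auto simp: B1_def B2_def)
  have "B1 \<in> Pow {1..k}" "cell_compatible n \<omega> B1"
    using B cell_compatible_subset[OF comp, of B1] by (auto simp: B1_def)
  then have first: "(\<Sum>i\<in>B1. embedded_weight n i \<omega>) / ?b \<le> limit_passage \<omega> + \<epsilon>"
    using notin gen(2) by (auto simp: overshoot_def not_less)
  have B2: "\<And>i. i \<in> B2 \<Longrightarrow> k < i" by (auto simp: B2_def)
  have "(card (B2 \<inter> {..i}))\<^sup>2 \<le> 24 * i" if "i \<in> B2" for i
  proof (rule sparse_if_not_crowded[where P = "cell_compatible n \<omega>" and m = l0 and k = k])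
    fix l B assume "l0 \<le> l" "B \<subseteq> {1..l\<^sup>2 div 24}" "card B = l"
    then show "\<not> cell_compatible n \<omega> B" using crowd gen(2) by (auto simp: crowded_def)
  next
    fix A assume "A \<subseteq> B2"
    then show "cell_compatible n \<omega> A" by (intro cell_compatible_subset[OF comp]) (auto simp: B2_def)
  qed (use B12 B2 k that in auto)
  then have tail: "(\<Sum>i\<in>B2. real i powr (- \<alpha>)) \<le>
    24 powr (\<alpha> - \<delta>) * (\<Sum>j. real j powr (- 2 * (\<alpha> - \<delta>))) * real k powr (- \<delta>)"
    using B12 B2 \<alpha> k by (intro sparse_powr_sum_bound) auto
  have "(\<Sum>i\<in>B2. embedded_weight n i \<omega>) \<le> (\<Sum>i\<in>B2. K + C * ?b * 2 powr \<alpha> * real i powr (- \<alpha>))"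
  proof (intro sum_mono)
    fix i assume i: "i \<in> B2"
    \<comment> \<open>From \<open>8 \<le> k\<close> the arrival time is at least 4, the range in
      which \<open>bound\<close> holds.\<close>
    have i2: "real i / 2 \<le> arrival i \<omega>" "8 \<le> real i" using arr[of i] B2[OF i] k by auto
    have "embedded_weight n i \<omega> \<le> K + C * ?b * arrival i \<omega> powr (- \<alpha>)"
      unfolding embedded_weight_def using i2 by (intro bound) linarith
    also have "\<dots> \<le> K + C * ?b * (real i / 2) powr (- \<alpha>)"
      using i2 \<alpha> K b by (intro add_left_mono mult_left_mono powr_mono2') auto
    also have "(real i / 2) powr (- \<alpha>) = 2 powr \<alpha> * real i powr (- \<alpha>)"
      by (simp add: powr_divide powr_minus_divide)
    finally show "embedded_weight n i \<omega> \<le> K + C * ?b * 2 powr \<alpha> * real i powr (- \<alpha>)" by (simp add: mult.assoc)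
  qed
  also have "\<dots> = real (card B2) * K + C * ?b * 2 powr \<alpha> * (\<Sum>i\<in>B2. real i powr (- \<alpha>))"
    by (simp add: sum.distrib sum_distrib_left)
  also have "\<dots> \<le> real n * K + C * ?b * 2 powr \<alpha> *
    (24 powr (\<alpha> - \<delta>) * (\<Sum>j. real j powr (- 2 * (\<alpha> - \<delta>))) * real k powr (- \<delta>))"
  proof (intro add_mono mult_right_mono mult_left_mono tail)
    have "card B2 \<le> card B" using B by (intro card_mono) (auto simp: B2_def)
    then show "real (card B2) \<le> real n" using cardB by simp
  qed (use K b in auto)
  finally have "(\<Sum>i\<in>B2. embedded_weight n i \<omega>) / ?b \<le> (real n * K + C * ?b * 2 powr \<alpha> *
    (24 powr (\<alpha> - \<delta>) * (\<Sum>j. real j powr (- 2 * (\<alpha> - \<delta>))) * real k powr (- \<delta>))) / ?b"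
    using b by (intro divide_right_mono) auto
  also have "\<dots> = K * (real n / ?b) + C * 2 powr \<alpha> *
    (24 powr (\<alpha> - \<delta>) * (\<Sum>j. real j powr (- 2 * (\<alpha> - \<delta>)))) * real k powr (- \<delta>)"
    using b by (simp add: add_divide_distrib mult_ac)
  finally show ?thesis
    using first B12 unfolding passB by (simp add: sum.union_disjoint add_divide_distrib)
qed

text \<open>The order of choices matters. First \<open>l0\<close>, and with it \<open>k\<close>, is
  fixed so that the tail term is below \<open>\<epsilon> / 3\<close> and slow arrivals and crowding
  have probability below \<open>\<eta> / 3\<close> each, uniformly in \<open>n\<close>. Then
  \<open>n\<close> grows with \<open>k\<close> fixed, which disposes of \<open>overshoot\<close> and
  of the term \<open>K * n / b_n\<close>.\<close>

lemma embedded_passage_upper: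
  assumes \<epsilon>: "0 < \<epsilon>"
  shows "(\<lambda>n. prob {\<omega>\<in>space N. limit_passage \<omega> + \<epsilon> < embedded_passage n \<omega> / scaling (cdf D) n}) \<longlonglongrightarrow> 0"
proof -
  let ?b = "scaling (cdf D)"
  define s' where "s' = (s + 2) / 2"
  define \<alpha> where "\<alpha> = 1 / s'"
  \<comment> \<open>Half of the excess of \<open>\<alpha>\<close> over the critical exponent
    \<open>1 / 2\<close>: one half yields decay in \<open>k\<close>, the other keeps the series
    convergent.\<close>
  define \<delta> where "\<delta> = (\<alpha> - 1 / 2) / 2"
  have s': "s < s'" "0 < s'" "s' < 2" using s_less_2 R.s_pos by (auto simp: s'_def)
  have "1 / 2 < \<alpha>" using s' by (simp add: \<alpha>_def field_simps)
  then have \<alpha>: "0 < \<delta>" "1 / 2 < \<alpha> - \<delta>" by (auto simp: \<delta>_def field_simps)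
  obtain K C where K: "0 < K" and C: "0 < C" and bound: "\<And>n x. 2 \<le> n \<Longrightarrow> 4 \<le> x \<Longrightarrow>
    R.quantile_01 (exp (- cell_mass n * x)) \<le> K + C * ?b n * x powr (-1 / s')"
    by (rule R.level_quantile_bound[OF s'(1)]) blast
  define C' where "C' = C * 2 powr \<alpha> * (24 powr (\<alpha> - \<delta>) * (\<Sum>j. real j powr (- 2 * (\<alpha> - \<delta>))))"
  define \<rho> where "\<rho> = (exp (1 / 2) / 2 :: real)"
  have \<rho>: "0 \<le> \<rho>" "\<rho> < 1" using exp_half_less_2 by (auto simp: \<rho>_def)
  define E where "E n = {\<omega>\<in>space N. limit_passage \<omega> + \<epsilon> < embedded_passage n \<omega> / ?b n}" for n
  have E [measurable]: "E n \<in> events" for n unfolding E_def by measurable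
  have "(\<lambda>n. prob (E n)) \<longlonglongrightarrow> 0"
  proof (rule order_tendstoI)
    fix a :: real assume "a < 0"
    then have "a < prob (E n)" for n using measure_nonneg[of N "E n"] by linarith
    then show "\<forall>\<^sub>F n in sequentially. a < prob (E n)" by simp
  next
    fix \<eta> :: real assume \<eta>: "0 < \<eta>"
    have "(\<lambda>l. C' * real (l\<^sup>2) powr (- \<delta>)) \<longlonglongrightarrow> C' * 0"
    proof (intro tendsto_mult tendsto_const tendsto_neg_powr)
      have "filterlim (\<lambda>l::nat. l\<^sup>2) at_top sequentially" 
        by (intro filterlim_subseq strict_monoI power_strict_mono) auto
      then show "filterlim (\<lambda>l::nat. real (l\<^sup>2)) at_top sequentially"
        by (rule filterlim_compose[OF filterlim_real_sequentially])
    qed (use \<alpha> in simp)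
    then have ev1: "\<forall>\<^sub>F l in sequentially. C' * real (l\<^sup>2) powr (- \<delta>) < \<epsilon> / 3"
      using \<epsilon> by (intro order_tendstoD(2)) auto
    have lim2: "(\<lambda>l. (1 / 2) ^ l / (1 - 1 / 2) :: real) \<longlonglongrightarrow> 0 / (1 - 1 / 2)"
      by (intro tendsto_divide tendsto_const LIMSEQ_power_zero) auto
    have ev2: "\<forall>\<^sub>F l in sequentially. (1 / 2) ^ l / (1 - 1 / 2 :: real) < \<eta> / 3"
      by (rule order_tendstoD(2)[OF lim2]) (use \<eta> in simp)
    have lim3: "(\<lambda>l. \<rho> ^ l / (1 - \<rho>)) \<longlonglongrightarrow> 0 / (1 - \<rho>)"
      using \<rho> by (intro tendsto_divide tendsto_const LIMSEQ_power_zero) auto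
    have ev3: "\<forall>\<^sub>F l in sequentially. \<rho> ^ l / (1 - \<rho>) < \<eta> / 3"
      by (rule order_tendstoD(2)[OF lim3]) (use \<eta> in simp)
    obtain l0 where l0: "C' * real (l0\<^sup>2) powr (- \<delta>) < \<epsilon> / 3" "(1 / 2) ^ l0 / (1 - 1 / 2 :: real) < \<eta> / 3"
      "\<rho> ^ l0 / (1 - \<rho>) < \<eta> / 3" "3 \<le> l0"
      using eventually_happens'[OF sequentially_bot
          eventually_conj[OF ev1 eventually_conj[OF ev2 eventually_conj[OF ev3 eventually_ge_at_top[of 3]]]]]
      by blast
    \<comment> \<open>The smallest cut for which non-crowding from \<open>l0\<close> on gives
      sparsity beyond \<open>k\<close>; \<open>l0 \<ge> 3\<close> yields
      \<open>k \<ge> 9\<close>.\<close>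
    define k where "k = l0\<^sup>2"
    have k: "8 \<le> k" "l0 \<le> k"
    proof -
      have "3\<^sup>2 \<le> l0\<^sup>2" using l0(4) by (intro power_mono) auto
      then show "8 \<le> k" by (simp add: k_def)
      show "l0 \<le> k" by (simp add: k_def power2_eq_square)
    qed
    define A where "A = (\<Union>i\<in>{l0..}. {\<omega>\<in>space N. arrival i \<omega> < real i / 2})"
    define Cr where "Cr n = (\<Union>l\<in>{l0..}. crowded n l)" for n
    have A: "A \<in> events"
      unfolding A_def by (rule prob_UN_geometric(1)[OF _ _ \<rho>]) (use prob_arrival_small in \<open>simp_all add: \<rho>_def\<close>)
    have "prob A \<le> \<rho> ^ l0 / (1 - \<rho>)"
      unfolding A_def by (rule prob_UN_geometric(2)[OF _ _ \<rho>]) (use prob_arrival_small in \<open>simp_all add: \<rho>_def\<close>)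
    then have A': "prob A < \<eta> / 3" using l0(3) by linarith
    have Cr: "Cr n \<in> events" for n unfolding Cr_def by measurable
    have Cr': "prob (Cr n) < \<eta> / 3" for n
    proof -
      have "prob (Cr n) \<le> (1 / 2) ^ l0 / (1 - 1 / 2)"
        unfolding Cr_def by (rule prob_UN_geometric(2)) (use prob_crowded_le[of _ n] l0(4) in auto)
      then show ?thesis using l0(2) by linarith
    qed
    have over: "(\<lambda>n. prob (overshoot k (\<epsilon> / 3) n)) \<longlonglongrightarrow> 0"
    proof (rule prob_tendsto_0_if_eventually_notin[OF overshoot_measurable])
      show "AE \<omega> in N. \<forall>\<^sub>F n in sequentially. \<omega> \<notin> overshoot k (\<epsilon> / 3) n"
        using generic_AE AE_space by eventually_elim (use \<epsilon> in \<open>auto intro: eventually_not_overshoot\<close>)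
    qed
    have lin: "(\<lambda>n. K * (real n / ?b n)) \<longlonglongrightarrow> K * 0"
      by (intro tendsto_mult tendsto_const R.linear_over_scaling_tendsto_0 s_less_2)
    have ev4: "\<forall>\<^sub>F n in sequentially. K * (real n / ?b n) < \<epsilon> / 3"
      using lin \<epsilon> by (intro order_tendstoD(2)) auto
    have ev5: "\<forall>\<^sub>F n in sequentially. prob (overshoot k (\<epsilon> / 3) n) < \<eta> / 3"
      using over \<eta> by (intro order_tendstoD(2)) auto
    show "\<forall>\<^sub>F n in sequentially. prob (E n) < \<eta>"
      using ev4 ev5 eventually_scaling_pos eventually_ge_at_top[of 2]
    proof eventually_elim
      fix n :: nat
      assume n4: "K * (real n / ?b n) < \<epsilon> / 3" and n5: "prob (overshoot k (\<epsilon> / 3) n) < \<eta> / 3"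
        and b: "0 < ?b n" and n2: "2 \<le> n"
      have "AE \<omega> in N. \<omega> \<in> E n \<longrightarrow> \<omega> \<in> overshoot k (\<epsilon> / 3) n \<union> A \<union> Cr n"
        using generic_AE
      proof eventually_elim
        fix \<omega> assume gen: "generic \<omega>"
        show "\<omega> \<in> E n \<longrightarrow> \<omega> \<in> overshoot k (\<epsilon> / 3) n \<union> A \<union> Cr n"
        proof (intro impI, rule ccontr)
          assume En: "\<omega> \<in> E n" and *: "\<omega> \<notin> overshoot k (\<epsilon> / 3) n \<union> A \<union> Cr n"
          have sp: "\<omega> \<in> space N" using En by (simp add: E_def)
          have "embedded_passage n \<omega> / ?b n \<le> limit_passage \<omega> + \<epsilon> / 3 + K * (real n / ?b n) +
            C * 2 powr \<alpha> * (24 powr (\<alpha> - \<delta>) * (\<Sum>j. real j powr (- 2 * (\<alpha> - \<delta>)))) * real k powr (- \<delta>)"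
          proof (rule embedded_passage_le[OF gen sp, of k "\<epsilon> / 3" n l0 \<delta> \<alpha> K C])
            show "real i / 2 \<le> arrival i \<omega>" if "k \<le> i" for i
              using * that k sp by (auto simp: A_def not_less)
            show "\<omega> \<notin> crowded n l" if "l0 \<le> l" for l using * that by (auto simp: Cr_def)
            show "R.quantile_01 (exp (- cell_mass n * x)) \<le> K + C * ?b n * x powr (- \<alpha>)" if "4 \<le> x" for x
              using bound[OF n2 that] by (simp add: \<alpha>_def)
          qed (use * k \<alpha> K C b in \<open>auto simp: k_def\<close>)
          also have "\<dots> < limit_passage \<omega> + \<epsilon>"
            using n4 l0(1) unfolding C'_def[symmetric] k_def by linarith
          finally show False using En by (simp add: E_def)
        qed
      qed
      then have "prob (E n) \<le> prob (overshoot k (\<epsilon> / 3) n \<union> A \<union> Cr n)"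
        using A Cr overshoot_measurable by (intro finite_measure_mono_AE) auto
      also have "\<dots> \<le> prob (overshoot k (\<epsilon> / 3) n) + prob A + prob (Cr n)"
        using A Cr overshoot_measurable
        by (intro order_trans[OF measure_Un_le] add_right_mono measure_Un_le) auto
      also have "\<dots> < \<eta>" using n5 A' Cr'[of n] by linarith
      finally show "prob (E n) < \<eta>" .
    qed
  qed
  then show ?thesis by (simp add: E_def)
qed

lemma embedded_passage_lower:
  assumes \<epsilon>: "0 < \<epsilon>"
  shows "(\<lambda>n. prob {\<omega>\<in>space N. embedded_passage n \<omega> / scaling (cdf D) n < limit_passage \<omega> - \<epsilon>}) \<longlonglongrightarrow> 0"
proof (rule prob_tendsto_0_if_eventually_notin)
  show "AE \<omega> in N. \<forall>\<^sub>F n in sequentially.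
      \<omega> \<notin> {\<omega>\<in>space N. embedded_passage n \<omega> / scaling (cdf D) n < limit_passage \<omega> - \<epsilon>}"
    using generic_AE AE_space
  proof eventually_elim
    fix \<omega> assume "generic \<omega>" "\<omega> \<in> space N"
    from eventually_less_embedded_passage[OF this \<epsilon>]
    show "\<forall>\<^sub>F n in sequentially.
      \<omega> \<notin> {\<omega>\<in>space N. embedded_passage n \<omega> / scaling (cdf D) n < limit_passage \<omega> - \<epsilon>}"
      by eventually_elim auto
  qed
qed measurable

lemma weak_conv_embedded_passage:
  "weak_conv_m (\<lambda>n. distr N borel (\<lambda>\<omega>. embedded_passage n \<omega> / scaling (cdf D) n)) (distr N borel limit_passage)"
  by (rule weak_conv_m_if_tendsto_in_probability)
     (use embedded_passage_upper embedded_passage_lower in auto)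

lemma distr_embedded_passage:
  assumes "1 \<le> n"
  shows "distr N borel (\<lambda>\<omega>. embedded_passage n \<omega> / b) =
    distr (PiM (edges n) (\<lambda>_. D)) borel (\<lambda>x. passage n x / b)"
proof -
  have m: "(\<lambda>x. passage n x / b) \<in> borel_measurable (PiM (edges n) (\<lambda>_. borel))" by measurable
  show ?thesis
    unfolding embedded_weights_law[OF R.cdf_distribution_axioms assms, symmetric]
    by (subst distr_distr[OF m embedded_vector_measurable]) (simp add: comp_def embedded_passage_eq)
qed

end

section \<open>The law of the discrete passage time\<close>

context discrete_model
begin

lemma distr_last_passage:
  assumes n: "1 \<le> n"
  shows "distr M borel (\<lambda>\<omega>. last_passage v 0 (int n) \<omega> / b) =
    distr (PiM (edges n) (\<lambda>_. distr M borel (v 0 1))) borel (\<lambda>x. passage n x / b)"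
proof -
  let ?X = "\<lambda>e. (\<lambda>(i, j). v i j) e"
  have sub: "edges n \<subseteq> {(i, j). i < j}" by (auto simp: edges_def)
  have ind: "indep_vars (\<lambda>_. borel) ?X (edges n)" by (rule indep_vars_subset[OF indep sub])
  have rv: "random_variable borel (?X e)" if "e \<in> {(i, j). i < j}" for e
    using indep that by (auto simp: indep_vars_def)
  have "(0, 1) \<in> edges n" using n by (simp add: edges_def)
  then have "distr M (PiM (edges n) (\<lambda>_. borel)) (\<lambda>\<omega>. \<lambda>e\<in>edges n. ?X e \<omega>) = PiM (edges n) (\<lambda>e. distr M borel (?X e))"
    using ind rv sub by (subst (asm) indep_vars_iff_distr_eq_PiM') auto
  also have "\<dots> = PiM (edges n) (\<lambda>_. distr M borel (v 0 1))"
  proof (intro PiM_cong refl)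
    fix e assume "e \<in> edges n"
    then have e: "e \<in> {(i, j). i < j}" using sub by auto
    show "distr M borel (?X e) = distr M borel (v 0 1)"
      using rv[OF e] rv[of "(0, 1)"] e cdf_eq[of "fst e" "snd e"] cdf_eq[of 0 1]
      by (intro cdf_unique real_distribution_distr) (auto simp: split_beta)
  qed
  finally have law: "distr M (PiM (edges n) (\<lambda>_. borel)) (\<lambda>\<omega>. \<lambda>e\<in>edges n. ?X e \<omega>) =
    PiM (edges n) (\<lambda>_. distr M borel (v 0 1))" .
  have vec: "(\<lambda>\<omega>. \<lambda>e\<in>edges n. ?X e \<omega>) \<in> measurable M (PiM (edges n) (\<lambda>_. borel))"
    using rv sub by (intro measurable_restrict) auto
  have m: "(\<lambda>x. passage n x / b) \<in> borel_measurable (PiM (edges n) (\<lambda>_. borel))" by measurable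
  have "last_passage v 0 (int n) \<omega> = passage n (\<lambda>e\<in>edges n. ?X e \<omega>)" for \<omega>
  proof -
    have "last_passage v 0 (int n) \<omega> = passage n (\<lambda>e. ?X e \<omega>)"
      by (simp add: last_passage_eq_Max passage_def split_beta')
    also have "\<dots> = passage n (\<lambda>e\<in>edges n. ?X e \<omega>)" by (rule passage_cong) simp
    finally show ?thesis .
  qed
  then show ?thesis
    unfolding law[symmetric] by (subst distr_distr[OF m vec]) (simp add: comp_def)
qed

lemma regularly_varying_tail_weights:
  assumes "0 < s" and "\<And>t. 0 < t \<Longrightarrow> ((\<lambda>x. (1 - F (t * x)) / (1 - F x)) \<longlongrightarrow> t powr (- s)) at_top"
  shows "regularly_varying_tail (distr M borel (v 0 1)) s"
proof -
  have rv [measurable]: "random_variable borel (v 0 1)" using indep by (auto simp: indep_vars_def)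
  interpret D: real_distribution "distr M borel (v 0 1)" using rv by (rule real_distribution_distr)
  have cdf: "cdf (distr M borel (v 0 1)) = F" by (rule cdf_eq) simp
  have "cdf (distr M borel (v 0 1)) 0 = prob (v 0 1 -` {..0} \<inter> space M)"
    unfolding cdf_def by (rule measure_distr) auto
  also have "\<dots> = 0"
  proof -
    have "AE \<omega> in M. \<omega> \<notin> v 0 1 -` {..0} \<inter> space M"
      using pos[of 0 1] by (auto elim!: eventually_mono)
    then show ?thesis by (subst prob_eq_0) auto
  qed
  finally have "cdf (distr M borel (v 0 1)) 0 = 0" .
  then show ?thesis
    using assms by unfold_locales (auto simp: cdf)
qed

end

section \<open>Transfer of the limit from the embedding to an arbitrary discrete model\<close>

theorem theorem2p6:
  fixes s :: real
    and N :: "'b measure" and W U V :: "nat \<Rightarrow> 'b \<Rightarrow> real"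
  assumes s: "0 < s" "s < 2"
    and cont: "continuous_model N W U V"
  shows "cont_last_passage s W U V \<in> borel_measurable N \<and>
    (AE \<omega> in N. cont_last_passage s W U V \<omega> < \<infinity>) \<and>
    (\<forall>(M :: 'a measure) (v :: int \<Rightarrow> int \<Rightarrow> 'a \<Rightarrow> real) (F :: real \<Rightarrow> real).
       discrete_model M v F \<longrightarrow>
       (\<forall>t>0. ((\<lambda>x. (1 - F (t * x)) / (1 - F x)) \<longlongrightarrow> t powr (- s)) at_top) \<longrightarrow>
       weak_conv_m
         (\<lambda>n. distr M borel (\<lambda>\<omega>. last_passage v 0 (int n) \<omega> / scaling F n))
         (distr N borel (\<lambda>\<omega>. enn2real (cont_last_passage s W U V \<omega>))))"
proof (intro conjI allI impI)
  interpret C: continuous_model N W U V by fact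
  show "cont_last_passage s W U V \<in> borel_measurable N" by (rule C.cont_last_passage_measurable)
  show "AE \<omega> in N. cont_last_passage s W U V \<omega> < \<infinity>"
    using C.generic_AE AE_space by eventually_elim (rule C.cont_last_passage_finite[OF s])
  fix M :: "'a measure" and v :: "int \<Rightarrow> int \<Rightarrow> 'a \<Rightarrow> real" and F :: "real \<Rightarrow> real"
  assume "discrete_model M v F"
    and reg: "\<forall>t>0. ((\<lambda>x. (1 - F (t * x)) / (1 - F x)) \<longlongrightarrow> t powr (- s)) at_top"
  then interpret A: discrete_model M v F by simp
  interpret R: regularly_varying_tail "distr M borel (v 0 1)" s
    by (rule A.regularly_varying_tail_weights[OF s(1)]) (use reg in auto)
  interpret E: embedded_model N W U V "distr M borel (v 0 1)" s
    by unfold_locales (rule s)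
  have F: "cdf (distr M borel (v 0 1)) = F" by (rule A.cdf_eq) simp
  show "weak_conv_m
         (\<lambda>n. distr M borel (\<lambda>\<omega>. last_passage v 0 (int n) \<omega> / scaling F n))
         (distr N borel (\<lambda>\<omega>. enn2real (cont_last_passage s W U V \<omega>)))"
    unfolding weak_conv_m_def weak_conv_def
  proof (intro allI impI)
    fix x assume "isCont (cdf (distr N borel (\<lambda>\<omega>. enn2real (cont_last_passage s W U V \<omega>)))) x"
    then have "(\<lambda>n. cdf (distr N borel (\<lambda>\<omega>. E.embedded_passage n \<omega> / scaling F n)) x)
        \<longlonglongrightarrow> cdf (distr N borel (\<lambda>\<omega>. enn2real (cont_last_passage s W U V \<omega>))) x"
      using E.weak_conv_embedded_passage
      unfolding weak_conv_m_def weak_conv_def F E.limit_passage_def[abs_def] by blast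
    \<comment> \<open>The identification of the two laws is stated for \<open>n \<ge> 1\<close>,
      hence eventual equality.\<close>
    moreover have "\<forall>\<^sub>F n in sequentially. cdf (distr N borel (\<lambda>\<omega>. E.embedded_passage n \<omega> / scaling F n)) x =
        cdf (distr M borel (\<lambda>\<omega>. last_passage v 0 (int n) \<omega> / scaling F n)) x"
      using eventually_ge_at_top[of 1]
      by eventually_elim (simp add: E.distr_embedded_passage A.distr_last_passage)
    ultimately show "(\<lambda>n. cdf (distr M borel (\<lambda>\<omega>. last_passage v 0 (int n) \<omega> / scaling F n)) x)
        \<longlonglongrightarrow> cdf (distr N borel (\<lambda>\<omega>. enn2real (cont_last_passage s W U V \<omega>))) x"
      by (rule Lim_transform_eventually)
  qed
qed

end
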